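(* Let $M$ be a Riemannian manifold of dimension at least $1$ and finite volume, let $\mathrm{Vol}_M$ denote its Riemannian volume normalized to be a probability measure, let $d \geq 1$ be an integer and let $k \in [1,\infty]$ (an integer $\ge 1$ or $\infty$). Let $v \in \mathcal{C}^k(M,\mathbb{R}^d)$, and put $g_t(x,y) := (x, y + t v(x))$ for $(x,y) \in M \times \mathbb{T}^d$ and $t \in \mathbb{R}$. If $$\mathrm{Vol}_M\big(\{x \in M : \nabla \langle \xi, v\rangle (x) = 0\}\big) = 0 \quad \text{for all } \xi \in \mathbb{Z}^d \setminus \{0\},$$ then $(M \times \mathbb{T}^d, \mathrm{Vol}_M \otimes \mathrm{Leb}_{\mathbb{T}^d}, (g_t)_{t\in\mathbb{R}})$ exhibits Keplerian shear. Moreover, the set of $v \in \mathcal{C}^k(M,\mathbb{R}^d)$ satisfying the displayed criterion is Baire generic in $\mathcal{C}^k(M,\mathbb{R}^d)$.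
   Context: $\mathbb{T}^d = \mathbb{R}^d/\mathbb{Z}^d$ with Lebesgue (Haar) probability measure $\mathrm{Leb}_{\mathbb{T}^d}$; $tv(x)$ is reduced modulo $\mathbb{Z}^d$ in $y+tv(x)$. Keplerian shear: a (measurable) flow $(\Omega,\mu,(g_t)_{t\in\mathbb{R}})$ preserving a probability measure $\mu$ exhibits Keplerian shear if for all $f \in \mathbb{L}^2(\Omega,\mu)$ one has $f\circ g_t \to \mathbb{E}_\mu(f\mid\mathcal{I})$ as $t\to+\infty$, weakly in $\mathbb{L}^2(\Omega,\mu)$, where $\mathcal{I}$ is the $\sigma$-algebra of $(g_t)$-invariant measurable sets (up to $\mu$-null sets). $\mathcal{C}^k(M,\mathbb{R}^d)$ carries the topology of uniform convergence on compact sets of all derivatives up to order $k$ (all derivatives if $k=\infty$). A set is Baire generic if it contains a countable intersection of dense open sets. *)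

theory Defs
  imports "HOL-Probability.Probability"
begin

section \<open>Functions of class \<open>C\<^sup>k\<close> between Euclidean spaces\<close>

primrec Ck_on :: "nat \<Rightarrow> 'a::real_normed_vector set \<Rightarrow> ('a \<Rightarrow> 'b::real_normed_vector) \<Rightarrow> bool" where
  "Ck_on 0 S f \<longleftrightarrow> continuous_on S f"
| "Ck_on (Suc n) S f \<longleftrightarrow>
     (\<forall>x\<in>S. f differentiable at x) \<and> (\<forall>h. Ck_on n S (\<lambda>x. frechet_derivative f (at x) h))"

text \<open>Only meant for open \<open>S\<close>, since derivatives are taken at full neighbourhoods.\<close>

definition class_C_on :: "enat \<Rightarrow> 'a::real_normed_vector set \<Rightarrow> ('a \<Rightarrow> 'b::real_normed_vector) \<Rightarrow> bool" where
  "class_C_on k S f \<longleftrightarrow> (\<forall>n. enat n \<le> k \<longrightarrow> Ck_on n S f)"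

primrec iterated_derivative ::
  "'a list \<Rightarrow> ('a::real_normed_vector \<Rightarrow> 'b::real_normed_vector) \<Rightarrow> 'a \<Rightarrow> 'b" where
  "iterated_derivative [] f = f"
| "iterated_derivative (h # hs) f =
     (\<lambda>x. frechet_derivative (iterated_derivative hs f) (at x) h)"

section \<open>Smooth and Riemannian manifolds\<close>

text \<open>
  The underlying space of a manifold is a whole type that is Hausdorff and second countable.
  A chart is a domain together with a coordinate map into \<open>\<real>\<^sup>n\<close>, where \<open>n = CARD('n) \<ge> 1\<close>.
\<close>

type_synonym ('m, 'n) chart = "'m set \<times> ('m \<Rightarrow> real ^ 'n)"

definition dom_of :: "('m, 'n) chart \<Rightarrow> 'm set" where
  "dom_of c = fst c"

definition coord :: "('m, 'n) chart \<Rightarrow> 'm \<Rightarrow> real ^ 'n" where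
  "coord c = snd c"

definition param :: "('m, 'n) chart \<Rightarrow> real ^ 'n \<Rightarrow> 'm" where
  "param c = inv_into (dom_of c) (coord c)"

definition smooth_atlas ::
  "('m::{t2_space,second_countable_topology}, 'n::finite) chart set \<Rightarrow> bool" where
  "smooth_atlas A \<longleftrightarrow>
     (\<Union>c\<in>A. dom_of c) = UNIV \<and>
     (\<forall>c\<in>A. open (dom_of c) \<and> open (coord c ` dom_of c) \<and>
        homeomorphism (dom_of c) (coord c ` dom_of c) (coord c) (param c)) \<and>
     (\<forall>c\<in>A. \<forall>c'\<in>A. class_C_on \<infinity> (coord c ` (dom_of c \<inter> dom_of c')) (coord c' \<circ> param c))"

text \<open>
  A metric is given by its Gram matrices \<open>G c x = (g\<^sub>i\<^sub>j(x))\<close> with respect to the coordinate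
  frame of each chart \<open>c\<close> around \<open>x\<close>; the last clause is the transformation law of a
  covariant 2-tensor.
\<close>

definition riemannian_metric ::
  "('m::{t2_space,second_countable_topology}, 'n::finite) chart set \<Rightarrow>
   (('m, 'n) chart \<Rightarrow> 'm \<Rightarrow> real ^ 'n ^ 'n) \<Rightarrow> bool" where
  "riemannian_metric A G \<longleftrightarrow>
     (\<forall>c\<in>A. class_C_on \<infinity> (coord c ` dom_of c) (G c \<circ> param c)) \<and>
     (\<forall>c\<in>A. \<forall>x\<in>dom_of c.
        transpose (G c x) = G c x \<and> (\<forall>u. u \<noteq> 0 \<longrightarrow> u \<bullet> (G c x *v u) > 0)) \<and>
     (\<forall>c\<in>A. \<forall>c'\<in>A. \<forall>x\<in>dom_of c \<inter> dom_of c'.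
        let J = jacobian (coord c' \<circ> param c) (at (coord c x))
        in G c x = transpose J ** G c' x ** J)"

definition riemannian_manifold ::
  "('m::{t2_space,second_countable_topology}, 'n::finite) chart set \<Rightarrow>
   (('m, 'n) chart \<Rightarrow> 'm \<Rightarrow> real ^ 'n ^ 'n) \<Rightarrow> bool" where
  "riemannian_manifold A G \<longleftrightarrow> smooth_atlas A \<and> riemannian_metric A G"

text \<open>
  The Riemannian volume is the unique Borel measure which is \<open>sqrt (det (g\<^sub>i\<^sub>j)) dx\<^sub>1 \<dots> dx\<^sub>n\<close>
  in every chart.
\<close>

definition riemannian_volume ::
  "('m::{t2_space,second_countable_topology}, 'n::finite) chart set \<Rightarrow>
   (('m, 'n) chart \<Rightarrow> 'm \<Rightarrow> real ^ 'n ^ 'n) \<Rightarrow> 'm measure \<Rightarrow> bool" where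
  "riemannian_volume A G vol \<longleftrightarrow>
     sets vol = sets borel \<and>
     (\<forall>c\<in>A. \<forall>E\<in>sets borel. E \<subseteq> dom_of c \<longrightarrow>
        emeasure vol E =
          (\<integral>\<^sup>+ z \<in> coord c ` E. ennreal (sqrt (det (G c (param c z)))) \<partial>lborel))"

definition normalized :: "'a measure \<Rightarrow> 'a measure" where
  "normalized M = scale_measure (1 / emeasure M (space M)) M"

text \<open>The components \<open>\<Sum>\<^sub>j g\<^sup>i\<^sup>j \<partial>\<^sub>j f\<close> of the gradient of \<open>f\<close> in the chart \<open>c\<close>.\<close>

definition gradient ::
  "(('m, 'n::finite) chart \<Rightarrow> 'm \<Rightarrow> real ^ 'n ^ 'n) \<Rightarrow> ('m \<Rightarrow> real) \<Rightarrow> ('m, 'n) chart \<Rightarrow> 'm \<Rightarrow> real ^ 'n" where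
  "gradient G f c x =
     matrix_inv (G c x) *v
       (\<chi> j. frechet_derivative (f \<circ> param c) (at (coord c x)) (axis j 1))"

definition gradient_vanishes ::
  "('m, 'n::finite) chart set \<Rightarrow> (('m, 'n) chart \<Rightarrow> 'm \<Rightarrow> real ^ 'n ^ 'n) \<Rightarrow> ('m \<Rightarrow> real) \<Rightarrow> 'm \<Rightarrow> bool" where
  "gradient_vanishes A G f x \<longleftrightarrow> (\<forall>c\<in>A. x \<in> dom_of c \<longrightarrow> gradient G f c x = 0)"

section \<open>The space \<open>C\<^sup>k(M, \<real>\<^sup>d)\<close> and Baire genericity\<close>

definition Ck_maps :: "('m, 'n::finite) chart set \<Rightarrow> enat \<Rightarrow> ('m \<Rightarrow> real ^ 'd::finite) set" where
  "Ck_maps A k = {v. \<forall>c\<in>A. class_C_on k (coord c ` dom_of c) (v \<circ> param c)}"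

text \<open>
  The subbasic neighbourhoods of \<open>v\<close> control one iterated partial derivative of order at
  most \<open>k\<close>, in one chart, uniformly on one compact subset of the chart domain.
\<close>

definition Ck_topology ::
  "('m::topological_space, 'n::finite) chart set \<Rightarrow> enat \<Rightarrow> ('m \<Rightarrow> real ^ 'd::finite) topology" where
  "Ck_topology A k = topology_generated_by
     {{w \<in> Ck_maps A k. \<forall>x\<in>K.
         norm (iterated_derivative hs (w \<circ> param c) (coord c x)
               - iterated_derivative hs (v \<circ> param c) (coord c x)) < e}
      | v c K hs e.
        v \<in> Ck_maps A k \<and> c \<in> A \<and> compact K \<and> K \<subseteq> dom_of c \<and>
        hs \<in> lists Basis \<and> enat (length hs) \<le> k \<and> e > 0}"

definition baire_generic :: "'a topology \<Rightarrow> 'a set \<Rightarrow> bool" where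
  "baire_generic X S \<longleftrightarrow>
     S \<subseteq> topspace X \<and>
     (\<exists>\<U>. countable \<U> \<and> (\<forall>U\<in>\<U>. openin X U \<and> X closure_of U = topspace X) \<and>
        topspace X \<inter> \<Inter>\<U> \<subseteq> S)"

section \<open>The torus\<close>

definition integer_vectors :: "(real ^ 'd) set" where
  "integer_vectors = {\<xi>. \<forall>i. \<xi> $ i \<in> \<int>}"

lemma integer_vectors_0: "0 \<in> integer_vectors"
  by (simp add: integer_vectors_def)

lemma integer_vectors_uminus: "\<xi> \<in> integer_vectors \<Longrightarrow> - \<xi> \<in> integer_vectors"
  by (simp add: integer_vectors_def)

lemma integer_vectors_add:
  "\<xi> \<in> integer_vectors \<Longrightarrow> \<eta> \<in> integer_vectors \<Longrightarrow> \<xi> + \<eta> \<in> integer_vectors"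
  by (simp add: integer_vectors_def)

quotient_type 'd torus = "real ^ 'd::finite" / "\<lambda>x y. x - y \<in> integer_vectors"
  morphisms rep_torus torus_proj
proof (intro equivpI reflpI sympI transpI)
  fix x y z :: "real ^ 'd"
  show "x - x \<in> integer_vectors"
    by (simp add: integer_vectors_0)
  show "y - x \<in> integer_vectors" if "x - y \<in> integer_vectors"
    using integer_vectors_uminus[OF that] by simp
  show "x - z \<in> integer_vectors" if "x - y \<in> integer_vectors" "y - z \<in> integer_vectors"
    using integer_vectors_add[OF that] by simp
qed

instantiation torus :: (finite) ab_group_add
begin

lift_definition zero_torus :: "'a torus" is 0 .

lift_definition plus_torus :: "'a torus \<Rightarrow> 'a torus \<Rightarrow> 'a torus" is "(+)"
  by (drule (1) integer_vectors_add) (simp add: algebra_simps)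

lift_definition uminus_torus :: "'a torus \<Rightarrow> 'a torus" is uminus
  by (drule integer_vectors_uminus) (simp add: algebra_simps)

definition minus_torus :: "'a torus \<Rightarrow> 'a torus \<Rightarrow> 'a torus" where
  "minus_torus x y = x + - y"

instance
proof
  fix a b c :: "'a torus"
  show "a + b + c = a + (b + c)" by transfer (simp add: integer_vectors_0 add.assoc)
  show "a + b = b + a" by transfer (simp add: integer_vectors_0 add.commute)
  show "0 + a = a" by transfer (simp add: integer_vectors_0)
  show "- a + a = 0" by transfer (simp add: integer_vectors_0)
  show "a - b = a + - b" by (fact minus_torus_def)
qed

end

instantiation torus :: (finite) topological_space
begin

definition open_torus :: "'a torus set \<Rightarrow> bool" where
  "open_torus U \<longleftrightarrow> open (torus_proj -` U)"

instance
  by standard (auto simp: open_torus_def vimage_Int vimage_Union)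

end

definition torus_measure :: "('d::finite) torus measure" where
  "torus_measure = distr (restrict_space lborel {x. \<forall>i. 0 \<le> x $ i \<and> x $ i < 1}) borel torus_proj"

section \<open>Keplerian shear\<close>

definition square_integrable :: "'a measure \<Rightarrow> ('a \<Rightarrow> real) set" where
  "square_integrable M = {f \<in> borel_measurable M. integrable M (\<lambda>x. (f x)\<^sup>2)}"

definition weakly_tendsto_L2 ::
  "'a measure \<Rightarrow> ('i \<Rightarrow> 'a \<Rightarrow> real) \<Rightarrow> ('a \<Rightarrow> real) \<Rightarrow> 'i filter \<Rightarrow> bool" where
  "weakly_tendsto_L2 M F f filt \<longleftrightarrow>
     f \<in> square_integrable M \<and>
     (\<forall>h\<in>square_integrable M. ((\<lambda>i. \<integral>x. F i x * h x \<partial>M) \<longlongrightarrow> (\<integral>x. f x * h x \<partial>M)) filt)"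

definition measure_preserving_flow :: "'a measure \<Rightarrow> (real \<Rightarrow> 'a \<Rightarrow> 'a) \<Rightarrow> bool" where
  "measure_preserving_flow M g \<longleftrightarrow>
     (\<lambda>(t, x). g t x) \<in> measurable (borel \<Otimes>\<^sub>M M) M \<and>
     (\<forall>x\<in>space M. g 0 x = x) \<and>
     (\<forall>s t. \<forall>x\<in>space M. g (s + t) x = g s (g t x)) \<and>
     (\<forall>t. distr M M (g t) = M)"

definition invariant_algebra :: "'a measure \<Rightarrow> (real \<Rightarrow> 'a \<Rightarrow> 'a) \<Rightarrow> 'a measure" where
  "invariant_algebra M g =
     sigma (space M) {B \<in> sets M. \<forall>t. AE x in M. g t x \<in> B \<longleftrightarrow> x \<in> B}"

definition keplerian_shear :: "'a measure \<Rightarrow> (real \<Rightarrow> 'a \<Rightarrow> 'a) \<Rightarrow> bool" where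
  "keplerian_shear M g \<longleftrightarrow>
     prob_space M \<and> measure_preserving_flow M g \<and>
     (\<forall>f\<in>square_integrable M.
        weakly_tendsto_L2 M (\<lambda>t. f \<circ> g t) (real_cond_exp M (invariant_algebra M g) f) at_top)"

section \<open>The shear flow and the criterion\<close>

definition shear_flow ::
  "('m \<Rightarrow> real ^ 'd) \<Rightarrow> real \<Rightarrow> 'm \<times> 'd::finite torus \<Rightarrow> 'm \<times> 'd torus" where
  "shear_flow v t = (\<lambda>(x, y). (x, y + torus_proj (t *\<^sub>R v x)))"

definition shear_criterion ::
  "('m, 'n::finite) chart set \<Rightarrow> (('m, 'n) chart \<Rightarrow> 'm \<Rightarrow> real ^ 'n ^ 'n) \<Rightarrow> 'm measure \<Rightarrow>
   ('m \<Rightarrow> real ^ 'd::finite) \<Rightarrow> bool" where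
  "shear_criterion A G vol v \<longleftrightarrow>
     (\<forall>\<xi>\<in>integer_vectors - {0}.
        {x. gradient_vanishes A G (\<lambda>y. \<xi> \<bullet> v y) x} \<in> null_sets (normalized vol))"

end

theory Submission
  imports Defs
begin

text \<open>
Keplerian shear asks that \<open>\<integral> (f \<circ> g\<^sub>t) h\<close> converges to \<open>\<integral> E(f | \<I>) h\<close>. For
fixed bounded \<open>h\<close> both sides are Lipschitz in \<open>f\<close> for the \<open>L\<^sup>1\<close> norm, uniformly in \<open>t\<close>, so it
suffices to treat a class of functions whose closed linear span is all of \<open>L\<^sup>1\<close>
(\<open>keplerian_shear_if_shears_pi_system\<close>). On \<open>M \<times> \<T>\<^sup>d\<close> the class consists of the products
of an indicator in \<open>x\<close> with a character \<open>cos (2\<pi> \<langle>\<xi>, y\<rangle>)\<close> or \<open>sin (2\<pi> \<langle>\<xi>, y\<rangle>)\<close>; that these span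
follows from the Stone-Weierstrass theorem. Along the flow a character of frequency \<open>\<xi>\<close> is multiplied by
the oscillating factor \<open>exp (2\<pi>i t \<langle>\<xi>, v x\<rangle>)\<close>. For \<open>\<xi> = 0\<close> the function is invariant. For \<open>\<xi> \<noteq> 0\<close> the
integral tends to \<open>0\<close> by the Riemann-Lebesgue lemma, provided that \<open>\<langle>\<xi>, v\<rangle>\<close> has an absolutely continuous
law (\<open>keplerian_shear_shear_flow\<close>). A weak limit that is invariant is automatically the
conditional expectation (\<open>weak_limit_eq_cond_exp\<close>).

The criterion provides the absolute continuity: near a point where \<open>\<langle>\<xi>, v\<rangle>\<close> has a nonzero
partial derivative this function can serve as a coordinate, so the preimage of a Lebesgue null set is null
there (\<open>negligible_noncritical_level\<close>); countably many charts cover all such points, and the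
remaining points are null by hypothesis.

For genericity, cover \<open>M\<close> by countably many compact coordinate balls \<open>K\<close>, and consider for each \<open>\<xi> \<noteq> 0\<close>
and each \<open>m\<close> the set of all \<open>v\<close> for which the critical points of \<open>\<langle>\<xi>, v\<rangle>\<close> in \<open>K\<close> have volume
less than \<open>1/(m + 1)\<close>. These sets are open (\<open>openin_few_critical\<close>), since the critical set in \<open>K\<close> is
the intersection of the decreasing sets on which all first derivatives are at most \<open>1/(p + 1)\<close>. They are dense
(\<open>dense_few_critical\<close>): adding \<open>s \<eta> \<xi>\<close> to \<open>v\<close>, with \<open>\<eta>\<close> a smooth bump without critical points
in \<open>K\<close> except the centre, produces critical sets that are disjoint for different \<open>s\<close> up to the
centre, so that in a space of finite volume their measures tend to \<open>0\<close> along any sequence of distinct \<open>s\<close>.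
Their intersection is contained in the set of all \<open>v\<close> that satisfy the criterion.
\<close>

section \<open>The Riemann-Lebesgue lemma for phases with absolutely continuous law\<close>

lemma tendsto_zero_if_approximated:
  fixes K :: "'t \<Rightarrow> real"
  assumes L: "\<And>i::nat. (L i \<longlongrightarrow> 0) F"
    and approx: "\<And>i. \<forall>\<^sub>F t in F. \<bar>K t - L i t\<bar> \<le> e i"
    and e: "e \<longlonglongrightarrow> 0"
  shows "(K \<longlongrightarrow> 0) F"
proof (rule tendstoI)
  fix r :: real assume "r > 0"
  then have "\<forall>\<^sub>F i in sequentially. dist (e i) 0 < r / 2"
    using e by (intro tendstoD) auto
  then obtain i where i: "\<bar>e i\<bar> < r / 2"
    by (auto simp: dist_real_def dest: eventually_happens)
  have "\<forall>\<^sub>F t in F. dist (L i t) 0 < r / 2"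
    using L[of i] \<open>r > 0\<close> by (intro tendstoD) auto
  with approx[of i] show "\<forall>\<^sub>F t in F. dist (K t) 0 < r"
  proof eventually_elim
    case (elim t)
    then show ?case using i by (simp add: dist_real_def)
  qed
qed

text \<open>
A closed subspace of \<open>L\<^sup>1\<close> that contains the indicators of a generating \<open>\<inter>\<close>-stable family is everything: the
sets whose indicator it contains form a Dynkin system, because countable disjoint unions are
dominated limits, and integrable functions are limits of linear combinations of indicators.
\<close>

lemma L1_dense_of_indicators:
  fixes M :: "'a measure" and \<F> :: "('a \<Rightarrow> real) set"
  assumes M: "finite_measure M" "sets M = sigma_sets (space M) P"
    and P: "Int_stable P" "P \<subseteq> Pow (space M)"
    and basis: "\<And>A. A \<in> P \<Longrightarrow> indicator A \<in> \<F>" "indicator (space M) \<in> \<F>"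
    and add: "\<And>f g. integrable M f \<Longrightarrow> integrable M g \<Longrightarrow> f \<in> \<F> \<Longrightarrow> g \<in> \<F> \<Longrightarrow> (\<lambda>x. f x + g x) \<in> \<F>"
    and scale: "\<And>f c. integrable M f \<Longrightarrow> f \<in> \<F> \<Longrightarrow> (\<lambda>x. c * f x) \<in> \<F>"
    and lim: "\<And>s f. (\<And>i::nat. integrable M (s i)) \<Longrightarrow> (\<And>i. s i \<in> \<F>) \<Longrightarrow> integrable M f \<Longrightarrow>
               (\<lambda>i. \<integral>x. \<bar>s i x - f x\<bar> \<partial>M) \<longlonglongrightarrow> 0 \<Longrightarrow> f \<in> \<F>"
    and f: "integrable M f"
  shows "f \<in> \<F>"
proof -
  interpret finite_measure M by fact
  have int_ind: "integrable M (indicator A :: 'a \<Rightarrow> real)" if "A \<in> sets M" for A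
    using that by (simp add: less_top[symmetric])
  have diff: "(\<lambda>x. f x - g x) \<in> \<F>" if "integrable M f" "integrable M g" "f \<in> \<F>" "g \<in> \<F>" for f g
    using add[OF that(1) _ that(3) scale[OF that(2,4), of "-1"]] that by simp
  have dom: "f \<in> \<F>"
    if s: "\<And>i. integrable M (s i)" "\<And>i. s i \<in> \<F>" "\<And>x. x \<in> space M \<Longrightarrow> (\<lambda>i. s i x) \<longlonglongrightarrow> f x"
      and bd: "\<And>i x. x \<in> space M \<Longrightarrow> \<bar>s i x\<bar> \<le> w x" "integrable M w" and f: "integrable M f"
    for s :: "nat \<Rightarrow> 'a \<Rightarrow> real" and f w
  proof (rule lim[OF s(1,2) f])
    have [measurable]: "s i \<in> borel_measurable M" "f \<in> borel_measurable M" for i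
      using s f by auto
    have "(\<lambda>i. \<integral>x. \<bar>s i x - f x\<bar> \<partial>M) \<longlonglongrightarrow> (\<integral>x. 0 \<partial>M)"
    proof (rule integral_dominated_convergence[where w = "\<lambda>x. w x + \<bar>f x\<bar>"])
      show "AE x in M. (\<lambda>i. \<bar>s i x - f x\<bar>) \<longlonglongrightarrow> 0"
        by (rule AE_I2, rule tendsto_rabs_zero, rule LIM_zero[OF s(3)])
      show "AE x in M. norm \<bar>s i x - f x\<bar> \<le> w x + \<bar>f x\<bar>" for i
        using bd(1)[of _ i] by (intro AE_I2) (smt (verit) real_norm_def)
    qed (use bd f in auto)
    then show "(\<lambda>i. \<integral>x. \<bar>s i x - f x\<bar> \<partial>M) \<longlonglongrightarrow> 0" by simp
  qed
  have sets: "indicator A \<in> \<F>" if "A \<in> sets M" for A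
    using P that[unfolded M(2)]
  proof (induction rule: sigma_sets_induct_disjoint)
    case empty
    have "(\<lambda>x. 0 * indicator (space M) x :: real) \<in> \<F>"
      by (intro scale basis int_ind) auto
    then show ?case by (simp add: indicator_def[abs_def])
  next
    case (compl A)
    then have A: "A \<in> sets M" by (simp add: M(2))
    have "(\<lambda>x. indicator (space M) x - indicator A x :: real) \<in> \<F>"
      using A compl basis by (intro diff int_ind) auto
    moreover have "(\<lambda>x. indicator (space M) x - indicator A x :: real) = indicator (space M - A)"
      using sets.sets_into_space[OF A] by (auto simp: fun_eq_iff indicator_def)
    ultimately show ?case by simp
  next
    case (union A)
    have A: "A i \<in> sets M" for i using union by (auto simp: M(2))
    have fin: "(\<lambda>x. \<Sum>i<n. indicator (A i) x :: real) \<in> \<F>" for n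
    proof (induction n)
      case 0
      have "(\<lambda>x. 0 * indicator (space M) x :: real) \<in> \<F>"
        by (intro scale basis int_ind) auto
      then show ?case by simp
    next
      case (Suc n)
      show ?case unfolding sum.lessThan_Suc
        by (rule add[OF _ _ Suc union(3)]) (auto intro!: int_ind A Bochner_Integration.integrable_sum)
    qed
    have sum: "(\<Sum>i<n. indicator (A i) x :: real) = indicator (\<Union>i<n. A i) x" for n x
      using union(1) by (subst indicator_UN_disjoint) (auto simp: disjoint_family_on_def)
    show ?case
    proof (rule dom[where s = "\<lambda>n x. \<Sum>i<n. indicator (A i) x" and w = "\<lambda>_. 1"])
      show "(\<lambda>n. \<Sum>i<n. indicator (A i) x :: real) \<longlonglongrightarrow> indicator (\<Union> (range A)) x" for x
        unfolding sum by (rule LIMSEQ_indicator_UN)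
      show "\<bar>\<Sum>i<n. indicator (A i) x :: real\<bar> \<le> 1" for n x
        unfolding sum by (auto simp: indicator_def)
    qed (use fin A in \<open>auto intro!: int_ind Bochner_Integration.integrable_sum\<close>)
  qed (use basis in auto)
  show ?thesis
    using f
  proof (induction rule: integrable_induct)
    case (base A c)
    then show ?case
      using scale[OF int_ind[OF base(1)] sets[OF base(1)], of c] by (simp add: mult.commute)
  next
    case (add f g)
    show ?case using assms(7)[OF add] .
  next
    case (lim f s)
    then show ?case
      by (rule_tac dom[where s = s and w = "\<lambda>x. 2 * \<bar>f x\<bar>"]) auto
  qed
qed

text \<open>
The kernel \<open>k\<close> is a sine or a cosine in all applications; what matters is that it has a bounded primitive
\<open>K\<close>, which makes the integral over an interval of size \<open>O(1/t)\<close>. Density in \<open>L\<^sup>1\<close> is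
applied to Lebesgue measure on a window \<open>[-n, n]\<close>, where it is finite, before \<open>n\<close> tends to infinity.
\<close>

lemma Riemann_Lebesgue_lborel:
  fixes k K p :: "real \<Rightarrow> real"
  assumes K: "\<And>x. (K has_real_derivative k x) (at x)" and cont: "continuous_on UNIV k"
    and bound: "\<And>x. \<bar>k x\<bar> \<le> 1" "\<And>x. \<bar>K x\<bar> \<le> 1"
    and p: "integrable lborel p"
  shows "((\<lambda>t. \<integral>x. p x * k (t * x) \<partial>lborel) \<longlongrightarrow> 0) at_top"
proof -
  have [measurable]: "k \<in> borel_measurable borel"
    using cont by (rule borel_measurable_continuous_onI)
  have intk: "integrable M (\<lambda>x. f x * k (t * x))"
    if f: "integrable M f" and [measurable_cong]: "sets M = sets borel" for f t and M :: "real measure"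
  proof (rule Bochner_Integration.integrable_bound[OF f])
    have [measurable]: "f \<in> borel_measurable M" using f by auto
    show "(\<lambda>x. f x * k (t * x)) \<in> borel_measurable M" by measurable
    show "AE x in M. norm (f x * k (t * x)) \<le> norm (f x)"
      using bound(1) by (intro AE_I2) (simp add: abs_mult mult_left_le)
  qed
  have interval: "((\<lambda>t. \<integral>x. indicator {a..b} x * k (t * x) \<partial>lborel) \<longlongrightarrow> 0) at_top" for a b :: real
  proof (cases "a \<le> b")
    case True
    have eq: "(\<integral>x. indicator {a..b} x * k (t * x) \<partial>lborel) = K (t * b) / t - K (t * a) / t" if "t > 0" for t
    proof -
      have "(\<integral>x. k (t * x) * indicator {a..b} x \<partial>lborel) = K (t * b) / t - K (t * a) / t"
      proof (rule integral_FTC_Icc_real[OF True])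
        show "((\<lambda>x. K (t * x) / t) has_real_derivative k (t * x)) (at x)" for x
          using that by (auto intro!: derivative_eq_intros DERIV_chain2[OF K])
        have "continuous_on UNIV (\<lambda>x. k (t * x))"
          by (rule continuous_on_compose2[OF cont]) (auto intro: continuous_intros)
        then show "isCont (\<lambda>x. k (t * x)) x" for x
          by (simp add: continuous_on_eq_continuous_at)
      qed
      then show ?thesis by (simp add: mult.commute)
    qed
    show ?thesis
    proof (rule Lim_null_comparison)
      show "\<forall>\<^sub>F t in at_top. norm (\<integral>x. indicator {a..b} x * k (t * x) \<partial>lborel) \<le> 2 / t"
        using eventually_gt_at_top[of "0::real"]
      proof eventually_elim
        case (elim t)
        have "\<bar>K (t * b) - K (t * a)\<bar> \<le> 2"
          using bound(2)[of "t * b"] bound(2)[of "t * a"] by linarith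
        then show ?case
          unfolding eq[OF elim] using elim by (simp add: diff_divide_distrib[symmetric] divide_right_mono)
      qed
      show "((\<lambda>t::real. 2 / t) \<longlongrightarrow> 0) at_top"
        by (intro tendsto_divide_0[OF tendsto_const] filterlim_at_top_imp_at_infinity filterlim_ident)
    qed
  qed (simp add: indicator_def)
  have window: "((\<lambda>t. \<integral>x. f x * k (t * x) \<partial>density lborel (indicator {- n..n})) \<longlongrightarrow> 0) at_top"
    if f: "integrable (density lborel (indicator {- n..n})) f" for f and n :: real
  proof -
    let ?M = "density lborel (\<lambda>x. ennreal (indicator {- n..n} x))"
    have M_eq: "density lborel (indicator {- n..n}) = ?M"
      by (rule density_cong) (auto simp: indicator_def)
    have fin: "finite_measure ?M"
      by (rule finite_measureI) (auto simp: emeasure_density ennreal_indicator less_top[symmetric] emeasure_lborel_Icc_eq)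
    have dens: "(\<integral>x. g x * k (t * x) \<partial>?M) = (\<integral>x. indicator {- n..n} x * (g x * k (t * x)) \<partial>lborel)"
      if [measurable]: "g \<in> borel_measurable borel" for g t
      by (subst integral_real_density) auto
    have half: "((\<lambda>t. \<integral>x. indicator {..a} x * k (t * x) \<partial>?M) \<longlongrightarrow> 0) at_top" for a
    proof -
      have "(\<integral>x. indicator {..a} x * k (t * x) \<partial>?M) = (\<integral>x. indicator {- n..min a n} x * k (t * x) \<partial>lborel)" for t
        by (subst dens) (auto intro!: Bochner_Integration.integral_cong simp: indicator_def)
      then show ?thesis using interval by simp
    qed
    have all: "((\<lambda>t. \<integral>x. indicator UNIV x * k (t * x) \<partial>?M) \<longlongrightarrow> 0) at_top"
    proof -
      have "(\<integral>x. indicator UNIV x * k (t * x) \<partial>?M) = (\<integral>x. indicator {- n..n} x * k (t * x) \<partial>lborel)" for t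
        by (subst dens) (auto intro!: Bochner_Integration.integral_cong simp: indicator_def)
      then show ?thesis using interval by simp
    qed
    let ?\<F> = "{f. ((\<lambda>t. \<integral>x. f x * k (t * x) \<partial>?M) \<longlongrightarrow> 0) at_top}"
    have "f \<in> ?\<F>"
    proof (rule L1_dense_of_indicators[OF fin, where P = "range (\<lambda>a::real. {..a})"])
      show "sets ?M = sigma_sets (space ?M) (range (\<lambda>a::real. {..a}))"
        by (simp add: borel_eq_atMost)
      have "{..a} \<inter> {..b} = {..min a b}" for a b :: real by auto
      then show "Int_stable (range (\<lambda>a::real. {..a}))"
        by (auto simp: Int_stable_def)
    next
      fix f g assume *: "integrable ?M f" "integrable ?M g"
        "f \<in> ?\<F>" "g \<in> ?\<F>"
      then show "(\<lambda>x. f x + g x) \<in> ?\<F>"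
        using tendsto_add[of _ 0 _ _ 0] by (auto simp: distrib_right intk)
    next
      fix f and c :: real assume *: "integrable ?M f"
        "f \<in> ?\<F>"
      then show "(\<lambda>x. c * f x) \<in> ?\<F>"
        using tendsto_mult_right_zero[of _ _ c] by (auto simp: mult.assoc)
    next
      fix s f assume s: "\<And>i::nat. integrable ?M (s i)"
        "\<And>i. s i \<in> ?\<F>"
        and f: "integrable ?M f" and lim: "(\<lambda>i. \<integral>x. \<bar>s i x - f x\<bar> \<partial>?M) \<longlonglongrightarrow> 0"
      have "((\<lambda>t. \<integral>x. f x * k (t * x) \<partial>?M) \<longlongrightarrow> 0) at_top"
      proof (rule tendsto_zero_if_approximated[OF _ always_eventually lim, rule_format])
        show "((\<lambda>t. \<integral>x. s i x * k (t * x) \<partial>?M) \<longlongrightarrow> 0) at_top" for i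
          using s(2) by auto
        fix i t
        have "(\<integral>x. f x * k (t * x) \<partial>?M) - (\<integral>x. s i x * k (t * x) \<partial>?M) = (\<integral>x. (f x - s i x) * k (t * x) \<partial>?M)"
          using f s by (simp add: left_diff_distrib intk)
        also have "\<bar>\<dots>\<bar> \<le> (\<integral>x. \<bar>s i x - f x\<bar> \<partial>?M)"
        proof (rule order_trans[OF integral_abs_bound integral_mono])
          show "integrable ?M (\<lambda>x. \<bar>(f x - s i x) * k (t * x)\<bar>)" "integrable ?M (\<lambda>x. \<bar>s i x - f x\<bar>)"
            using f s by (auto intro!: integrable_abs intk)
          show "\<bar>(f x - s i x) * k (t * x)\<bar> \<le> \<bar>s i x - f x\<bar>" for x
            using bound(1)[of "t * x"] by (simp add: abs_mult mult_left_le abs_minus_commute)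
        qed
        finally show "\<bar>(\<integral>x. f x * k (t * x) \<partial>?M) - (\<integral>x. s i x * k (t * x) \<partial>?M)\<bar> \<le> (\<integral>x. \<bar>s i x - f x\<bar> \<partial>?M)" .
      qed
      then show "f \<in> ?\<F>" by simp
    qed (use half all f in \<open>auto simp: M_eq\<close>)
    then show ?thesis by (simp add: M_eq)
  qed
  have [measurable]: "p \<in> borel_measurable borel" using p by auto
  let ?W = "\<lambda>n :: nat. {- real n..real n}"
  show ?thesis
  proof (rule tendsto_zero_if_approximated[OF _ always_eventually, rule_format])
    show "((\<lambda>t. \<integral>x. indicator (?W n) x * (p x * k (t * x)) \<partial>lborel) \<longlongrightarrow> 0) at_top" for n
    proof -
      let ?M = "density lborel (\<lambda>x. ennreal (indicator (?W n) x))"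
      have "integrable ?M p"
        using p by (subst integrable_real_density) (auto intro: integrable_real_mult_indicator simp: mult.commute)
      then have "((\<lambda>t. \<integral>x. p x * k (t * x) \<partial>?M) \<longlongrightarrow> 0) at_top"
        using window[of "real n" p] by (simp add: ennreal_indicator)
      then show ?thesis
        by (subst (asm) integral_real_density) auto
    qed
    show "\<bar>(\<integral>x. p x * k (t * x) \<partial>lborel) - (\<integral>x. indicator (?W n) x * (p x * k (t * x)) \<partial>lborel)\<bar>
        \<le> (\<integral>x. indicator (- ?W n) x * \<bar>p x\<bar> \<partial>lborel)" for n t
    proof -
      have *: "integrable lborel (\<lambda>x. indicator A x * (p x * k (t * x)))" if "A \<in> sets borel" for A :: "real set"
        using integrable_real_mult_indicator[OF _ intk[OF p, of t], of A] that
        by (simp add: mult.commute[of _ "indicator A _"])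
      have "(\<integral>x. p x * k (t * x) \<partial>lborel) - (\<integral>x. indicator (?W n) x * (p x * k (t * x)) \<partial>lborel)
          = (\<integral>x. p x * k (t * x) - indicator (?W n) x * (p x * k (t * x)) \<partial>lborel)"
        by (rule Bochner_Integration.integral_diff[symmetric]) (auto intro: intk p *)
      also have "\<dots> = (\<integral>x. indicator (- ?W n) x * (p x * k (t * x)) \<partial>lborel)"
        by (rule Bochner_Integration.integral_cong) (auto simp: indicator_def)
      also have "\<bar>\<dots>\<bar> \<le> (\<integral>x. indicator (- ?W n) x * \<bar>p x\<bar> \<partial>lborel)"
      proof (rule order_trans[OF integral_abs_bound integral_mono])
        show "integrable lborel (\<lambda>x. \<bar>indicator (- ?W n) x * (p x * k (t * x))\<bar>)"
          by (intro integrable_abs *) auto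
        show "integrable lborel (\<lambda>x. indicator (- ?W n) x * \<bar>p x\<bar>)"
          using integrable_real_mult_indicator[OF _ integrable_abs[OF p], of "- ?W n"] by (simp add: mult.commute)
        show "\<bar>indicator (- ?W n) x * (p x * k (t * x))\<bar> \<le> indicator (- ?W n) x * \<bar>p x\<bar>" for x
          using bound(1)[of "t * x"] by (simp add: abs_mult mult_left_le indicator_def)
      qed
      finally show ?thesis .
    qed
    have "(\<lambda>n. \<integral>x. indicator (- ?W n) x * \<bar>p x\<bar> \<partial>lborel) \<longlonglongrightarrow> (\<integral>x. 0 \<partial>(lborel :: real measure))"
    proof (rule integral_dominated_convergence[where w = "\<lambda>x. \<bar>p x\<bar>"])
      show "AE x in lborel. (\<lambda>n. indicator (- ?W n) x * \<bar>p x\<bar>) \<longlonglongrightarrow> 0"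
      proof (rule AE_I2, rule tendsto_eventually)
        fix x :: real
        obtain N :: nat where "\<bar>x\<bar> \<le> real N" using real_arch_simple by blast
        then show "\<forall>\<^sub>F n in sequentially. indicator (- ?W n) x * \<bar>p x\<bar> = 0"
          unfolding eventually_sequentially by (intro exI[of _ N]) (auto simp: indicator_def)
      qed
    qed (use p in \<open>auto simp: indicator_def\<close>)
    then show "(\<lambda>n. \<integral>x. indicator (- ?W n) x * \<bar>p x\<bar> \<partial>lborel) \<longlonglongrightarrow> 0" by simp
  qed
qed

text \<open>
For \<open>\<psi> \<ge> 0\<close> the law of \<open>u\<close> under the measure \<open>\<psi> dM\<close> is absolutely continuous; the claim is the
Riemann-Lebesgue lemma for its Radon-Nikodym density.
\<close>

lemma Riemann_Lebesgue_phase: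
  fixes k K :: "real \<Rightarrow> real" and \<psi> u :: "'a \<Rightarrow> real"
  assumes K: "\<And>x. (K has_real_derivative k x) (at x)" and cont: "continuous_on UNIV k"
    and bound: "\<And>x. \<bar>k x\<bar> \<le> 1" "\<And>x. \<bar>K x\<bar> \<le> 1"
    and u[measurable]: "u \<in> borel_measurable M"
    and ac: "\<And>Z. Z \<in> null_sets lborel \<Longrightarrow> u -` Z \<inter> space M \<in> null_sets M"
    and \<psi>: "integrable M \<psi>"
  shows "((\<lambda>t. \<integral>x. \<psi> x * k (t * u x) \<partial>M) \<longlongrightarrow> 0) at_top"
proof -
  have [measurable]: "k \<in> borel_measurable borel"
    using cont by (rule borel_measurable_continuous_onI)
  have nonneg: "((\<lambda>t. \<integral>x. \<psi> x * k (t * u x) \<partial>M) \<longlongrightarrow> 0) at_top"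
    if \<psi>: "integrable M \<psi>" "\<And>x. \<psi> x \<ge> 0" for \<psi> :: "'a \<Rightarrow> real"
  proof -
    have [measurable]: "\<psi> \<in> borel_measurable M" using \<psi> by auto
    define \<rho> where "\<rho> = distr (density M \<psi>) lborel u"
    have "emeasure (density M \<psi>) (space M) < \<infinity>"
      using \<psi> by (simp add: emeasure_density integrable_iff_bounded cong: nn_integral_cong)
    then have fin: "finite_measure \<rho>"
      unfolding \<rho>_def by (intro finite_measure.finite_measure_distr finite_measureI) auto
    have acl: "absolutely_continuous lborel \<rho>"
      unfolding absolutely_continuous_def
    proof
      fix Z :: "real set" assume Z: "Z \<in> null_sets lborel"
      then have [measurable]: "Z \<in> sets borel" by auto
      have "AE x in M. \<psi> x * indicator (u -` Z \<inter> space M) x = 0"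
        using AE_not_in[OF ac[OF Z]] by eventually_elim auto
      then have "emeasure (density M \<psi>) (u -` Z \<inter> space M) = 0"
        by (subst emeasure_density) (auto simp: nn_integral_0_iff_AE indicator_def)
      then show "Z \<in> null_sets \<rho>"
        unfolding \<rho>_def by (auto simp: null_sets_def emeasure_distr)
    qed
    obtain D where D[measurable]: "D \<in> borel_measurable lborel"
      and RN: "AE x in lborel. RN_deriv lborel \<rho> x = ennreal (D x)" and D0: "\<And>x. 0 \<le> D x"
      using sigma_finite_measure.real_RN_deriv[OF sigma_finite_lborel fin acl] by (auto simp: \<rho>_def)
    have dens: "density lborel D = \<rho>"
    proof -
      have "density lborel (RN_deriv lborel \<rho>) = \<rho>"
        by (rule sigma_finite_measure.density_RN_deriv[OF sigma_finite_lborel acl]) (simp add: \<rho>_def)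
      moreover have "density lborel (RN_deriv lborel \<rho>) = density lborel D"
        using RN by (intro density_cong) auto
      ultimately show ?thesis by simp
    qed
    have "emeasure \<rho> UNIV = (\<integral>\<^sup>+x. D x \<partial>lborel)"
      unfolding dens[symmetric] by (simp add: emeasure_density)
    \<comment> \<open>the total mass of the density is the mass of the finite measure \<open>\<rho>\<close>\<close>
    then have "integrable lborel D"
      using finite_measure.emeasure_finite[OF fin, of UNIV] D0
      by (auto simp: integrable_iff_bounded less_top)
    then have "((\<lambda>t. \<integral>x. D x * k (t * x) \<partial>lborel) \<longlongrightarrow> 0) at_top"
      by (intro Riemann_Lebesgue_lborel[OF K cont bound])
    moreover have "(\<integral>x. D x * k (t * x) \<partial>lborel) = (\<integral>x. \<psi> x * k (t * u x) \<partial>M)" for t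
    proof -
      have "(\<integral>x. D x * k (t * x) \<partial>lborel) = (\<integral>x. k (t * x) \<partial>\<rho>)"
        unfolding dens[symmetric] using D0 by (subst integral_real_density) auto
      also have "\<dots> = (\<integral>x. k (t * u x) \<partial>density M \<psi>)"
        unfolding \<rho>_def by (subst integral_distr) auto
      also have "\<dots> = (\<integral>x. \<psi> x * k (t * u x) \<partial>M)"
        using \<psi> by (subst integral_real_density) auto
      finally show ?thesis .
    qed
    ultimately show ?thesis by simp
  qed
  have [measurable]: "\<psi> \<in> borel_measurable M" using \<psi> by auto
  have int: "integrable M (\<lambda>x. f x * k (t * u x))" if f: "integrable M f" for f t
  proof (rule Bochner_Integration.integrable_bound[OF f])
    have [measurable]: "f \<in> borel_measurable M" using f by auto
    show "(\<lambda>x. f x * k (t * u x)) \<in> borel_measurable M" by measurable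
    show "AE x in M. norm (f x * k (t * u x)) \<le> norm (f x)"
      using bound(1) by (intro AE_I2) (simp add: abs_mult mult_left_le)
  qed
  have parts: "integrable M (\<lambda>x. max 0 (\<psi> x))" "integrable M (\<lambda>x. max 0 (- \<psi> x))"
    using \<psi> by auto
  have split: "\<psi> x * c = max 0 (\<psi> x) * c - max 0 (- \<psi> x) * c" for x c
    by (auto simp: max_def)
  have "(\<integral>x. \<psi> x * k (t * u x) \<partial>M) =
      (\<integral>x. max 0 (\<psi> x) * k (t * u x) \<partial>M) - (\<integral>x. max 0 (- \<psi> x) * k (t * u x) \<partial>M)" for t
    unfolding split by (rule Bochner_Integration.integral_diff) (intro int parts)+
  then show ?thesis
    using tendsto_diff[OF nonneg[OF parts(1)] nonneg[OF parts(2)]] by simp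
qed

section \<open>Weak limits along measure-preserving flows\<close>

lemma square_integrable_mult:
  assumes "f \<in> square_integrable M" "g \<in> square_integrable M"
  shows "integrable M (\<lambda>x. f x * g x)"
    and "(\<integral>x. \<bar>f x * g x\<bar> \<partial>M) \<le> sqrt (\<integral>x. (f x)\<^sup>2 \<partial>M) * sqrt (\<integral>x. (g x)\<^sup>2 \<partial>M)"
proof -
  have [measurable]: "f \<in> borel_measurable M" "g \<in> borel_measurable M"
    and int: "integrable M (\<lambda>x. (f x)\<^sup>2)" "integrable M (\<lambda>x. (g x)\<^sup>2)"
    using assms by (auto simp: square_integrable_def)
  show prod: "integrable M (\<lambda>x. f x * g x)"
  proof (rule Bochner_Integration.integrable_bound)
    show "integrable M (\<lambda>x. (f x)\<^sup>2 + (g x)\<^sup>2)" using int by simp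
    show "AE x in M. norm (f x * g x) \<le> norm ((f x)\<^sup>2 + (g x)\<^sup>2)"
    proof (rule AE_I2)
      fix x
      have "2 * (\<bar>f x\<bar> * \<bar>g x\<bar>) \<le> (f x)\<^sup>2 + (g x)\<^sup>2"
        using sum_squares_bound[of "\<bar>f x\<bar>" "\<bar>g x\<bar>"] by simp
      moreover have "0 \<le> \<bar>f x\<bar> * \<bar>g x\<bar>" by simp
      ultimately have "\<bar>f x\<bar> * \<bar>g x\<bar> \<le> (f x)\<^sup>2 + (g x)\<^sup>2" by linarith
      then show "norm (f x * g x) \<le> norm ((f x)\<^sup>2 + (g x)\<^sup>2)"
        by (simp add: abs_mult)
    qed
  qed measurable
  let ?I = "\<integral>x. \<bar>f x * g x\<bar> \<partial>M" and ?F = "\<integral>x. (f x)\<^sup>2 \<partial>M" and ?G = "\<integral>x. (g x)\<^sup>2 \<partial>M"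
  have "(\<integral>\<^sup>+x. ennreal \<bar>f x\<bar> * ennreal \<bar>g x\<bar> \<partial>M)\<^sup>2 \<le> (\<integral>\<^sup>+x. (ennreal \<bar>f x\<bar>)\<^sup>2 \<partial>M) * (\<integral>\<^sup>+x. (ennreal \<bar>g x\<bar>)\<^sup>2 \<partial>M)"
    by (rule Cauchy_Schwarz_nn_integral) auto
  moreover have "(\<integral>\<^sup>+x. ennreal \<bar>f x\<bar> * ennreal \<bar>g x\<bar> \<partial>M) = ennreal ?I"
    using integrable_abs[OF prod] by (subst nn_integral_eq_integral[symmetric]) (auto simp: ennreal_mult abs_mult)
  moreover have "(\<integral>\<^sup>+x. (ennreal \<bar>f x\<bar>)\<^sup>2 \<partial>M) = ennreal ?F"
    using int by (subst nn_integral_eq_integral[symmetric]) (auto simp: ennreal_power)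
  moreover have "(\<integral>\<^sup>+x. (ennreal \<bar>g x\<bar>)\<^sup>2 \<partial>M) = ennreal ?G"
    using int by (subst nn_integral_eq_integral[symmetric]) (auto simp: ennreal_power)
  ultimately have "(ennreal ?I)\<^sup>2 \<le> ennreal ?F * ennreal ?G" by simp
  then have "?I\<^sup>2 \<le> ?F * ?G"
    by (simp add: ennreal_power ennreal_mult[symmetric])
  then show "?I \<le> sqrt ?F * sqrt ?G"
    by (simp add: real_le_rsqrt real_sqrt_mult[symmetric])
qed

locale probability_flow = prob_space M for M :: "'a measure" +
  fixes g :: "real \<Rightarrow> 'a \<Rightarrow> 'a"
  assumes flow: "measure_preserving_flow M g"
begin

abbreviation \<I> :: "'a measure" where "\<I> \<equiv> invariant_algebra M g"

abbreviation P :: "('a \<Rightarrow> real) \<Rightarrow> 'a \<Rightarrow> real" where "P \<equiv> real_cond_exp M \<I>"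

lemma flow_measurable [measurable]: "g t \<in> measurable M M"
proof -
  have [measurable]: "(\<lambda>(t, x). g t x) \<in> measurable (borel \<Otimes>\<^sub>M M) M"
    using flow by (simp add: measure_preserving_flow_def)
  have "(\<lambda>x. (\<lambda>(t, x). g t x) (t, x)) \<in> measurable M M" by measurable
  then show ?thesis by simp
qed

lemma distr_flow: "distr M M (g t) = M"
  using flow by (simp add: measure_preserving_flow_def)

lemma integrable_flow: "integrable M f \<Longrightarrow> integrable M (\<lambda>x. f (g t x))" for f :: "'a \<Rightarrow> real"
  using integrable_distr_eq[OF flow_measurable[of t], of f] by (simp add: distr_flow)

lemma integral_flow: "f \<in> borel_measurable M \<Longrightarrow> (\<integral>x. f (g t x) \<partial>M) = (\<integral>x. f x \<partial>M)" for f :: "'a \<Rightarrow> real"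
  using integral_distr[OF flow_measurable[of t], of f] by (simp add: distr_flow)

text \<open>
Each \<open>t\<close> is treated separately, so that in a countable union of almost invariant sets only countably many
exceptional null sets have to be united.
\<close>

lemma sets_invariant_algebra:
  "sets \<I> = {B \<in> sets M. \<forall>t. AE x in M. g t x \<in> B \<longleftrightarrow> x \<in> B}" (is "_ = ?S")
proof -
  have "sigma_algebra (space M) ?S"
    unfolding sigma_algebra_iff2
  proof (intro conjI ballI allI impI)
    fix B assume B: "B \<in> ?S"
    have "AE x in M. g t x \<in> space M - B \<longleftrightarrow> x \<in> space M - B" for t
    proof -
      have "AE x in M. g t x \<in> B \<longleftrightarrow> x \<in> B" using B by auto
      with AE_space show ?thesis
        by eventually_elim (use measurable_space[OF flow_measurable] in auto)
    qed
    with B show "space M - B \<in> ?S" by auto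
  next
    fix B :: "nat \<Rightarrow> 'a set" assume B: "range B \<subseteq> ?S"
    have "AE x in M. g t x \<in> \<Union> (range B) \<longleftrightarrow> x \<in> \<Union> (range B)" for t
    proof -
      have "AE x in M. g t x \<in> B i \<longleftrightarrow> x \<in> B i" for i using B by auto
      then have "AE x in M. \<forall>i. g t x \<in> B i \<longleftrightarrow> x \<in> B i" by (simp add: AE_all_countable)
      then show ?thesis by eventually_elim auto
    qed
    with B show "\<Union> (range B) \<in> ?S" by auto
  qed (auto dest: sets.sets_into_space)
  then show ?thesis
    unfolding invariant_algebra_def
    by (subst sets_measure_of) (auto simp: sigma_algebra.sigma_sets_eq dest: sets.sets_into_space)
qed

lemma space_invariant_algebra: "space \<I> = space M"
  unfolding invariant_algebra_def by (rule space_measure_of) (auto dest: sets.sets_into_space)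

sublocale finite_measure_subalgebra M \<I>
  by unfold_locales (auto simp: subalgebra_def space_invariant_algebra sets_invariant_algebra)

lemma cond_exp_contraction:
  assumes f: "integrable M f"
  shows "(\<integral>x. \<bar>P f x\<bar> \<partial>M) \<le> (\<integral>x. \<bar>f x\<bar> \<partial>M)"
proof -
  have int: "integrable M (\<lambda>x. \<bar>f x\<bar>)" "integrable M (\<lambda>x. -1 * f x)" using f by auto
  have "AE x in M. \<bar>P f x\<bar> \<le> P (\<lambda>x. \<bar>f x\<bar>) x"
  proof -
    have "AE x in M. P f x \<le> P (\<lambda>x. \<bar>f x\<bar>) x" "AE x in M. P (\<lambda>x. -1 * f x) x \<le> P (\<lambda>x. \<bar>f x\<bar>) x"
      by (rule real_cond_exp_mono; use f int in auto)+
    with real_cond_exp_cmult[OF f, of "-1"] show ?thesis by eventually_elim auto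
  qed
  then have "(\<integral>x. \<bar>P f x\<bar> \<partial>M) \<le> (\<integral>x. P (\<lambda>x. \<bar>f x\<bar>) x \<partial>M)"
    using f int by (intro integral_mono_AE) (auto intro: real_cond_exp_int)
  then show ?thesis using real_cond_exp_int(2)[OF int(1)] by simp
qed

text \<open>
Jensen's inequality for the square.
\<close>

lemma cond_exp_square_integrable:
  assumes f: "f \<in> square_integrable M"
  shows "P f \<in> square_integrable M" "(\<integral>x. (P f x)\<^sup>2 \<partial>M) \<le> (\<integral>x. (f x)\<^sup>2 \<partial>M)"
proof -
  have f1: "integrable M f" using f by (rule_tac square_integrable_imp_integrable) (auto simp: square_integrable_def)
  have f2: "integrable M (\<lambda>x. (f x)\<^sup>2)" using f by (simp add: square_integrable_def)
  have conv: "convex_on UNIV (\<lambda>x::real. x\<^sup>2)" by (rule convex_power2)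
  have int: "integrable M (\<lambda>x. (P f x)\<^sup>2)"
    by (rule integrable_convex_cond_exp[OF f1, where I = UNIV and a = 0 and b = 0 and q = "\<lambda>x. x\<^sup>2"]) (use f2 conv in auto)
  then show "P f \<in> square_integrable M" by (simp add: square_integrable_def)
  have "AE x in M. (P f x)\<^sup>2 \<le> P (\<lambda>x. (f x)\<^sup>2) x"
    by (rule real_cond_exp_jensens_inequality(2)[OF f1, where I = UNIV and a = 0 and b = 0 and q = "\<lambda>x. x\<^sup>2"]) (use f2 conv in auto)
  then have "(\<integral>x. (P f x)\<^sup>2 \<partial>M) \<le> (\<integral>x. P (\<lambda>x. (f x)\<^sup>2) x \<partial>M)"
    using int f2 by (intro integral_mono_AE) (auto intro: real_cond_exp_int)
  then show "(\<integral>x. (P f x)\<^sup>2 \<partial>M) \<le> (\<integral>x. (f x)\<^sup>2 \<partial>M)"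
    using real_cond_exp_int(2)[OF f2] by simp
qed

text \<open>
For an invariant set \<open>A\<close> the integral of \<open>f \<circ> g t\<close> over \<open>A\<close> does not depend on \<open>t\<close>, so it equals its own
limit, the integral of \<open>p\<close> over \<open>A\<close>. This identifies conditional expectations without any description of
the invariant sets.
\<close>

lemma weak_limit_eq_cond_exp:
  assumes f: "integrable M f" and p: "integrable M p" "p \<in> borel_measurable \<I>"
    and lim: "\<And>A. A \<in> sets \<I> \<Longrightarrow>
      ((\<lambda>t. \<integral>x. f (g t x) * indicator A x \<partial>M) \<longlongrightarrow> (\<integral>x. p x * indicator A x \<partial>M)) at_top"
  shows "AE x in M. P f x = p x"
proof (rule real_cond_exp_charact[OF _ f p])
  fix A assume A: "A \<in> sets \<I>"
  then have [measurable]: "A \<in> sets M" and inv: "\<And>t. AE x in M. g t x \<in> A \<longleftrightarrow> x \<in> A"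
    by (auto simp: sets_invariant_algebra)
  have [measurable]: "f \<in> borel_measurable M" using f by auto
  have "(\<integral>x. f (g t x) * indicator A x \<partial>M) = (\<integral>x. f x * indicator A x \<partial>M)" for t
  proof -
    have "(\<integral>x. f (g t x) * indicator A x \<partial>M) = (\<integral>x. f (g t x) * indicator A (g t x) \<partial>M)"
      using inv[of t] by (intro integral_cong_AE) (auto elim!: eventually_mono simp: indicator_def)
    also have "\<dots> = (\<integral>x. f x * indicator A x \<partial>M)"
      by (rule integral_flow[of "\<lambda>x. f x * indicator A x"]) measurable
    finally show ?thesis .
  qed
  then have "(\<integral>x. f x * indicator A x \<partial>M) = (\<integral>x. p x * indicator A x \<partial>M)"
    using lim[OF A] by (simp add: tendsto_const_iff)
  then show "(\<integral>x\<in>A. f x \<partial>M) = (\<integral>x\<in>A. p x \<partial>M)"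
    by (simp add: set_lebesgue_integral_def mult.commute)
qed

abbreviation defect :: "('a \<Rightarrow> real) \<Rightarrow> ('a \<Rightarrow> real) \<Rightarrow> real \<Rightarrow> real" where
  "defect f h t \<equiv> (\<integral>x. f (g t x) * h x \<partial>M) - (\<integral>x. P f x * h x \<partial>M)"

text \<open>
Weak convergence of \<open>f \<circ> g t\<close> to the conditional expectation, tested against bounded functions only. With such
test functions the condition makes sense for \<open>f\<close> in \<open>L\<^sup>1\<close> and is preserved by \<open>L\<^sup>1\<close> limits.
\<close>

definition shears :: "('a \<Rightarrow> real) \<Rightarrow> bool" where
  "shears f \<longleftrightarrow> (\<forall>h\<in>borel_measurable M. (\<forall>x. \<bar>h x\<bar> \<le> 1) \<longrightarrow>
     (defect f h \<longlongrightarrow> 0) at_top)"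

lemma integrable_mult_bounded:
  fixes f h :: "'a \<Rightarrow> real"
  assumes f: "integrable M f" and h[measurable]: "h \<in> borel_measurable M" and bd: "\<And>x. \<bar>h x\<bar> \<le> c"
  shows "integrable M (\<lambda>x. f x * h x)"
proof (rule Bochner_Integration.integrable_bound)
  have [measurable]: "f \<in> borel_measurable M" using f by auto
  show "integrable M (\<lambda>x. c * f x)" using f by simp
  show "(\<lambda>x. f x * h x) \<in> borel_measurable M" by measurable
  show "AE x in M. norm (f x * h x) \<le> norm (c * f x)"
  proof (rule AE_I2)
    fix x
    have "\<bar>h x\<bar> \<le> \<bar>c\<bar>" using bd[of x] by linarith
    then show "norm (f x * h x) \<le> norm (c * f x)"
      using mult_left_mono[of "\<bar>h x\<bar>" "\<bar>c\<bar>" "\<bar>f x\<bar>"] by (simp add: abs_mult mult.commute)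
  qed
qed

lemma integral_mult_bounded_le:
  fixes f h :: "'a \<Rightarrow> real"
  assumes f: "integrable M f" and h: "h \<in> borel_measurable M" and bd: "\<And>x. \<bar>h x\<bar> \<le> 1"
  shows "\<bar>\<integral>x. f x * h x \<partial>M\<bar> \<le> (\<integral>x. \<bar>f x\<bar> \<partial>M)"
proof (rule order_trans[OF integral_abs_bound integral_mono])
  show "integrable M (\<lambda>x. \<bar>f x * h x\<bar>)" "integrable M (\<lambda>x. \<bar>f x\<bar>)"
    using integrable_mult_bounded[OF assms] f by auto
  show "\<bar>f x * h x\<bar> \<le> \<bar>f x\<bar>" for x
    using bd[of x] by (simp add: abs_mult mult_left_le)
qed

lemma shearsI_weak_limit:
  assumes f: "integrable M f" and p: "integrable M p" "p \<in> borel_measurable \<I>"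
    and lim: "\<And>h. h \<in> borel_measurable M \<Longrightarrow> (\<And>x. \<bar>h x\<bar> \<le> 1) \<Longrightarrow>
      ((\<lambda>t. \<integral>x. f (g t x) * h x \<partial>M) \<longlongrightarrow> (\<integral>x. p x * h x \<partial>M)) at_top"
  shows "shears f"
  unfolding shears_def
proof (intro ballI impI)
  fix h :: "'a \<Rightarrow> real" assume h[measurable]: "h \<in> borel_measurable M" and bd: "\<forall>x. \<bar>h x\<bar> \<le> 1"
  have [measurable]: "p \<in> borel_measurable M" using p by auto
  have "AE x in M. P f x = p x"
  proof (rule weak_limit_eq_cond_exp[OF f p lim])
    show "indicator A \<in> borel_measurable M" if "A \<in> sets \<I>" for A
      using that by (auto simp: sets_invariant_algebra)
  qed (auto simp: indicator_def)
  then have "(\<integral>x. P f x * h x \<partial>M) = (\<integral>x. p x * h x \<partial>M)"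
    by (intro integral_cong_AE) auto
  then show "(defect f h \<longlongrightarrow> 0) at_top"
    using LIM_zero[OF lim[OF h]] bd by simp
qed

lemma shears_invariant:
  assumes f: "integrable M f" "f \<in> borel_measurable \<I>" and inv: "\<And>t x. x \<in> space M \<Longrightarrow> f (g t x) = f x"
  shows "shears f"
proof (rule shearsI_weak_limit[OF f(1) f])
  fix h :: "'a \<Rightarrow> real"
  have "(\<integral>x. f (g t x) * h x \<partial>M) = (\<integral>x. f x * h x \<partial>M)" for t
    by (rule Bochner_Integration.integral_cong) (auto simp: inv)
  then show "((\<lambda>t. \<integral>x. f (g t x) * h x \<partial>M) \<longlongrightarrow> (\<integral>x. f x * h x \<partial>M)) at_top" by simp
qed

lemma shears_add:
  assumes f: "integrable M f1" "integrable M f2" and s: "shears f1" "shears f2"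
  shows "shears (\<lambda>x. f1 x + f2 x)"
  unfolding shears_def
proof (intro ballI impI)
  fix h :: "'a \<Rightarrow> real" assume h[measurable]: "h \<in> borel_measurable M" and bd: "\<forall>x. \<bar>h x\<bar> \<le> 1"
  have [measurable]: "f1 \<in> borel_measurable M" "f2 \<in> borel_measurable M" using f by auto
  have ints: "integrable M (\<lambda>x. f1 (g t x) * h x)" "integrable M (\<lambda>x. f2 (g t x) * h x)"
    "integrable M (\<lambda>x. P f1 x * h x)" "integrable M (\<lambda>x. P f2 x * h x)" for t
    using bd f by (auto intro!: integrable_mult_bounded[where c = 1] integrable_flow real_cond_exp_int)
  have "(\<integral>x. P (\<lambda>x. f1 x + f2 x) x * h x \<partial>M) = (\<integral>x. P f1 x * h x + P f2 x * h x \<partial>M)"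
    using real_cond_exp_add[OF f] by (intro integral_cong_AE) (auto elim!: eventually_mono simp: distrib_right)
  then have "(\<integral>x. (f1 (g t x) + f2 (g t x)) * h x \<partial>M) - (\<integral>x. P (\<lambda>x. f1 x + f2 x) x * h x \<partial>M) =
      defect f1 h t + defect f2 h t" for t
    using ints by (simp add: distrib_right)
  moreover have "((\<lambda>t. defect f1 h t +
      defect f2 h t) \<longlongrightarrow> 0) at_top"
    using s bd h by (intro tendsto_add_zero) (auto simp: shears_def)
  ultimately show "((\<lambda>t. (\<integral>x. (f1 (g t x) + f2 (g t x)) * h x \<partial>M) - (\<integral>x. P (\<lambda>x. f1 x + f2 x) x * h x \<partial>M)) \<longlongrightarrow> 0) at_top"
    by simp
qed

lemma shears_scale:
  assumes f: "integrable M f" and s: "shears f"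
  shows "shears (\<lambda>x. c * f x)"
  unfolding shears_def
proof (intro ballI impI)
  fix h :: "'a \<Rightarrow> real" assume h[measurable]: "h \<in> borel_measurable M" and bd: "\<forall>x. \<bar>h x\<bar> \<le> 1"
  have [measurable]: "f \<in> borel_measurable M" using f by auto
  have "(\<integral>x. P (\<lambda>x. c * f x) x * h x \<partial>M) = (\<integral>x. c * (P f x * h x) \<partial>M)"
    using real_cond_exp_cmult[OF f, of c] by (intro integral_cong_AE) (auto elim!: eventually_mono)
  then have "(\<integral>x. (c * f (g t x)) * h x \<partial>M) - (\<integral>x. P (\<lambda>x. c * f x) x * h x \<partial>M) =
      c * defect f h t" for t
    by (simp add: mult.assoc right_diff_distrib)
  moreover have "((\<lambda>t. c * defect f h t) \<longlongrightarrow> 0) at_top"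
    using s bd h by (intro tendsto_mult_right_zero) (auto simp: shears_def)
  ultimately show "((\<lambda>t. (\<integral>x. c * f (g t x) * h x \<partial>M) - (\<integral>x. P (\<lambda>x. c * f x) x * h x \<partial>M)) \<longlongrightarrow> 0) at_top"
    by simp
qed

text \<open>
Composition with \<open>g t\<close> and conditional expectation are both contractions of \<open>L\<^sup>1\<close>, so the error is at
most twice the \<open>L\<^sup>1\<close> distance, whatever \<open>t\<close> is.
\<close>

lemma shears_L1_limit:
  fixes s :: "nat \<Rightarrow> 'a \<Rightarrow> real"
  assumes s: "\<And>i. integrable M (s i)" "\<And>i. shears (s i)" and f: "integrable M f"
    and lim: "(\<lambda>i. \<integral>x. \<bar>s i x - f x\<bar> \<partial>M) \<longlonglongrightarrow> 0"
  shows "shears f"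
  unfolding shears_def
proof (intro ballI impI)
  fix h :: "'a \<Rightarrow> real" assume h[measurable]: "h \<in> borel_measurable M" and bd: "\<forall>x. \<bar>h x\<bar> \<le> 1"
  have [measurable]: "f \<in> borel_measurable M" "s i \<in> borel_measurable M" for i using f s(1) by auto
  show "(defect f h \<longlongrightarrow> 0) at_top"
  proof (rule tendsto_zero_if_approximated[OF _ always_eventually, rule_format])
    show "((\<lambda>t. defect (s i) h t) \<longlongrightarrow> 0) at_top" for i
      using s(2)[of i] h bd by (auto simp: shears_def)
    show "(\<lambda>i. 2 * (\<integral>x. \<bar>s i x - f x\<bar> \<partial>M)) \<longlonglongrightarrow> 0"
      using lim by (rule tendsto_mult_right_zero)
    fix i t
    let ?d = "\<lambda>x. f x - s i x"
    have d: "integrable M ?d" using f s(1)[of i] by auto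
    have ints: "integrable M (\<lambda>x. f (g t x) * h x)" "integrable M (\<lambda>x. s i (g t x) * h x)"
      "integrable M (\<lambda>x. P f x * h x)" "integrable M (\<lambda>x. P (s i) x * h x)"
      using bd f s(1) by (auto intro!: integrable_mult_bounded[where c = 1] integrable_flow real_cond_exp_int)
    have 1: "(\<integral>x. P ?d x * h x \<partial>M) = (\<integral>x. P f x * h x \<partial>M) - (\<integral>x. P (s i) x * h x \<partial>M)"
    proof -
      have "(\<integral>x. P ?d x * h x \<partial>M) = (\<integral>x. P f x * h x - P (s i) x * h x \<partial>M)"
        using real_cond_exp_diff[OF f s(1)[of i]] by (intro integral_cong_AE) (auto elim!: eventually_mono simp: left_diff_distrib)
      then show ?thesis using ints by simp
    qed
    have 2: "(\<integral>x. ?d (g t x) * h x \<partial>M) = (\<integral>x. f (g t x) * h x \<partial>M) - (\<integral>x. s i (g t x) * h x \<partial>M)"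
      using ints by (simp add: left_diff_distrib)
    have "\<bar>\<integral>x. P ?d x * h x \<partial>M\<bar> \<le> (\<integral>x. \<bar>?d x\<bar> \<partial>M)"
      using integral_mult_bounded_le[OF real_cond_exp_int(1)[OF d] h] bd cond_exp_contraction[OF d] by force
    moreover have "\<bar>\<integral>x. ?d (g t x) * h x \<partial>M\<bar> \<le> (\<integral>x. \<bar>?d x\<bar> \<partial>M)"
      using integral_mult_bounded_le[OF integrable_flow[OF d] h, of t] bd integral_flow[of "\<lambda>x. \<bar>?d x\<bar>" t] by auto
    moreover have "(\<integral>x. \<bar>?d x\<bar> \<partial>M) = (\<integral>x. \<bar>s i x - f x\<bar> \<partial>M)"
      by (simp add: abs_minus_commute)
    ultimately show "\<bar>defect f h t -
        defect (s i) h t\<bar> \<le> 2 * (\<integral>x. \<bar>s i x - f x\<bar> \<partial>M)"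
      using 1 2 by linarith
  qed
qed

text \<open>
Square integrable test functions are truncated. The error is uniform in \<open>t\<close> by the Cauchy-Schwarz inequality,
as neither \<open>g t\<close> nor conditional expectation increases the \<open>L\<^sup>2\<close> norm of \<open>f\<close>.
\<close>

lemma keplerian_shearI:
  assumes all: "\<And>f. integrable M f \<Longrightarrow> shears f"
  shows "keplerian_shear M g"
  unfolding keplerian_shear_def weakly_tendsto_L2_def
proof (intro conjI ballI)
  show "prob_space M" by unfold_locales
  show "measure_preserving_flow M g" by (rule flow)
  fix f assume f: "f \<in> square_integrable M"
  then have fm[measurable]: "f \<in> borel_measurable M" by (simp add: square_integrable_def)
  show "P f \<in> square_integrable M" using f by (rule cond_exp_square_integrable)
  have f1: "integrable M f" using f by (rule_tac square_integrable_imp_integrable) (auto simp: square_integrable_def)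
  have fg: "(\<lambda>x. f (g t x)) \<in> square_integrable M" for t
    using f integrable_flow[of "\<lambda>x. (f x)\<^sup>2" t] by (auto simp: square_integrable_def)
  fix h assume h: "h \<in> square_integrable M"
  then have [measurable]: "h \<in> borel_measurable M" and h2: "integrable M (\<lambda>x. (h x)\<^sup>2)"
    by (simp_all add: square_integrable_def)
  \<comment> \<open>truncation of \<open>h\<close> at height \<open>n + 1\<close>, a positive number by which the test function can be divided\<close>
  define c where "c n x = max (- real (Suc n)) (min (real (Suc n)) (h x))" for n x
  have [measurable]: "c n \<in> borel_measurable M" for n unfolding c_def by measurable
  have c_le: "\<bar>h x - c n x\<bar> \<le> \<bar>h x\<bar>" for n x unfolding c_def by linarith
  have dsq: "(\<lambda>x. h x - c n x) \<in> square_integrable M" for n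
    unfolding square_integrable_def
    using c_le by (auto intro!: Bochner_Integration.integrable_bound[OF h2] simp: abs_le_square_iff[symmetric])
  have csq: "c n \<in> square_integrable M" for n
    by (auto simp: square_integrable_def c_def intro!: integrable_const_bound[where B = "(real (Suc n))\<^sup>2"] simp: abs_le_square_iff[symmetric])
  let ?e = "\<lambda>n. 2 * (sqrt (\<integral>x. (f x)\<^sup>2 \<partial>M) * sqrt (\<integral>x. (h x - c n x)\<^sup>2 \<partial>M))"
  have "(defect f h \<longlongrightarrow> 0) at_top"
  proof (rule tendsto_zero_if_approximated[OF _ always_eventually, rule_format])
    show "((\<lambda>t. defect f (c n) t) \<longlongrightarrow> 0) at_top" for n
    proof -
      have "\<bar>c n x / real (Suc n)\<bar> \<le> 1" for x by (auto simp: c_def divide_le_eq le_divide_eq)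
      then have "((\<lambda>t. (\<integral>x. f (g t x) * (c n x / real (Suc n)) \<partial>M) - (\<integral>x. P f x * (c n x / real (Suc n)) \<partial>M)) \<longlongrightarrow> 0) at_top"
        by (intro all[OF f1, unfolded shears_def, rule_format]) auto
      from tendsto_mult_right_zero[OF this, of "real (Suc n)"] show ?thesis
        by (simp add: right_diff_distrib del: of_nat_Suc)
    qed
    have "(\<lambda>n. \<integral>x. (h x - c n x)\<^sup>2 \<partial>M) \<longlonglongrightarrow> (\<integral>x. 0 \<partial>M)"
    proof (rule integral_dominated_convergence[OF _ _ h2])
      show "AE x in M. (\<lambda>n. (h x - c n x)\<^sup>2) \<longlonglongrightarrow> 0"
      proof (rule AE_I2, rule tendsto_eventually)
        fix x
        obtain N :: nat where "\<bar>h x\<bar> \<le> real N" using real_arch_simple by blast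
        then show "\<forall>\<^sub>F n in sequentially. (h x - c n x)\<^sup>2 = 0"
          unfolding eventually_sequentially c_def by (intro exI[of _ N]) auto
      qed
      show "AE x in M. norm ((h x - c n x)\<^sup>2) \<le> (h x)\<^sup>2" for n
        using c_le by (auto simp: abs_le_square_iff[symmetric])
    qed auto
    then have "?e \<longlonglongrightarrow> 2 * (sqrt (\<integral>x. (f x)\<^sup>2 \<partial>M) * sqrt 0)"
      by (intro tendsto_intros) simp
    then show "?e \<longlonglongrightarrow> 0" by simp
    fix n t
    have A: "\<bar>\<integral>x. F x * (h x - c n x) \<partial>M\<bar> \<le> sqrt (\<integral>x. (f x)\<^sup>2 \<partial>M) * sqrt (\<integral>x. (h x - c n x)\<^sup>2 \<partial>M)"
      if F: "F \<in> square_integrable M" "(\<integral>x. (F x)\<^sup>2 \<partial>M) \<le> (\<integral>x. (f x)\<^sup>2 \<partial>M)" for F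
      using order_trans[OF integral_abs_bound square_integrable_mult(2)[OF F(1) dsq[of n]]]
        mult_right_mono[OF real_sqrt_le_mono[OF F(2)], of "sqrt (\<integral>x. (h x - c n x)\<^sup>2 \<partial>M)"] by force
    have B: "(\<integral>x. F x * (h x - c n x) \<partial>M) = (\<integral>x. F x * h x \<partial>M) - (\<integral>x. F x * c n x \<partial>M)"
      if F: "F \<in> square_integrable M" for F
      using square_integrable_mult(1)[OF F h] square_integrable_mult(1)[OF F csq[of n]]
      by (simp add: right_diff_distrib)
    have "(\<integral>x. (f (g t x))\<^sup>2 \<partial>M) \<le> (\<integral>x. (f x)\<^sup>2 \<partial>M)"
      using integral_flow[of "\<lambda>x. (f x)\<^sup>2" t] by simp
    from A[OF fg this] A[OF cond_exp_square_integrable[OF f]] B[OF fg[of t]] B[OF cond_exp_square_integrable(1)[OF f]]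
    show "\<bar>defect f h t - defect f (c n) t\<bar> \<le> ?e n"
      by linarith
  qed
  then show "((\<lambda>t. \<integral>x. (f \<circ> g t) x * h x \<partial>M) \<longlongrightarrow> (\<integral>x. P f x * h x \<partial>M)) at_top"
    unfolding comp_def by (rule LIM_zero_cancel)
qed

lemma keplerian_shear_if_shears_pi_system:
  assumes G: "sets M = sigma_sets (space M) G" "Int_stable G" "G \<subseteq> Pow (space M)"
    and basis: "\<And>A. A \<in> G \<Longrightarrow> shears (indicator A)"
  shows "keplerian_shear M g"
proof (rule keplerian_shearI)
  fix f :: "'a \<Rightarrow> real" assume f: "integrable M f"
  have "f \<in> {f. shears f}"
  proof (rule L1_dense_of_indicators[OF _ G])
    have "space M \<in> sets \<I>" using sets.top[of \<I>] by (simp add: space_invariant_algebra)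
    then show "indicator (space M) \<in> {f. shears f}"
      using measurable_space[OF flow_measurable]
      by (auto intro!: shears_invariant borel_measurable_indicator simp: less_top[symmetric] indicator_def)
    show "finite_measure M" by unfold_locales
    show "indicator A \<in> {f. shears f}" if "A \<in> G" for A using basis[OF that] by simp
    show "(\<lambda>x. f1 x + f2 x) \<in> {f. shears f}"
      if "integrable M f1" "integrable M f2" "f1 \<in> {f. shears f}" "f2 \<in> {f. shears f}" for f1 f2
      using shears_add that by simp
    show "(\<lambda>x. c * f1 x) \<in> {f. shears f}" if "integrable M f1" "f1 \<in> {f. shears f}" for f1 c
      using shears_scale that by simp
    show "f1 \<in> {f. shears f}"
      if "\<And>i. integrable M (s i)" "\<And>i. s i \<in> {f. shears f}" "integrable M f1"
        "(\<lambda>i. \<integral>x. \<bar>s i x - f1 x\<bar> \<partial>M) \<longlonglongrightarrow> 0" for s :: "nat \<Rightarrow> 'a \<Rightarrow> real" and f1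
      using shears_L1_limit[of s f1] that by simp
  qed (rule f)
  then show "shears f" by simp
qed

end

section \<open>The torus and its Haar measure\<close>

lemma torus_proj_eq_iff: "torus_proj x = torus_proj y \<longleftrightarrow> x - y \<in> integer_vectors"
  by (rule torus.abs_eq_iff)

lemma torus_proj_rep [simp]: "torus_proj (rep_torus y) = y"
  using Quotient_abs_rep[OF Quotient_torus] .

lemma torus_proj_add: "torus_proj a + torus_proj b = torus_proj (a + b)"
  by (rule plus_torus.abs_eq)

lemma countable_integer_vectors: "countable (integer_vectors :: (real ^ 'd::finite) set)"
proof (rule countable_subset)
  show "integer_vectors \<subseteq> range (\<lambda>k :: 'd \<Rightarrow> int. \<chi> i. real_of_int (k i))"
  proof
    fix x :: "real ^ 'd" assume "x \<in> integer_vectors"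
    then have "x = (\<chi> i. real_of_int \<lfloor>x $ i\<rfloor>)"
      by (simp add: integer_vectors_def vec_eq_iff)
    then show "x \<in> range (\<lambda>k :: 'd \<Rightarrow> int. \<chi> i. real_of_int (k i))"
      by (rule range_eqI[where x = "\<lambda>i. \<lfloor>x $ i\<rfloor>"])
  qed
qed auto

lemma inner_integer_vectors:
  "\<xi> \<in> integer_vectors \<Longrightarrow> \<eta> \<in> integer_vectors \<Longrightarrow> \<xi> \<bullet> \<eta> \<in> \<int>"
  by (auto simp: integer_vectors_def inner_vec_def intro!: Ints_sum)

text \<open>
A Borel section of the projection, in contrast to the arbitrary choice of representatives in
\<open>rep_torus\<close>. It expresses addition on the torus by measurable operations on vectors.
\<close>

definition frac_rep :: "'d::finite torus \<Rightarrow> real ^ 'd" where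
  "frac_rep y = (\<chi> i. frac (rep_torus y $ i))"

definition unit_cube :: "(real ^ 'd::finite) set" where
  "unit_cube = {x. \<forall>i. 0 \<le> x $ i \<and> x $ i < 1}"

lemma frac_cong_Ints: "a - b \<in> \<int> \<Longrightarrow> frac a = frac b" for a b :: real
proof -
  assume "a - b \<in> \<int>"
  then obtain n :: int where "a = b + of_int n" by (metis Ints_cases add.commute diff_add_cancel)
  then show ?thesis by (simp add: frac_def)
qed

lemma frac_rep_proj: "frac_rep (torus_proj x) = (\<chi> i. frac (x $ i))"
proof -
  have "rep_torus (torus_proj x) - x \<in> integer_vectors"
    by (simp add: torus_proj_eq_iff[symmetric])
  then show ?thesis
    by (simp add: frac_rep_def vec_eq_iff integer_vectors_def frac_cong_Ints)
qed

lemma torus_proj_frac_rep [simp]: "torus_proj (frac_rep y) = y"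
proof -
  have "frac_rep y - rep_torus y \<in> integer_vectors"
    by (simp add: frac_rep_def integer_vectors_def frac_def)
  then show ?thesis by (metis torus_proj_eq_iff torus_proj_rep)
qed

lemma frac_rep_in_unit_cube: "frac_rep y \<in> unit_cube"
  by (simp add: frac_rep_def unit_cube_def frac_lt_1)

lemma continuous_on_torus_proj: "continuous_on S torus_proj"
proof -
  have "continuous_on UNIV torus_proj"
    by (simp add: continuous_on_open_vimage open_torus_def)
  then show ?thesis by (rule continuous_on_subset) simp
qed

lemma torus_proj_measurable [measurable]: "torus_proj \<in> borel_measurable borel"
  by (rule borel_measurable_continuous_onI[OF continuous_on_torus_proj])

lemma continuous_on_torusI:
  fixes f :: "'d::finite torus \<Rightarrow> 'b::topological_space"
  assumes "continuous_on UNIV (\<lambda>x. f (torus_proj x))"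
  shows "continuous_on UNIV f"
  using assms by (simp add: continuous_on_open_vimage open_torus_def vimage_def)

lemma compact_torus: "compact (UNIV :: 'd::finite torus set)"
proof -
  have "compact (torus_proj ` cbox 0 (1 :: real ^ 'd))"
    by (intro compact_continuous_image continuous_on_torus_proj compact_cbox)
  moreover have "y \<in> torus_proj ` cbox 0 (1 :: real ^ 'd)" for y
    using frac_rep_in_unit_cube[of y]
    by (intro image_eqI[where x = "frac_rep y"]) (auto simp: mem_box_cart unit_cube_def less_imp_le)
  ultimately show ?thesis by (metis UNIV_eq_I)
qed

text \<open>
The set where a coordinate exceeds \<open>a \<ge> 0\<close> is open: it lifts to the union of the open slabs
\<open>n + a < x $ i < n + 1\<close>.
\<close>

lemma frac_rep_measurable [measurable]: "(frac_rep :: 'd::finite torus \<Rightarrow> _) \<in> borel_measurable borel"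
proof -
  have comp: "(\<lambda>y. frac_rep y $ i) \<in> borel_measurable borel" for i :: 'd
    unfolding borel_measurable_iff_greater
  proof
    fix a :: real
    consider "a < 0" | "a \<ge> 0" by linarith
    then show "{y \<in> space borel. a < frac_rep y $ i} \<in> sets borel"
    proof cases
      case 1
      moreover have "0 \<le> frac_rep y $ i" for y
        using frac_rep_in_unit_cube[of y] by (simp add: unit_cube_def)
      ultimately have "{y \<in> space borel. a < frac_rep y $ i} = UNIV"
        by (auto intro: less_le_trans)
      then show ?thesis by simp
    next
      case 2
      have "torus_proj -` {y. a < frac_rep y $ i} = (\<Union>n::int. {x. of_int n + a < x $ i} \<inter> {x. x $ i < of_int n + 1})"
      proof (intro set_eqI iffI)
        fix x :: "real ^ 'd" assume "x \<in> torus_proj -` {y. a < frac_rep y $ i}"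
        then have "a < frac (x $ i)" by (simp add: frac_rep_proj)
        then have "of_int \<lfloor>x $ i\<rfloor> + a < x $ i" "x $ i < of_int \<lfloor>x $ i\<rfloor> + 1" by (simp_all add: frac_def)
        then show "x \<in> (\<Union>n::int. {x. of_int n + a < x $ i} \<inter> {x. x $ i < of_int n + 1})" by blast
      next
        fix x :: "real ^ 'd" assume "x \<in> (\<Union>n::int. {x. of_int n + a < x $ i} \<inter> {x. x $ i < of_int n + 1})"
        then obtain n :: int where n: "of_int n + a < x $ i" "x $ i < of_int n + 1" by auto
        then have "\<lfloor>x $ i\<rfloor> = n" using 2 by (intro floor_unique) auto
        with n show "x \<in> torus_proj -` {y. a < frac_rep y $ i}" by (simp add: frac_rep_proj frac_def)
      qed
      moreover have "open (\<Union>n::int. {x :: real ^ 'd. of_int n + a < x $ i} \<inter> {x. x $ i < of_int n + 1})"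
        by (intro open_UN ballI open_Int open_Collect_less continuous_intros)
      ultimately have "open {y. a < frac_rep y $ i}" by (simp add: open_torus_def)
      then show ?thesis by simp
    qed
  qed
  show ?thesis
  proof (rule borel_measurable_euclidean_space[THEN iffD2, rule_format])
    fix b :: "real ^ 'd" assume "b \<in> Basis"
    then obtain i where "b = axis i 1" unfolding Basis_vec_def Basis_real_def by blast
    then show "(\<lambda>y. frac_rep y \<bullet> b) \<in> borel_measurable borel"
      by (simp only: inner_axis inner_real_def mult_1_right comp)
  qed
qed

lemma torus_add_proj: "y + torus_proj z = torus_proj (frac_rep y + z)"
  by (metis torus_proj_add torus_proj_frac_rep)

lemma unit_cube_measurable [measurable]: "unit_cube \<in> sets borel"
proof -
  have [measurable]: "(\<lambda>x :: real ^ 'd. x $ i) \<in> borel_measurable borel" for i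
    by (intro borel_measurable_continuous_onI continuous_intros)
  show ?thesis unfolding unit_cube_def by measurable
qed

lemma emeasure_unit_cube: "emeasure lborel (unit_cube :: (real ^ 'd::finite) set) = 1"
proof (rule antisym)
  have one: "(\<Prod>b\<in>Basis. (1 :: real ^ 'd) \<bullet> b) = 1"
    by (rule prod.neutral) (auto simp: Basis_vec_def inner_axis)
  have nonneg: "\<forall>b\<in>Basis. 0 \<le> (1 :: real ^ 'd) \<bullet> b"
    by (auto simp: Basis_vec_def inner_axis)
  have "emeasure lborel (unit_cube :: (real ^ 'd) set) \<le> emeasure lborel (cbox 0 (1 :: real ^ 'd))"
    by (intro emeasure_mono) (auto simp: unit_cube_def mem_box_cart less_imp_le)
  then show "emeasure lborel (unit_cube :: (real ^ 'd) set) \<le> 1"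
    using one nonneg by (simp add: emeasure_lborel_cbox_eq)
  have "emeasure lborel (box 0 (1 :: real ^ 'd)) \<le> emeasure lborel (unit_cube :: (real ^ 'd) set)"
    by (intro emeasure_mono) (auto simp: unit_cube_def mem_box_cart less_imp_le)
  then show "1 \<le> emeasure lborel (unit_cube :: (real ^ 'd) set)"
    using one nonneg by (simp add: emeasure_lborel_box_eq)
qed

lemma space_torus_measure [simp]: "space torus_measure = UNIV"
  and sets_torus_measure [simp, measurable_cong]: "sets torus_measure = sets borel"
  by (simp_all add: torus_measure_def)

lemma emeasure_torus_measure:
  fixes S :: "'d::finite torus set"
  assumes "S \<in> sets borel"
  shows "emeasure torus_measure S = emeasure lborel (unit_cube \<inter> torus_proj -` S)"
proof -
  have m: "torus_proj -` S \<in> sets borel" 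
    using measurable_sets[OF torus_proj_measurable assms] by simp
  have "emeasure torus_measure S = emeasure (restrict_space lborel unit_cube) (torus_proj -` S \<inter> space (restrict_space lborel unit_cube))"
    unfolding torus_measure_def unit_cube_def[symmetric]
    using assms by (intro emeasure_distr measurable_restrict_space1) auto
  also have "\<dots> = emeasure lborel (unit_cube \<inter> torus_proj -` S)"
    using m by (subst emeasure_restrict_space) (auto simp: space_restrict_space Int_commute)
  finally show ?thesis .
qed

interpretation torus_measure: prob_space "torus_measure :: 'd::finite torus measure"
  by (rule prob_spaceI) (simp add: emeasure_torus_measure emeasure_unit_cube)

text \<open>
The points \<open>x\<close> of the unit cube are sorted by the lattice cell \<open>n + unit_cube\<close> that contains \<open>x + a\<close>. Every
point lies in exactly one cell because the cells are half-open.
\<close>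

lemma unit_cube_partition:
  fixes a :: "real ^ 'd::finite"
  shows "(\<Union>n\<in>integer_vectors. {x \<in> unit_cube. x + a - n \<in> unit_cube}) = unit_cube"
    and "disjoint_family_on (\<lambda>n. {x \<in> unit_cube. x + a - n \<in> unit_cube}) integer_vectors"
proof -
  have "\<exists>n\<in>integer_vectors. x + a - n \<in> unit_cube" for x
    by (rule bexI[where x = "\<chi> i. of_int \<lfloor>(x + a) $ i\<rfloor>"]) (auto simp: unit_cube_def integer_vectors_def, linarith+)
  then show "(\<Union>n\<in>integer_vectors. {x \<in> unit_cube. x + a - n \<in> unit_cube}) = unit_cube" by auto
  show "disjoint_family_on (\<lambda>n. {x \<in> unit_cube. x + a - n \<in> unit_cube}) integer_vectors"
    unfolding disjoint_family_on_def
  proof (intro ballI impI, rule ccontr)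
    fix m n :: "real ^ 'd" assume mn: "m \<in> integer_vectors" "n \<in> integer_vectors" "m \<noteq> n"
      and "{x \<in> unit_cube. x + a - m \<in> unit_cube} \<inter> {x \<in> unit_cube. x + a - n \<in> unit_cube} \<noteq> {}"
    then obtain x where x: "x + a - m \<in> unit_cube" "x + a - n \<in> unit_cube" by auto
    have "m $ i = n $ i" for i
    proof -
      obtain k l :: int where kl: "m $ i = of_int k" "n $ i = of_int l"
        using mn by (auto simp: integer_vectors_def elim!: Ints_cases dest!: spec[of _ i])
      moreover have "\<lfloor>(x + a) $ i\<rfloor> = k" "\<lfloor>(x + a) $ i\<rfloor> = l"
        using x kl by (auto intro!: floor_unique simp: unit_cube_def diff_less_eq dest!: spec[of _ i])
      ultimately show ?thesis by simp
    qed
    then show False using mn by (simp add: vec_eq_iff)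
  qed
qed

text \<open>
Cut the cube into the pieces of \<open>unit_cube_partition\<close> for \<open>a\<close>; the piece with index \<open>n\<close> is a Lebesgue
translate of the piece with index \<open>-n\<close> for \<open>-a\<close>.
\<close>

lemma torus_measure_translate:
  fixes a :: "real ^ 'd::finite"
  assumes S: "S \<in> sets borel"
  shows "emeasure torus_measure ((\<lambda>y. y + torus_proj a) -` S) = emeasure torus_measure S"
proof -
  define Q where "Q = torus_proj -` S"
  have Q[measurable]: "Q \<in> sets borel" 
    using measurable_sets[OF torus_proj_measurable S] by (simp add: Q_def)
  have periodic: "x - n \<in> Q \<longleftrightarrow> x \<in> Q" if "n \<in> integer_vectors" for x n
  proof -
    have "torus_proj (x - n) = torus_proj x"
      using integer_vectors_uminus[OF that] by (simp add: torus_proj_eq_iff)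
    then show ?thesis by (simp add: Q_def)
  qed
  have Sm: "(\<lambda>y. y + torus_proj a) -` S \<in> sets borel"
  proof -
    have "(\<lambda>y. torus_proj (frac_rep y + a)) \<in> borel_measurable borel" by measurable
    from measurable_sets[OF this S] show ?thesis by (simp add: torus_add_proj)
  qed
  have shift[measurable]: "{x \<in> unit_cube. x + b - n \<in> unit_cube} \<in> sets borel" for b n :: "real ^ 'd"
    by measurable
  have translation: "emeasure lborel ((\<lambda>x. c + x) -` X) = emeasure lborel X" if [measurable]: "X \<in> sets borel" for c :: "real ^ 'd" and X
    using emeasure_distr[of "(+) c" lborel borel X] by (simp add: lborel_distr_plus)
  have "emeasure torus_measure ((\<lambda>y. y + torus_proj a) -` S) = emeasure lborel (unit_cube \<inter> {x. x + a \<in> Q})"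
    using Sm by (subst emeasure_torus_measure) (auto simp: Q_def torus_proj_add vimage_def)
  also have "unit_cube \<inter> {x. x + a \<in> Q} = (\<Union>n\<in>integer_vectors. {x \<in> unit_cube. x + a - n \<in> unit_cube} \<inter> {x. x + a \<in> Q})"
    using unit_cube_partition(1)[of a] by auto
  also have "emeasure lborel \<dots> = (\<integral>\<^sup>+n. emeasure lborel ({x \<in> unit_cube. x + a - n \<in> unit_cube} \<inter> {x. x + a \<in> Q}) \<partial>count_space integer_vectors)"
    by (rule emeasure_UN_countable) (use unit_cube_partition(2)[of a] in \<open>auto simp: disjoint_family_on_def countable_integer_vectors\<close>)
  also have "\<dots> = (\<integral>\<^sup>+n. emeasure lborel ({x \<in> unit_cube. x + - a - - n \<in> unit_cube} \<inter> Q) \<partial>count_space integer_vectors)"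
  proof (rule nn_integral_cong)
    fix n :: "real ^ 'd" assume "n \<in> space (count_space integer_vectors)"
    then have n: "n \<in> integer_vectors" by simp
    have eq: "{x \<in> unit_cube. x + a - n \<in> unit_cube} \<inter> {x. x + a \<in> Q} =
      (+) (a - n) -` ({x \<in> unit_cube. x + - a - - n \<in> unit_cube} \<inter> Q)"
    proof (rule set_eqI)
      fix x
      have 1: "x + a - n + - a - - n = x" "a - n + x = x + a - n" by simp_all
      show "x \<in> {x \<in> unit_cube. x + a - n \<in> unit_cube} \<inter> {x. x + a \<in> Q} \<longleftrightarrow>
        x \<in> (+) (a - n) -` ({x \<in> unit_cube. x + - a - - n \<in> unit_cube} \<inter> Q)"
        unfolding vimage_eq Int_iff mem_Collect_eq 1 periodic[OF n, of "x + a"] by blast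
    qed
    show "emeasure lborel ({x \<in> unit_cube. x + a - n \<in> unit_cube} \<inter> {x. x + a \<in> Q}) =
      emeasure lborel ({x \<in> unit_cube. x + - a - - n \<in> unit_cube} \<inter> Q)"
      unfolding eq by (rule translation, intro sets.Int shift Q)
  qed
  also have "\<dots> = (\<integral>\<^sup>+n. emeasure lborel ({x \<in> unit_cube. x + - a - n \<in> unit_cube} \<inter> Q) \<partial>count_space integer_vectors)"
    by (rule nn_integral_bij_count_space, rule bij_betwI[where g = uminus]) (auto intro: integer_vectors_uminus)
  also have "\<dots> = emeasure lborel (\<Union>n\<in>integer_vectors. {x \<in> unit_cube. x + - a - n \<in> unit_cube} \<inter> Q)"
    by (rule emeasure_UN_countable[symmetric]) (use unit_cube_partition(2)[of "- a"] in \<open>auto simp: disjoint_family_on_def countable_integer_vectors\<close>)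
  also have "(\<Union>n\<in>integer_vectors. {x \<in> unit_cube. x + - a - n \<in> unit_cube} \<inter> Q) = unit_cube \<inter> Q"
    using unit_cube_partition(1)[of "- a"] by auto
  also have "emeasure lborel (unit_cube \<inter> Q) = emeasure torus_measure S"
    using S by (simp add: emeasure_torus_measure Q_def)
  finally show ?thesis .
qed

section \<open>Keplerian shear for fibrewise translations\<close>

lemma measure_preserving_shear_flow:
  fixes v :: "'a \<Rightarrow> real ^ 'd::finite"
  assumes "prob_space N" and v[measurable]: "v \<in> borel_measurable N"
  shows "measure_preserving_flow (N \<Otimes>\<^sub>M torus_measure) (shear_flow v)"
  unfolding measure_preserving_flow_def
proof (intro conjI allI ballI)
  let ?M = "N \<Otimes>\<^sub>M (torus_measure :: 'd torus measure)"
  interpret N: prob_space N by fact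
  interpret NT: pair_prob_space N "torus_measure :: 'd torus measure" ..
  have eq: "shear_flow v t = (\<lambda>(x, y). (x, torus_proj (frac_rep y + t *\<^sub>R v x)))" for t
    by (auto simp: shear_flow_def torus_add_proj)
  show "(\<lambda>(t, x). shear_flow v t x) \<in> borel \<Otimes>\<^sub>M ?M \<rightarrow>\<^sub>M ?M"
    unfolding eq by measurable
  have "torus_proj 0 = (0 :: 'd torus)" by (simp add: zero_torus_def)
  then show "shear_flow v 0 z = z" for z by (auto simp: shear_flow_def)
  have "torus_proj ((s + t) *\<^sub>R v x) = torus_proj (t *\<^sub>R v x) + torus_proj (s *\<^sub>R v x)" for s t x
    by (simp add: torus_proj_add scaleR_add_left add.commute)
  then show "shear_flow v (s + t) z = shear_flow v s (shear_flow v t z)" for s t z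
    by (cases z) (simp add: shear_flow_def add.assoc)
  fix t
  have g: "shear_flow v t \<in> ?M \<rightarrow>\<^sub>M ?M"
    unfolding eq by measurable
  show "distr ?M ?M (shear_flow v t) = ?M"
  proof (rule measure_eqI)
    fix A assume "A \<in> sets (distr ?M ?M (shear_flow v t))"
    then have A: "A \<in> sets ?M" by simp
    let ?B = "shear_flow v t -` A \<inter> space ?M"
    have B: "?B \<in> sets ?M" using g A by (rule measurable_sets)
    have "emeasure ?M ?B = (\<integral>\<^sup>+x. emeasure torus_measure (Pair x -` ?B) \<partial>N)"
      using B by (rule torus_measure.emeasure_pair_measure_alt)
    also have "\<dots> = (\<integral>\<^sup>+x. emeasure torus_measure (Pair x -` A) \<partial>N)"
    proof (rule nn_integral_cong)
      fix x assume "x \<in> space N"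
      then have "Pair x -` ?B = (\<lambda>y. y + torus_proj (t *\<^sub>R v x)) -` (Pair x -` A)"
        by (auto simp: shear_flow_def space_pair_measure)
      moreover have "Pair x -` A \<in> sets borel" using sets_Pair1[OF A, of x] by simp
      ultimately show "emeasure torus_measure (Pair x -` ?B) = emeasure torus_measure (Pair x -` A)"
        by (simp add: torus_measure_translate)
    qed
    also have "\<dots> = emeasure ?M A"
      using A by (rule torus_measure.emeasure_pair_measure_alt[symmetric])
    finally show "emeasure (distr ?M ?M (shear_flow v t)) A = emeasure ?M A"
      using A g by (simp add: emeasure_distr)
  qed simp
qed

text \<open>
Real and imaginary part of the character of frequency \<open>\<xi>\<close>. The value is independent of the chosen representative
when \<open>\<xi>\<close> is integral, which is the only case of interest.
\<close>

definition torus_cos :: "real ^ 'd::finite \<Rightarrow> 'd torus \<Rightarrow> real" where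
  "torus_cos \<xi> y = cos (2 * pi * (\<xi> \<bullet> rep_torus y))"

definition torus_sin :: "real ^ 'd::finite \<Rightarrow> 'd torus \<Rightarrow> real" where
  "torus_sin \<xi> y = sin (2 * pi * (\<xi> \<bullet> rep_torus y))"

lemma torus_character_proj:
  assumes \<xi>: "\<xi> \<in> integer_vectors"
  shows "torus_cos \<xi> (torus_proj x) = cos (2 * pi * (\<xi> \<bullet> x))"
    and "torus_sin \<xi> (torus_proj x) = sin (2 * pi * (\<xi> \<bullet> x))"
proof -
  have "rep_torus (torus_proj x) - x \<in> integer_vectors"
    by (simp add: torus_proj_eq_iff[symmetric])
  then have "\<xi> \<bullet> (rep_torus (torus_proj x) - x) \<in> \<int>" by (rule inner_integer_vectors[OF \<xi>])
  then obtain k :: int where "\<xi> \<bullet> rep_torus (torus_proj x) - \<xi> \<bullet> x = of_int k"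
    by (auto simp: inner_diff_right elim: Ints_cases)
  then have "\<xi> \<bullet> rep_torus (torus_proj x) = \<xi> \<bullet> x + of_int k" by linarith
  then have "2 * pi * (\<xi> \<bullet> rep_torus (torus_proj x)) = 2 * pi * (\<xi> \<bullet> x) + 2 * pi * of_int k"
    by (simp add: distrib_left)
  then have "sin (2 * pi * (\<xi> \<bullet> rep_torus (torus_proj x))) = sin (2 * pi * (\<xi> \<bullet> x)) \<and>
      cos (2 * pi * (\<xi> \<bullet> rep_torus (torus_proj x))) = cos (2 * pi * (\<xi> \<bullet> x))"
    unfolding sin_cos_eq_iff by blast
  then show "torus_cos \<xi> (torus_proj x) = cos (2 * pi * (\<xi> \<bullet> x))"
    and "torus_sin \<xi> (torus_proj x) = sin (2 * pi * (\<xi> \<bullet> x))"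
    by (simp_all add: torus_cos_def torus_sin_def)
qed

lemma torus_character_add:
  assumes \<xi>: "\<xi> \<in> integer_vectors"
  shows "torus_cos \<xi> (y + torus_proj z) =
      torus_cos \<xi> y * cos (2 * pi * (\<xi> \<bullet> z)) - torus_sin \<xi> y * sin (2 * pi * (\<xi> \<bullet> z))"
    and "torus_sin \<xi> (y + torus_proj z) =
      torus_sin \<xi> y * cos (2 * pi * (\<xi> \<bullet> z)) + torus_cos \<xi> y * sin (2 * pi * (\<xi> \<bullet> z))"
proof -
  have "torus_cos \<xi> (torus_proj (rep_torus y + z)) =
      torus_cos \<xi> (torus_proj (rep_torus y)) * cos (2 * pi * (\<xi> \<bullet> z)) - torus_sin \<xi> (torus_proj (rep_torus y)) * sin (2 * pi * (\<xi> \<bullet> z))"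
    "torus_sin \<xi> (torus_proj (rep_torus y + z)) =
      torus_sin \<xi> (torus_proj (rep_torus y)) * cos (2 * pi * (\<xi> \<bullet> z)) + torus_cos \<xi> (torus_proj (rep_torus y)) * sin (2 * pi * (\<xi> \<bullet> z))"
    unfolding torus_character_proj[OF \<xi>] by (simp_all add: inner_add_right distrib_left cos_add sin_add)
  then show "torus_cos \<xi> (y + torus_proj z) =
      torus_cos \<xi> y * cos (2 * pi * (\<xi> \<bullet> z)) - torus_sin \<xi> y * sin (2 * pi * (\<xi> \<bullet> z))"
    "torus_sin \<xi> (y + torus_proj z) =
      torus_sin \<xi> y * cos (2 * pi * (\<xi> \<bullet> z)) + torus_cos \<xi> y * sin (2 * pi * (\<xi> \<bullet> z))"
    by (simp_all add: torus_proj_add[symmetric])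
qed

lemma continuous_on_torus_character:
  assumes \<xi>: "\<xi> \<in> integer_vectors"
  shows "continuous_on UNIV (torus_cos \<xi>)" "continuous_on UNIV (torus_sin \<xi>)"
  by (rule continuous_on_torusI, unfold torus_character_proj[OF \<xi>], intro continuous_intros)+

inductive_set trig_polynomials :: "('d::finite torus \<Rightarrow> real) set" where
  cos: "\<xi> \<in> integer_vectors \<Longrightarrow> torus_cos \<xi> \<in> trig_polynomials"
| sin: "\<xi> \<in> integer_vectors \<Longrightarrow> torus_sin \<xi> \<in> trig_polynomials"
| add: "p \<in> trig_polynomials \<Longrightarrow> q \<in> trig_polynomials \<Longrightarrow> (\<lambda>y. p y + q y) \<in> trig_polynomials"
| scale: "p \<in> trig_polynomials \<Longrightarrow> (\<lambda>y. c * p y) \<in> trig_polynomials"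

lemma trig_polynomials_const: "(\<lambda>_. c) \<in> (trig_polynomials :: ('d::finite torus \<Rightarrow> real) set)"
proof -
  have "(\<lambda>y. c * torus_cos 0 y) \<in> (trig_polynomials :: ('d torus \<Rightarrow> real) set)"
    by (intro trig_polynomials.intros integer_vectors_0)
  then show ?thesis by (simp add: torus_cos_def)
qed

lemma trig_polynomials_sum:
  assumes "\<And>i. i \<in> I \<Longrightarrow> p i \<in> trig_polynomials"
  shows "(\<lambda>y. \<Sum>i\<in>I. p i y) \<in> trig_polynomials"
  using assms
  by (induction I rule: infinite_finite_induct) (auto intro: trig_polynomials_const trig_polynomials.add)

text \<open>
The product formulas for sine and cosine express a product of two characters through their sum and difference
frequencies.
\<close>

lemma trig_polynomials_mult:
  fixes p q :: "'d::finite torus \<Rightarrow> real"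
  assumes p: "p \<in> trig_polynomials" and q: "q \<in> trig_polynomials"
  shows "(\<lambda>y. p y * q y) \<in> trig_polynomials"
proof -
  have chars: "(\<lambda>y. torus_cos \<xi> y * torus_cos \<eta> y) \<in> trig_polynomials"
      "(\<lambda>y. torus_cos \<xi> y * torus_sin \<eta> y) \<in> trig_polynomials"
      "(\<lambda>y. torus_sin \<xi> y * torus_cos \<eta> y) \<in> trig_polynomials"
      "(\<lambda>y. torus_sin \<xi> y * torus_sin \<eta> y) \<in> trig_polynomials"
    if "\<xi> \<in> integer_vectors" "\<eta> \<in> integer_vectors" for \<xi> \<eta> :: "real ^ 'd"
  proof -
    have pm: "\<xi> + \<eta> \<in> integer_vectors" "\<xi> + - \<eta> \<in> integer_vectors" "\<eta> + - \<xi> \<in> integer_vectors"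
      by (intro integer_vectors_add integer_vectors_uminus that)+
    have "(\<lambda>y. 1/2 * torus_cos (\<xi> + \<eta>) y + 1/2 * torus_cos (\<xi> + - \<eta>) y) \<in> trig_polynomials"
      "(\<lambda>y. 1/2 * torus_sin (\<xi> + \<eta>) y + 1/2 * torus_sin (\<eta> + - \<xi>) y) \<in> trig_polynomials"
      "(\<lambda>y. 1/2 * torus_sin (\<xi> + \<eta>) y + 1/2 * torus_sin (\<xi> + - \<eta>) y) \<in> trig_polynomials"
      "(\<lambda>y. 1/2 * torus_cos (\<xi> + - \<eta>) y + -1/2 * torus_cos (\<xi> + \<eta>) y) \<in> trig_polynomials"
      by (intro trig_polynomials.intros pm)+
    then show "(\<lambda>y. torus_cos \<xi> y * torus_cos \<eta> y) \<in> trig_polynomials"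
      "(\<lambda>y. torus_cos \<xi> y * torus_sin \<eta> y) \<in> trig_polynomials"
      "(\<lambda>y. torus_sin \<xi> y * torus_cos \<eta> y) \<in> trig_polynomials"
      "(\<lambda>y. torus_sin \<xi> y * torus_sin \<eta> y) \<in> trig_polynomials"
      by (simp_all add: torus_cos_def torus_sin_def inner_add_left inner_minus_left inner_diff_left
          distrib_left right_diff_distrib cos_add cos_diff sin_add sin_diff field_simps)
  qed
  have left: "(\<lambda>y. k y * q y) \<in> trig_polynomials"
    if "\<And>\<eta>. \<eta> \<in> integer_vectors \<Longrightarrow> (\<lambda>y. k y * torus_cos \<eta> y) \<in> trig_polynomials"
       "\<And>\<eta>. \<eta> \<in> integer_vectors \<Longrightarrow> (\<lambda>y. k y * torus_sin \<eta> y) \<in> trig_polynomials" for k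
    using q
  proof induction
    case (add q1 q2)
    from trig_polynomials.add[OF add.IH] show ?case by (simp add: distrib_left)
  next
    case (scale q1 c)
    from trig_polynomials.scale[OF scale.IH, of c] show ?case by (simp add: mult.left_commute)
  qed (use that in auto)
  from p show ?thesis
  proof induction
    case (cos \<xi>)
    show ?case by (rule left) (intro chars cos; assumption)+
  next
    case (sin \<xi>)
    show ?case by (rule left) (intro chars sin; assumption)+
  next
    case (add p1 p2)
    from trig_polynomials.add[OF add.IH] show ?case by (simp add: distrib_right)
  next
    case (scale p1 c)
    from trig_polynomials.scale[OF scale.IH, of c] show ?case by (simp add: mult.assoc)
  qed
qed

lemma axis_integer_vectors: "axis i 1 \<in> integer_vectors"
  by (simp add: integer_vectors_def axis_def)

text \<open>
Embeds the torus as a product of circles in a Euclidean space, so that polynomials in the coordinates become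
trigonometric polynomials.
\<close>

definition torus_embedding :: "'d::finite torus \<Rightarrow> (real ^ 'd) \<times> (real ^ 'd)" where
  "torus_embedding y = (\<chi> i. torus_cos (axis i 1) y, \<chi> i. torus_sin (axis i 1) y)"

lemma continuous_on_torus_embedding: "continuous_on S torus_embedding"
proof -
  have "continuous_on UNIV torus_embedding"
    unfolding torus_embedding_def[abs_def]
    by (intro continuous_intros continuous_on_Pair continuous_on_vec_lambda continuous_on_torus_character axis_integer_vectors)
  then show ?thesis by (rule continuous_on_subset) simp
qed

lemma inj_torus_embedding: "inj (torus_embedding :: 'd::finite torus \<Rightarrow> _)"
proof (rule injI)
  fix y z :: "'d torus" assume eq: "torus_embedding y = torus_embedding z"
  have "(rep_torus y - rep_torus z) $ i \<in> \<int>" for i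
  proof -
    have "sin (2 * pi * rep_torus y $ i) = sin (2 * pi * rep_torus z $ i) \<and> cos (2 * pi * rep_torus y $ i) = cos (2 * pi * rep_torus z $ i)"
      using eq by (simp add: torus_embedding_def torus_cos_def torus_sin_def vec_eq_iff inner_axis')
    then obtain n :: int where "2 * pi * rep_torus y $ i = 2 * pi * rep_torus z $ i + 2 * pi * of_int n"
      unfolding sin_cos_eq_iff by auto
    then have "2 * pi * (rep_torus y $ i - rep_torus z $ i) = 2 * pi * of_int n" by (simp add: algebra_simps)
    then show ?thesis by simp
  qed
  then have "torus_proj (rep_torus y) = torus_proj (rep_torus z)"
    unfolding torus_proj_eq_iff by (simp add: integer_vectors_def)
  then show "y = z" by simp
qed

lemma polynomial_on_torus_embedding:
  fixes p :: "(real ^ 'd::finite) \<times> (real ^ 'd) \<Rightarrow> real"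
  assumes "real_polynomial_function p"
  shows "(\<lambda>y. p (torus_embedding y)) \<in> trig_polynomials"
  using assms
proof induction
  case (linear f)
  interpret f: bounded_linear f by fact
  have coord: "(\<lambda>y. torus_embedding y \<bullet> b) \<in> trig_polynomials" if b: "b \<in> Basis" for b :: "(real ^ 'd) \<times> (real ^ 'd)"
  proof -
    from b consider i where "b = (axis i 1, 0)" | i where "b = (0, axis i 1)"
      by (auto simp: Basis_prod_def Basis_vec_def)
    then show ?thesis
      by cases (simp_all add: torus_embedding_def inner_axis trig_polynomials.cos trig_polynomials.sin axis_integer_vectors)
  qed
  have "f (torus_embedding y) = (\<Sum>b\<in>Basis. f b * (torus_embedding y \<bullet> b))" for y
  proof -
    have "f (torus_embedding y) = f (\<Sum>b\<in>Basis. (torus_embedding y \<bullet> b) *\<^sub>R b)"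
      by (simp only: euclidean_representation)
    then show ?thesis by (simp add: f.sum f.scaleR mult.commute)
  qed
  then show ?case by (simp add: trig_polynomials_sum trig_polynomials.scale coord)
next
  case (const c)
  show ?case by (rule trig_polynomials_const)
next
  case (add f g)
  then show ?case by (intro trig_polynomials.add)
next
  case (mult f g)
  then show ?case by (intro trig_polynomials_mult)
qed

lemma trig_polynomials_measurable: "p \<in> trig_polynomials \<Longrightarrow> p \<in> borel_measurable borel"
  by (induction rule: trig_polynomials.induct)
    (auto intro: borel_measurable_continuous_onI continuous_on_torus_character)

lemma trig_polynomials_bounded: "p \<in> trig_polynomials \<Longrightarrow> \<exists>B. \<forall>y. \<bar>p y\<bar> \<le> B"
proof (induction rule: trig_polynomials.induct)
  case (add p q)
  then obtain B C where "\<forall>y. \<bar>p y\<bar> \<le> B" "\<forall>y. \<bar>q y\<bar> \<le> C" by blast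
  then have "\<forall>y. \<bar>p y + q y\<bar> \<le> B + C" by (meson abs_triangle_ineq add_mono order_trans)
  then show ?case by blast
next
  case (scale p c)
  then obtain B where "\<forall>y. \<bar>p y\<bar> \<le> B" by blast
  then have "\<forall>y. \<bar>c * p y\<bar> \<le> \<bar>c\<bar> * B" by (simp add: abs_mult mult_left_mono)
  then show ?case by blast
qed (auto simp: torus_cos_def torus_sin_def intro!: exI[of _ 1])

text \<open>
Absolute continuity of the law of \<open>\<langle>\<xi>, v\<rangle>\<close> for integral \<open>\<xi> \<noteq> 0\<close> suffices on any probability space \<open>N\<close>. The
functions that shear are enlarged step by step: the second factor is a character, a trigonometric polynomial, a
continuous function (by uniform approximation), and the indicator of a closed set (by monotone approximation).
\<close>

lemma keplerian_shear_shear_flow: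
  fixes v :: "'a \<Rightarrow> real ^ 'd::finite"
  assumes N: "prob_space N" and v[measurable]: "v \<in> borel_measurable N"
    and ac: "\<And>\<xi> Z. \<xi> \<in> integer_vectors \<Longrightarrow> \<xi> \<noteq> 0 \<Longrightarrow> Z \<in> null_sets lborel \<Longrightarrow>
      (\<lambda>x. \<xi> \<bullet> v x) -` Z \<inter> space N \<in> null_sets N"
  shows "keplerian_shear (N \<Otimes>\<^sub>M torus_measure) (shear_flow v)"
proof -
  interpret N: prob_space N by fact
  interpret NT: pair_prob_space N "torus_measure :: 'd torus measure" ..
  let ?M = "N \<Otimes>\<^sub>M (torus_measure :: 'd torus measure)"
  interpret flow: probability_flow ?M "shear_flow v"
    by unfold_locales (rule measure_preserving_shear_flow[OF N v])
  have ind: "integrable ?M (\<lambda>(x, y). indicator B x * p y)"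
    if B[measurable]: "B \<in> sets N" and p[measurable]: "p \<in> borel_measurable borel" and bd: "\<exists>C. \<forall>y. \<bar>p y\<bar> \<le> C"
    for B and p :: "'d torus \<Rightarrow> real"
  proof -
    obtain C where C: "\<And>y. \<bar>p y\<bar> \<le> C" using bd by blast
    show ?thesis
    proof (rule NT.integrable_const_bound[where B = C])
      have "0 \<le> C" using order_trans[OF abs_ge_zero C] .
      then show "AE z in ?M. norm (case z of (x, y) \<Rightarrow> indicator B x * p y) \<le> C"
        using C by (auto simp: indicator_def)
    qed measurable
  qed
  have const: "flow.shears (\<lambda>(x, y). indicator B x * c)" if B: "B \<in> sets N" for B and c :: real
  proof (rule flow.shears_invariant)
    show "integrable ?M (\<lambda>(x, y). indicator B x * c)" by (rule ind[OF B]) auto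
    show "(case shear_flow v t z of (x, y) \<Rightarrow> indicator B x * c) = (case z of (x, y) \<Rightarrow> indicator B x * c)" for t z
      by (cases z) (simp add: shear_flow_def)
    have "B \<times> UNIV \<in> sets flow.\<I>"
      using B by (auto simp: flow.sets_invariant_algebra shear_flow_def)
    then have "(\<lambda>z. indicator (B \<times> UNIV) z * c) \<in> borel_measurable flow.\<I>" by measurable
    moreover have "(\<lambda>z. indicator (B \<times> UNIV) z * c) = (\<lambda>(x, y :: 'd torus). indicator B x * c)"
      by (auto simp: indicator_def fun_eq_iff)
    ultimately show "(\<lambda>(x, y). indicator B x * c) \<in> borel_measurable flow.\<I>" by simp
  qed
  \<comment> \<open>the first coordinate has law \<open>N\<close>, so \<open>\<langle>\<xi>, v\<rangle>\<close> keeps an absolutely continuous law on the product\<close>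
  have oscillate: "((\<lambda>t. \<integral>z. \<psi> z * cos (2 * pi * (t * (\<xi> \<bullet> v (fst z)))) \<partial>?M) \<longlongrightarrow> 0) at_top"
    "((\<lambda>t. \<integral>z. \<psi> z * sin (2 * pi * (t * (\<xi> \<bullet> v (fst z)))) \<partial>?M) \<longlongrightarrow> 0) at_top"
    if \<xi>: "\<xi> \<in> integer_vectors" "\<xi> \<noteq> 0" and \<psi>: "integrable ?M \<psi>" for \<xi> \<psi>
  proof -
    have u: "(\<lambda>z. \<xi> \<bullet> v (fst z)) \<in> borel_measurable ?M" by measurable
    have null: "(\<lambda>z. \<xi> \<bullet> v (fst z)) -` Z \<inter> space ?M \<in> null_sets ?M" if Z: "Z \<in> null_sets lborel" for Z
    proof -
      have "(\<lambda>z. \<xi> \<bullet> v (fst z)) -` Z \<inter> space ?M = ((\<lambda>x. \<xi> \<bullet> v x) -` Z \<inter> space N) \<times> UNIV"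
        by (auto simp: space_pair_measure)
      moreover have "((\<lambda>x. \<xi> \<bullet> v x) -` Z \<inter> space N) \<times> (UNIV :: 'd torus set) \<in> null_sets ?M"
        using ac[OF \<xi> Z] torus_measure.emeasure_pair_measure_Times[of "(\<lambda>x. \<xi> \<bullet> v x) -` Z \<inter> space N" N UNIV]
        by (auto simp: null_sets_def)
      ultimately show ?thesis by simp
    qed
    have pi: "\<bar>sin s\<bar> \<le> 2 * pi" "\<bar>cos s\<bar> \<le> 2 * pi" for s
      using pi_gt3 abs_sin_le_one[of s] abs_cos_le_one[of s] by linarith+
    show "((\<lambda>t. \<integral>z. \<psi> z * cos (2 * pi * (t * (\<xi> \<bullet> v (fst z)))) \<partial>?M) \<longlongrightarrow> 0) at_top"
      by (rule Riemann_Lebesgue_phase[where k = "\<lambda>s. cos (2 * pi * s)" and K = "\<lambda>s. sin (2 * pi * s) / (2 * pi)", OF _ _ _ _ u null \<psi>])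
        (auto intro!: derivative_eq_intros continuous_intros pi)
    show "((\<lambda>t. \<integral>z. \<psi> z * sin (2 * pi * (t * (\<xi> \<bullet> v (fst z)))) \<partial>?M) \<longlongrightarrow> 0) at_top"
      by (rule Riemann_Lebesgue_phase[where k = "\<lambda>s. sin (2 * pi * s)" and K = "\<lambda>s. - cos (2 * pi * s) / (2 * pi)", OF _ _ _ _ u null \<psi>])
        (auto intro!: derivative_eq_intros continuous_intros pi)
  qed
  have chars: "flow.shears (\<lambda>(x, y). indicator B x * torus_cos \<xi> y)" "flow.shears (\<lambda>(x, y). indicator B x * torus_sin \<xi> y)"
    if B[measurable]: "B \<in> sets N" and \<xi>: "\<xi> \<in> integer_vectors" for B \<xi>
  proof -
    have [measurable]: "torus_cos \<xi> \<in> borel_measurable borel" "torus_sin \<xi> \<in> borel_measurable borel"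
      using \<xi> by (auto intro: trig_polynomials_measurable trig_polynomials.cos trig_polynomials.sin)
    have bd: "\<bar>torus_cos \<xi> y\<bar> \<le> 1" "\<bar>torus_sin \<xi> y\<bar> \<le> 1" for y by (simp_all add: torus_cos_def torus_sin_def)
    have ints: "integrable ?M (\<lambda>(x, y). indicator B x * torus_cos \<xi> y)" "integrable ?M (\<lambda>(x, y). indicator B x * torus_sin \<xi> y)"
      by (auto intro!: ind[OF B] exI[of _ 1] bd)
    have "flow.shears (\<lambda>(x, y). indicator B x * torus_cos \<xi> y) \<and> flow.shears (\<lambda>(x, y). indicator B x * torus_sin \<xi> y)"
    proof (cases "\<xi> = 0")
      case True
      then show ?thesis using const[OF B, of 1] const[OF B, of 0] by (simp add: torus_cos_def torus_sin_def)
    next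
      case False
      have lim: "((\<lambda>t. \<integral>z. (case shear_flow v t z of (x, y) \<Rightarrow> indicator B x * torus_cos \<xi> y) * h z \<partial>?M) \<longlongrightarrow> 0) at_top"
          "((\<lambda>t. \<integral>z. (case shear_flow v t z of (x, y) \<Rightarrow> indicator B x * torus_sin \<xi> y) * h z \<partial>?M) \<longlongrightarrow> 0) at_top"
        if h: "h \<in> borel_measurable ?M" "\<And>z. \<bar>h z\<bar> \<le> 1" for h
      proof -
        let ?C = "\<lambda>z. (case z of (x, y) \<Rightarrow> indicator B x * torus_cos \<xi> y) * h z"
        let ?S = "\<lambda>z. (case z of (x, y) \<Rightarrow> indicator B x * torus_sin \<xi> y) * h z"
        let ?c = "\<lambda>t z. cos (2 * pi * (t * (\<xi> \<bullet> v (fst z))))" and ?s = "\<lambda>t z. sin (2 * pi * (t * (\<xi> \<bullet> v (fst z))))"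
        have iCS: "integrable ?M ?C" "integrable ?M ?S"
          by (rule flow.integrable_mult_bounded[OF _ h]; rule ints)+
        have int: "integrable ?M (\<lambda>z. ?C z * ?c t z)" "integrable ?M (\<lambda>z. ?C z * ?s t z)"
          "integrable ?M (\<lambda>z. ?S z * ?c t z)" "integrable ?M (\<lambda>z. ?S z * ?s t z)" for t
          by (rule flow.integrable_mult_bounded[where c = 1]; (rule iCS)?; auto)+
        have "(\<integral>z. (case shear_flow v t z of (x, y) \<Rightarrow> indicator B x * torus_cos \<xi> y) * h z \<partial>?M) =
            (\<integral>z. ?C z * ?c t z \<partial>?M) - (\<integral>z. ?S z * ?s t z \<partial>?M)" for t
          unfolding Bochner_Integration.integral_diff[OF int(1) int(4), symmetric]
          by (rule Bochner_Integration.integral_cong)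
            (auto simp: shear_flow_def torus_character_add[OF \<xi>] algebra_simps)
        then show "((\<lambda>t. \<integral>z. (case shear_flow v t z of (x, y) \<Rightarrow> indicator B x * torus_cos \<xi> y) * h z \<partial>?M) \<longlongrightarrow> 0) at_top"
          using tendsto_diff[OF oscillate(1)[OF \<xi> False iCS(1)] oscillate(2)[OF \<xi> False iCS(2)]] by simp
        have "(\<integral>z. (case shear_flow v t z of (x, y) \<Rightarrow> indicator B x * torus_sin \<xi> y) * h z \<partial>?M) =
            (\<integral>z. ?S z * ?c t z \<partial>?M) + (\<integral>z. ?C z * ?s t z \<partial>?M)" for t
          unfolding Bochner_Integration.integral_add[OF int(3) int(2), symmetric]
          by (rule Bochner_Integration.integral_cong)
            (auto simp: shear_flow_def torus_character_add[OF \<xi>] algebra_simps)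
        then show "((\<lambda>t. \<integral>z. (case shear_flow v t z of (x, y) \<Rightarrow> indicator B x * torus_sin \<xi> y) * h z \<partial>?M) \<longlongrightarrow> 0) at_top"
          using tendsto_add[OF oscillate(1)[OF \<xi> False iCS(2)] oscillate(2)[OF \<xi> False iCS(1)]] by simp
      qed
      show ?thesis
        by (intro conjI flow.shearsI_weak_limit[where p = "\<lambda>_. 0"] ints) (use lim in auto)
    qed
    then show "flow.shears (\<lambda>(x, y). indicator B x * torus_cos \<xi> y)" "flow.shears (\<lambda>(x, y). indicator B x * torus_sin \<xi> y)"
      by auto
  qed
  have trig: "flow.shears (\<lambda>(x, y). indicator B x * p y)" if B: "B \<in> sets N" and "p \<in> trig_polynomials" for B p
    using that(2)
  proof induction
    case (add p q)
    have "integrable ?M (\<lambda>(x, y). indicator B x * p y)" "integrable ?M (\<lambda>(x, y). indicator B x * q y)"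
      using add.hyps by (auto intro!: ind[OF B] trig_polynomials_measurable trig_polynomials_bounded)
    from flow.shears_add[OF this add.IH] show ?case by (simp add: split_def distrib_left)
  next
    case (scale p c)
    have "integrable ?M (\<lambda>(x, y). indicator B x * p y)"
      using scale.hyps by (auto intro!: ind[OF B] trig_polynomials_measurable trig_polynomials_bounded)
    from flow.shears_scale[OF this scale.IH, of c] show ?case by (simp add: split_def mult.left_commute)
  qed (use chars[OF B] in auto)
  have cont: "flow.shears (\<lambda>(x, y). indicator B x * F (torus_embedding y))"
    if B[measurable]: "B \<in> sets N" and F: "continuous_on UNIV F" for B and F :: "_ \<Rightarrow> real"
  proof -
    have cpt: "compact (range (torus_embedding :: 'd torus \<Rightarrow> _))"
      by (intro compact_continuous_image continuous_on_torus_embedding compact_torus)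
    have F': "continuous_on (range (torus_embedding :: 'd torus \<Rightarrow> _)) F"
      using F by (rule continuous_on_subset) simp
    have "\<exists>p. real_polynomial_function p \<and> (\<forall>y :: 'd torus. \<bar>F (torus_embedding y) - p (torus_embedding y)\<bar> < inverse (Suc n))" for n :: nat
    proof -
      have pos: "0 < inverse (real (Suc n))" by simp
      obtain p where "real_polynomial_function p"
          "\<And>w. w \<in> range (torus_embedding :: 'd torus \<Rightarrow> _) \<Longrightarrow> \<bar>F w - p w\<bar> < inverse (Suc n)"
        using Stone_Weierstrass_real_polynomial_function[OF cpt F' pos] that by (metis (no_types, lifting))
      then show ?thesis by blast
    qed
    then obtain p where p: "\<And>n. real_polynomial_function (p n)"
      and close: "\<And>n y. \<bar>F (torus_embedding y) - p n (torus_embedding y)\<bar> < inverse (Suc n)"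
      by metis
    have F_cont: "continuous_on UNIV (\<lambda>y :: 'd torus. F (torus_embedding y))"
      by (rule continuous_on_compose2[OF F continuous_on_torus_embedding]) simp
    have Fm: "(\<lambda>y :: 'd torus. F (torus_embedding y)) \<in> borel_measurable borel"
      using F_cont by (rule borel_measurable_continuous_onI)
    have pt: "(\<lambda>y :: 'd torus. p n (torus_embedding y)) \<in> trig_polynomials" for n
      by (rule polynomial_on_torus_embedding[OF p])
    note pm = trig_polynomials_measurable[OF pt]
    have "bounded (range (\<lambda>y :: 'd torus. F (torus_embedding y)))"
      by (intro compact_imp_bounded compact_continuous_image F_cont compact_torus)
    then have C: "\<exists>C. \<forall>y :: 'd torus. \<bar>F (torus_embedding y)\<bar> \<le> C"
      by (simp add: bounded_real)
    have intp: "integrable ?M (\<lambda>(x, y). indicator B x * p n (torus_embedding y))" for n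
      by (rule ind[OF B pm trig_polynomials_bounded[OF pt]])
    have intF: "integrable ?M (\<lambda>(x, y). indicator B x * F (torus_embedding y))" by (rule ind[OF B Fm C])
    show ?thesis
    proof (rule flow.shears_L1_limit[where s = "\<lambda>n (x, y). indicator B x * p n (torus_embedding y)", OF intp trig[OF B pt] intF])
      show "(\<lambda>n. \<integral>z. \<bar>(case z of (x, y) \<Rightarrow> indicator B x * p n (torus_embedding y)) - (case z of (x, y) \<Rightarrow> indicator B x * F (torus_embedding y))\<bar> \<partial>?M) \<longlonglongrightarrow> 0"
      proof (rule Lim_null_comparison[OF always_eventually LIMSEQ_inverse_real_of_nat], rule allI)
        fix n
        let ?D = "\<lambda>z. \<bar>(case z of (x, y) \<Rightarrow> indicator B x * p n (torus_embedding y)) - (case z of (x, y) \<Rightarrow> indicator B x * F (torus_embedding y))\<bar>"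
        have "(\<integral>z. ?D z \<partial>?M) \<le> (\<integral>z. inverse (Suc n) \<partial>?M)"
        proof (rule integral_mono)
          show "integrable ?M ?D" using intp intF by (intro integrable_abs Bochner_Integration.integrable_diff)
          show "?D z \<le> inverse (Suc n)" for z
            using close[of "snd z" n] by (auto simp: split_def indicator_def abs_minus_commute less_imp_le)
        qed simp
        moreover have "0 \<le> (\<integral>z. ?D z \<partial>?M)" by (rule Bochner_Integration.integral_nonneg) simp
        ultimately show "norm (\<integral>z. ?D z \<partial>?M) \<le> inverse (Suc n)"
          by (simp add: NT.prob_space)
      qed
    qed
  qed
  have closed: "flow.shears (indicator (B \<times> C))"
    if B[measurable]: "B \<in> sets N" and C: "closed C" for B and C :: "'d torus set"
  proof (cases "C = {}")
    case True
    then show ?thesis using const[OF B, of 0] by (simp add: indicator_def[abs_def] split_def)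
  next
    case False
    have Cm[measurable]: "C \<in> sets borel" using C by simp
    have "compact (UNIV \<inter> C)" using compact_torus C by (rule compact_Int_closed)
    then have "compact (torus_embedding ` C)"
      by (intro compact_continuous_image continuous_on_torus_embedding) simp
    then have clos: "closed (torus_embedding ` C)" by (rule compact_imp_closed)
    \<comment> \<open>continuous functions that equal \<open>1\<close> on the embedded copy of \<open>C\<close> and decrease to \<open>0\<close> off it\<close>
    define F where "F n w = max 0 (1 - real n * infdist w (torus_embedding ` C))" for n w
    have Fc: "continuous_on S (F n)" for n S
      unfolding F_def by (intro continuous_intros)
    have F_bd: "0 \<le> F n w" "F n w \<le> 1" for n w by (auto simp: F_def infdist_nonneg)
    have F_lim: "(\<lambda>n. F n (torus_embedding y)) \<longlonglongrightarrow> indicator C y" for y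
    proof (cases "y \<in> C")
      case True
      then show ?thesis by (simp add: F_def)
    next
      case False
      then have "torus_embedding y \<notin> torus_embedding ` C" using inj_torus_embedding by (auto dest: injD)
      then have pos: "infdist (torus_embedding y) (torus_embedding ` C) > 0"
        using clos \<open>C \<noteq> {}\<close> by (metis image_is_empty in_closed_iff_infdist_zero infdist_nonneg less_eq_real_def)
      obtain N :: nat where N: "1 / infdist (torus_embedding y) (torus_embedding ` C) \<le> real N"
        using real_arch_simple by blast
      have "F n (torus_embedding y) = 0" if "n \<ge> N" for n
      proof -
        have "1 / infdist (torus_embedding y) (torus_embedding ` C) \<le> real n" using N that by linarith
        then show ?thesis using pos by (simp add: F_def divide_le_eq)
      qed
      then show ?thesis using False
        by (intro tendsto_eventually) (auto simp: eventually_sequentially)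
    qed
    have Fm[measurable]: "(\<lambda>y :: 'd torus. F n (torus_embedding y)) \<in> borel_measurable borel" for n
      by (rule borel_measurable_continuous_onI, rule continuous_on_compose2[OF Fc[of UNIV] continuous_on_torus_embedding]) simp
    have intF: "integrable ?M (\<lambda>(x, y). indicator B x * F n (torus_embedding y))" for n
      by (rule ind[OF B Fm]) (simp add: abs_of_nonneg[OF F_bd(1)], rule exI[of _ 1], simp only: F_bd simp_thms)
    have eq: "indicator (B \<times> C) = (\<lambda>(x, y). indicator B x * indicator C y :: real)"
      by (auto simp: indicator_def fun_eq_iff)
    have intC: "integrable ?M (\<lambda>(x, y). indicator B x * indicator C y :: real)"
      by (rule ind[OF B]) (auto simp: indicator_def intro!: exI[of _ 1])
    show ?thesis unfolding eq
    proof (rule flow.shears_L1_limit[where s = "\<lambda>n (x, y). indicator B x * F n (torus_embedding y)", OF intF cont[OF B Fc] intC])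
      let ?D = "\<lambda>n z. \<bar>(case z of (x, y) \<Rightarrow> indicator B x * F n (torus_embedding y)) - (case z of (x, y) \<Rightarrow> indicator B x * indicator C y)\<bar>"
      have "(\<lambda>n. \<integral>z. ?D n z \<partial>?M) \<longlonglongrightarrow> (\<integral>z. 0 \<partial>?M)"
      proof (rule integral_dominated_convergence[where w = "\<lambda>_. 1"])
        show "AE z in ?M. (\<lambda>n. (?D n z)) \<longlonglongrightarrow> 0"
          using F_lim by (auto simp: split_def intro!: tendsto_rabs_zero LIM_zero tendsto_mult_left)
        have "\<bar>b * F n w - b * c\<bar> \<le> 1" if "b \<in> {0, 1}" "c \<in> {0, 1}" for b c :: real and n w
          using that F_bd[of n w] by auto
        then show "AE z in ?M. norm (?D n z) \<le> 1" for n
          by (intro AE_I2) (auto simp: split_def indicator_def)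
      qed auto
      then show "(\<lambda>n. \<integral>z. (?D n z) \<partial>?M) \<longlonglongrightarrow> 0" by simp
    qed
  qed
  let ?G = "{a \<times> b | a b. a \<in> sets N \<and> b \<in> {C :: 'd torus set. closed C}}"
  show ?thesis
  proof (rule flow.keplerian_shear_if_shears_pi_system[where G = ?G])
    have sub: "?G \<subseteq> Pow (space N \<times> UNIV)" using sets.sets_into_space by fastforce
    have "sets ?M = sets (sigma (space N \<times> space (torus_measure :: 'd torus measure)) ?G)"
    proof (rule sets_pair_eq[where Ca = "{space N}" and Cb = "{UNIV}"])
      show "sets N = sigma_sets (space N) (sets N)" by (rule sets.sigma_sets_eq[symmetric])
      show "sets torus_measure = sigma_sets (space torus_measure) {C :: 'd torus set. closed C}"
        by (simp add: borel_eq_closed)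
    qed (auto dest: sets.sets_into_space)
    then show "sets ?M = sigma_sets (space ?M) ?G"
      using sub by (simp add: space_pair_measure)
    show "?G \<subseteq> Pow (space ?M)" using sub by (simp add: space_pair_measure)
    show "Int_stable ?G"
    proof (rule Int_stableI)
      fix X Y assume "X \<in> ?G" "Y \<in> ?G"
      then obtain a b a' b' where "X = a \<times> b" "Y = a' \<times> b'" "a \<in> sets N" "a' \<in> sets N" "closed b" "closed b'"
        by auto
      then show "X \<inter> Y \<in> ?G"
        by (auto simp: Times_Int_Times intro!: exI[of _ "a \<inter> a'"] exI[of _ "b \<inter> b'"])
    qed
    show "flow.shears (indicator A)" if "A \<in> ?G" for A
      using that closed by auto
  qed
qed

section \<open>Level sets away from critical points\<close>

text \<open>
By Fubini, a set of the form \<open>Z \<times> \<real>\<^sup>n\<^sup>-\<^sup>1\<close> is null, with the convention \<open>0 \<cdot> \<infinity> = 0\<close>.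
\<close>

lemma negligible_slab:
  fixes b :: "'a::euclidean_space"
  assumes b: "b \<in> Basis" and Z: "Z \<in> null_sets (lborel :: real measure)"
  shows "negligible {y. y \<bullet> b \<in> Z}"
proof -
  have [measurable]: "Z \<in> sets borel" using Z by auto
  have "emeasure lborel {y :: 'a. y \<bullet> b \<in> Z} = (\<integral>\<^sup>+y. indicator {y. y \<bullet> b \<in> Z} y \<partial>(lborel :: 'a measure))"
    by (subst nn_integral_indicator) auto
  also have "\<dots> = (\<integral>\<^sup>+y. (\<Prod>c\<in>Basis. (if c = b then indicator Z (y \<bullet> c) else 1)) \<partial>(lborel :: 'a measure))"
    using b by (intro nn_integral_cong) (auto simp: prod.delta indicator_def)
  also have "\<dots> = (\<integral>\<^sup>+y. (\<Prod>c\<in>Basis. (if c = b then indicator Z else (\<lambda>_. 1)) (y \<bullet> c)) \<partial>(lborel :: 'a measure))"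
    by (intro nn_integral_cong prod.cong) auto
  also have "\<dots> = (\<Prod>c\<in>Basis. \<integral>\<^sup>+s. (if c = b then indicator Z else (\<lambda>_. 1)) s \<partial>(lborel :: real measure))"
    by (rule nn_integral_lborel_prod) auto
  also have "\<dots> = 0"
    using b Z by (intro prod_zero) (auto intro!: bexI[of _ b] simp: null_sets_def)
  finally have "{y :: 'a. y \<bullet> b \<in> Z} \<in> null_sets lborel"
    by (intro null_setsI) auto
  then show ?thesis
    by (simp add: negligible_iff_null_sets null_sets_completionI)
qed

text \<open>
Where the derivative is injective, \<open>f\<close> expands the distance to all sufficiently near points by a positive factor.
Sorting the points by this factor and by the meaning of \<open>near\<close> yields countably many sets \<open>T k\<close>. On a small
piece of \<open>T k\<close> the inverse of \<open>f\<close> is Lipschitz, and Lipschitz maps preserve null sets.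
\<close>

lemma negligible_if_image_negligible:
  fixes f :: "'a::euclidean_space \<Rightarrow> 'a"
  assumes der: "\<And>x. x \<in> S \<Longrightarrow> (f has_derivative f' x) (at x)"
    and inj: "\<And>x. x \<in> S \<Longrightarrow> inj (f' x)"
    and neg: "negligible (f ` S)"
  shows "negligible S"
proof -
  define T where "T k = {x \<in> S. \<forall>y. norm (y - x) < 1 / Suc k \<longrightarrow> norm (y - x) \<le> Suc k * norm (f y - f x)}" for k
  have cover: "\<exists>k. x \<in> T k" if x: "x \<in> S" for x
  proof -
    have lin: "linear (f' x)" using der[OF x] by (rule has_derivative_linear)
    obtain B where B: "B > 0" "\<And>h. B * norm h \<le> norm (f' x h)"
      using linear_inj_bounded_below_pos[OF lin inj[OF x]] by blast
    obtain d where d: "d > 0" "\<And>y. norm (y - x) < d \<Longrightarrow> norm (f y - f x - f' x (y - x)) \<le> B / 2 * norm (y - x)"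
      using der[OF x] B(1) unfolding has_derivative_at_alt by (meson half_gt_zero)
    obtain k :: nat where k: "1 / d + 2 / B < real k" using reals_Archimedean2 by blast
    have "norm (y - x) \<le> Suc k * norm (f y - f x)" if y: "norm (y - x) < 1 / Suc k" for y
    proof -
      have "0 < 1 / d" "0 < 2 / B" using B(1) d(1) by simp_all
      then have "1 / d < real (Suc k)" "2 / B < real (Suc k)" using k by linarith+
      then have "1 / Suc k < d" "1 / Suc k < B / 2"
        using B(1) d(1) by (simp_all add: field_simps)
      then have "norm (f y - f x - f' x (y - x)) \<le> B / 2 * norm (y - x)" using d(2) y by force
      then have "B / 2 * norm (y - x) \<le> norm (f y - f x)"
        using B(2)[of "y - x"] norm_triangle_ineq2[of "f' x (y - x)" "f' x (y - x) - (f y - f x)"]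
        by (simp add: norm_minus_commute)
      moreover have "1 / Suc k * norm (y - x) \<le> B / 2 * norm (y - x)"
        using \<open>1 / Suc k < B / 2\<close> by (intro mult_right_mono) auto
      ultimately have "1 / Suc k * norm (y - x) \<le> norm (f y - f x)" by linarith
      then show ?thesis by (simp add: field_simps)
    qed
    then show ?thesis using x by (auto simp: T_def)
  qed
  have "negligible (T k)" for k
  proof (subst locally_negligible_alt, intro ballI)
    fix z assume z: "z \<in> T k"
    define U where "U = T k \<inter> ball z (1 / (2 * Suc k))"
    have near: "norm (y - x) \<le> Suc k * norm (f y - f x)" if "x \<in> U" "y \<in> U" for x y
    proof -
      have "norm (y - x) \<le> norm (y - z) + norm (x - z)"
        using norm_triangle_ineq4[of "y - z" "x - z"] by simp
      also have "\<dots> < 1 / (2 * Suc k) + 1 / (2 * Suc k)"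
        using that by (intro add_strict_mono) (auto simp: U_def dist_norm norm_minus_commute)
      also have "\<dots> = 1 / Suc k" by (simp add: field_simps)
      finally show ?thesis using that by (auto simp: U_def T_def)
    qed
    then have injU: "inj_on f U"
      by (intro inj_onI) (metis norm_le_zero_iff norm_zero mult_zero_right right_minus_eq)
    have "negligible (inv_into U f ` (f ` U))"
    proof (rule negligible_locally_Lipschitz_image)
      show "negligible (f ` U)"
        using neg by (rule negligible_subset) (auto simp: U_def T_def)
      show "\<exists>W B. open W \<and> w \<in> W \<and> (\<forall>u \<in> f ` U \<inter> W. norm (inv_into U f u - inv_into U f w) \<le> B * norm (u - w))"
        if "w \<in> f ` U" for w
        using that near injU by (intro exI[of _ UNIV] exI[of _ "real (Suc k)"]) auto
    qed simp
    moreover have "inv_into U f ` (f ` U) = U" using injU by (simp add: inv_into_image_cancel)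
    ultimately have "negligible U" by simp
    moreover have "openin (top_of_set (T k)) U" unfolding U_def by (rule openin_open_Int) simp
    moreover have "z \<in> U" using z by (simp add: U_def)
    ultimately show "\<exists>U. openin (top_of_set (T k)) U \<and> z \<in> U \<and> negligible U" by blast
  qed
  then have "negligible (\<Union>k. T k)" by (intro negligible_countable_Union) auto
  then show ?thesis by (rule negligible_subset) (use cover in auto)
qed

text \<open>
Where the derivative of \<open>F\<close> in direction \<open>b\<close> is nonzero, replacing the coordinate \<open>x \<bullet> b\<close> by
\<open>F x\<close> gives a map with injective derivative; it sends the level set into the slab over \<open>Z\<close>.
\<close>

lemma negligible_noncritical_level:
  fixes F :: "'a::euclidean_space \<Rightarrow> real"
  assumes der: "\<And>x. x \<in> S \<Longrightarrow> (F has_derivative F' x) (at x)"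
    and noncrit: "\<And>x. x \<in> S \<Longrightarrow> \<exists>b\<in>Basis. F' x b \<noteq> 0"
    and Z: "Z \<in> null_sets lborel"
  shows "negligible {x \<in> S. F x \<in> Z}"
proof -
  have piece: "negligible {x \<in> S. F x \<in> Z \<and> F' x b \<noteq> 0}" if b: "b \<in> Basis" for b
  proof (rule negligible_if_image_negligible)
    \<comment> \<open>the coordinate along \<open>b\<close> is replaced by \<open>F\<close>\<close>
    let ?f = "\<lambda>x. x + (F x - x \<bullet> b) *\<^sub>R b"
    show "(?f has_derivative (\<lambda>h. h + (F' x h - h \<bullet> b) *\<^sub>R b)) (at x)"
      if "x \<in> {x \<in> S. F x \<in> Z \<and> F' x b \<noteq> 0}" for x
      using that der by (auto intro!: derivative_eq_intros)
    show "inj (\<lambda>h. h + (F' x h - h \<bullet> b) *\<^sub>R b)" if x: "x \<in> {x \<in> S. F x \<in> Z \<and> F' x b \<noteq> 0}" for x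
    proof -
      interpret F': bounded_linear "F' x" using x der by (auto intro: has_derivative_bounded_linear)
      have lin: "linear (\<lambda>h. h + (F' x h - h \<bullet> b) *\<^sub>R b)"
        by (intro linearI) (simp_all add: F'.add F'.scale inner_add_left algebra_simps)
      show ?thesis
        unfolding linear_injective_0[OF lin]
      proof (intro allI impI)
        fix h assume h: "h + (F' x h - h \<bullet> b) *\<^sub>R b = 0"
        then have "(h + (F' x h - h \<bullet> b) *\<^sub>R b) \<bullet> b = 0" by simp
        then have "F' x h = 0" using b by (simp add: inner_add_left)
        with h have hb: "h = (h \<bullet> b) *\<^sub>R b" by (simp add: algebra_simps)
        then have "F' x h = (h \<bullet> b) * F' x b" by (metis F'.scale real_scaleR_def)
        then have "h \<bullet> b = 0" using \<open>F' x h = 0\<close> x by simp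
        then show "h = 0" using hb by simp
      qed
    qed
    show "negligible (?f ` {x \<in> S. F x \<in> Z \<and> F' x b \<noteq> 0})"
      using b by (intro negligible_subset[OF negligible_slab[OF b Z]]) (auto simp: inner_add_left)
  qed
  have "negligible (\<Union>b\<in>Basis. {x \<in> S. F x \<in> Z \<and> F' x b \<noteq> 0})"
    using piece by (intro negligible_Union) auto
  then show ?thesis by (rule negligible_subset) (use noncrit in auto)
qed

section \<open>Calculus of \<open>C\<^sup>k\<close> functions\<close>

lemma Ck_on_cong:
  assumes "open S" "\<And>x. x \<in> S \<Longrightarrow> f x = g x" "Ck_on n S f"
  shows "Ck_on n S g"
  using assms(2,3)
proof (induction n arbitrary: f g)
  case 0
  then show ?case by (simp cong: continuous_on_cong)
next
  case (Suc n)
  have "g differentiable at x" "frechet_derivative f (at x) = frechet_derivative g (at x)" if x: "x \<in> S" for x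
  proof -
    have f: "f differentiable at x" using Suc.prems(2) x by simp
    then obtain D where "(f has_derivative D) (at x)" by (auto simp: differentiable_def)
    then have "(g has_derivative D) (at x)"
      using Suc.prems(1) by (rule has_derivative_transform_within_open[OF _ \<open>open S\<close> x])
    then show "g differentiable at x" by (auto simp: differentiable_def)
    show "frechet_derivative f (at x) = frechet_derivative g (at x)"
      by (rule frechet_derivative_transform_within_open[OF f \<open>open S\<close> x Suc.prems(1)])
  qed
  note eq = this
  have "Ck_on n S (\<lambda>x. frechet_derivative g (at x) h)" for h
  proof (rule Suc.IH)
    show "frechet_derivative f (at x) h = frechet_derivative g (at x) h" if "x \<in> S" for x
      using eq(2)[OF that] by simp
    show "Ck_on n S (\<lambda>x. frechet_derivative f (at x) h)" using Suc.prems(2) by simp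
  qed
  then show ?case using eq(1) by simp
qed

lemma Ck_on_imp_continuous_on: "Ck_on n S f \<Longrightarrow> continuous_on S f"
  by (cases n) (auto intro!: continuous_at_imp_continuous_on differentiable_imp_continuous_within)

lemma Ck_on_Suc_imp: "Ck_on (Suc n) S f \<Longrightarrow> Ck_on n S f"
proof (induction n arbitrary: f)
  case 0
  then show ?case using Ck_on_imp_continuous_on[OF 0] by simp
next
  case (Suc n)
  have "Ck_on n S (\<lambda>x. frechet_derivative f (at x) h)" for h
    using Suc.prems by (intro Suc.IH) simp
  then show ?case using Suc.prems by simp
qed

lemma Ck_on_le: "Ck_on n S f \<Longrightarrow> m \<le> n \<Longrightarrow> Ck_on m S f"
proof (induction n)
  case (Suc n)
  then show ?case using Ck_on_Suc_imp[OF Suc.prems(1)] by (cases "m = Suc n") (auto simp del: Ck_on.simps)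
qed simp

lemma Ck_on_locally:
  assumes "\<And>x. x \<in> S \<Longrightarrow> \<exists>T. open T \<and> x \<in> T \<and> Ck_on n T f"
  shows "Ck_on n S f"
  using assms
proof (induction n arbitrary: f)
  case 0
  show ?case unfolding Ck_on.simps
  proof (rule continuous_at_imp_continuous_on, rule ballI)
    fix x assume "x \<in> S"
    from 0[OF this] obtain T where "open T" "x \<in> T" "continuous_on T f" by auto
    then show "isCont f x" by (simp add: continuous_on_eq_continuous_at)
  qed
next
  case (Suc n)
  have "Ck_on n S (\<lambda>x. frechet_derivative f (at x) h)" for h
  proof (rule Suc.IH)
    fix x assume "x \<in> S"
    from Suc.prems[OF this] obtain T where "open T" "x \<in> T" "Ck_on (Suc n) T f" by blast
    then show "\<exists>T. open T \<and> x \<in> T \<and> Ck_on n T (\<lambda>x. frechet_derivative f (at x) h)" by auto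
  qed
  moreover have "f differentiable at x" if "x \<in> S" for x using Suc.prems[OF that] by auto
  ultimately show ?case by simp
qed

lemma Ck_on_const: "Ck_on n S (\<lambda>x. c)"
  by (induction n arbitrary: c) auto

lemma Ck_on_SucI:
  assumes "open S" "\<And>x. x \<in> S \<Longrightarrow> (f has_derivative f' x) (at x)" "\<And>h. Ck_on n S (\<lambda>x. f' x h)"
  shows "Ck_on (Suc n) S f"
  unfolding Ck_on.simps
proof (intro conjI ballI allI)
  show "f differentiable at x" if "x \<in> S" for x
    using assms(2)[OF that] by (auto simp: differentiable_def)
  show "Ck_on n S (\<lambda>x. frechet_derivative f (at x) h)" for h
  proof (rule Ck_on_cong[OF \<open>open S\<close> _ assms(3)])
    show "f' x h = frechet_derivative f (at x) h" if "x \<in> S" for x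
      using frechet_derivative_at[OF assms(2)[OF that]] by simp
  qed
qed

lemma Ck_on_SucD:
  assumes "Ck_on (Suc n) S f"
  shows "x \<in> S \<Longrightarrow> (f has_derivative frechet_derivative f (at x)) (at x)"
    and "Ck_on n S (\<lambda>x. frechet_derivative f (at x) h)"
  using assms by (auto simp: frechet_derivative_works)

lemma Ck_on_bounded_linear:
  assumes "bounded_linear L" "open S" "Ck_on n S f"
  shows "Ck_on n S (\<lambda>x. L (f x))"
  using assms(3)
proof (induction n arbitrary: f)
  case 0
  then show ?case using bounded_linear.continuous_on[OF assms(1)] by simp
next
  case (Suc n)
  show ?case
  proof (rule Ck_on_SucI[OF \<open>open S\<close>])
    show "((\<lambda>x. L (f x)) has_derivative (\<lambda>h. L (frechet_derivative f (at x) h))) (at x)" if "x \<in> S" for x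
      by (rule bounded_linear.has_derivative[OF assms(1) Ck_on_SucD(1)[OF Suc.prems that]])
    show "Ck_on n S (\<lambda>x. L (frechet_derivative f (at x) h))" for h
      by (rule Suc.IH[OF Ck_on_SucD(2)[OF Suc.prems]])
  qed
qed

lemma Ck_on_ident: "open S \<Longrightarrow> Ck_on n S (\<lambda>x. x)"
  by (cases n) (auto intro!: Ck_on_const simp: continuous_on_id)

lemma Ck_on_add:
  assumes "open S" "Ck_on n S f" "Ck_on n S g"
  shows "Ck_on n S (\<lambda>x. f x + g x)"
  using assms(2,3)
proof (induction n arbitrary: f g)
  case 0
  then show ?case by (simp add: continuous_on_add)
next
  case (Suc n)
  show ?case
  proof (rule Ck_on_SucI[OF \<open>open S\<close>])
    show "((\<lambda>x. f x + g x) has_derivative (\<lambda>h. frechet_derivative f (at x) h + frechet_derivative g (at x) h)) (at x)" if "x \<in> S" for x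
      by (rule has_derivative_add[OF Ck_on_SucD(1)[OF Suc.prems(1) that] Ck_on_SucD(1)[OF Suc.prems(2) that]])
    show "Ck_on n S (\<lambda>x. frechet_derivative f (at x) h + frechet_derivative g (at x) h)" for h
      by (rule Suc.IH[OF Ck_on_SucD(2)[OF Suc.prems(1)] Ck_on_SucD(2)[OF Suc.prems(2)]])
  qed
qed

lemma Ck_on_sum:
  assumes "open S" "\<And>i. i \<in> I \<Longrightarrow> Ck_on n S (f i)"
  shows "Ck_on n S (\<lambda>x. \<Sum>i\<in>I. f i x)"
  using assms(2)
  by (induction I rule: infinite_finite_induct) (auto intro: Ck_on_const Ck_on_add[OF \<open>open S\<close>])

lemma Ck_on_bounded_bilinear:
  assumes B: "bounded_bilinear B" and "open S" "Ck_on n S f" "Ck_on n S g"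
  shows "Ck_on n S (\<lambda>x. B (f x) (g x))"
  using assms(3,4)
proof (induction n arbitrary: f g)
  case 0
  then show ?case using bounded_bilinear.continuous_on[OF B] by simp
next
  case (Suc n)
  show ?case
  proof (rule Ck_on_SucI[OF \<open>open S\<close>])
    show "((\<lambda>x. B (f x) (g x)) has_derivative (\<lambda>h. B (f x) (frechet_derivative g (at x) h) + B (frechet_derivative f (at x) h) (g x))) (at x)" if "x \<in> S" for x
      by (rule bounded_bilinear.FDERIV[OF B Ck_on_SucD(1)[OF Suc.prems(1) that] Ck_on_SucD(1)[OF Suc.prems(2) that]])
    show "Ck_on n S (\<lambda>x. B (f x) (frechet_derivative g (at x) h) + B (frechet_derivative f (at x) h) (g x))" for h
      by (intro Ck_on_add[OF \<open>open S\<close>] Suc.IH Ck_on_SucD(2) Suc.prems Ck_on_Suc_imp)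
  qed
qed

text \<open>
By the chain rule, expanded in the basis of the intermediate space, a directional derivative of \<open>g \<circ> f\<close> is a
sum of products of functions of class \<open>C\<^sup>n\<close>.
\<close>

lemma Ck_on_compose:
  fixes f :: "'a::real_normed_vector \<Rightarrow> 'b::euclidean_space" and g :: "'b \<Rightarrow> 'c::real_normed_vector"
  assumes "open S" "open T" "f ` S \<subseteq> T" "Ck_on n S f" "Ck_on n T g"
  shows "Ck_on n S (\<lambda>x. g (f x))"
  using assms(4,5)
proof (induction n arbitrary: g)
  case 0
  then show ?case using assms(3) by (auto intro: continuous_on_compose2)
next
  case (Suc n)
  let ?f' = "\<lambda>x. frechet_derivative f (at x)" and ?g' = "\<lambda>y. frechet_derivative g (at y)"
  show ?case
  proof (rule Ck_on_SucI[OF \<open>open S\<close>])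
    fix x assume x: "x \<in> S"
    then have fx: "f x \<in> T" using assms(3) by auto
    note df = Ck_on_SucD(1)[OF Suc.prems(1) x] and dg = Ck_on_SucD(1)[OF Suc.prems(2) fx]
    have "linear (?g' (f x))" using dg by (rule has_derivative_linear)
    then have expand: "?g' (f x) w = (\<Sum>b\<in>Basis. (w \<bullet> b) *\<^sub>R ?g' (f x) b)" for w
      using linear_sum[of "?g' (f x)" "\<lambda>b. (w \<bullet> b) *\<^sub>R b" Basis] by (simp add: euclidean_representation linear_scale)
    show "((\<lambda>x. g (f x)) has_derivative (\<lambda>h. \<Sum>b\<in>Basis. (?f' x h \<bullet> b) *\<^sub>R ?g' (f x) b)) (at x)"
      by (rule has_derivative_eq_rhs[OF has_derivative_compose[OF df dg]], rule ext, rule expand)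
  next
    fix h
    have "Ck_on n S (\<lambda>x. ?g' (f x) b)" for b
      by (rule Suc.IH[OF Ck_on_Suc_imp[OF Suc.prems(1)] Ck_on_SucD(2)[OF Suc.prems(2)]])
    moreover have "Ck_on n S (\<lambda>x. ?f' x h \<bullet> b)" for b
      by (rule Ck_on_bounded_linear[OF bounded_linear_inner_left \<open>open S\<close> Ck_on_SucD(2)[OF Suc.prems(1)]])
    ultimately show "Ck_on n S (\<lambda>x. \<Sum>b\<in>Basis. (?f' x h \<bullet> b) *\<^sub>R ?g' (f x) b)"
      by (intro Ck_on_sum[OF \<open>open S\<close>] Ck_on_bounded_bilinear[OF bounded_bilinear_scaleR \<open>open S\<close>])
  qed
qed

lemma Ck_on_iterated_derivative:
  "Ck_on (length hs + m) S f \<Longrightarrow> Ck_on m S (iterated_derivative hs f)"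
proof (induction hs arbitrary: m)
  case (Cons h hs)
  have "Ck_on (Suc m) S (iterated_derivative hs f)"
    using Cons.prems by (intro Cons.IH) (simp only: length_Cons add_Suc_shift)
  then show ?case by simp
qed simp

lemma iterated_derivative_add_scaled:
  assumes S: "open S" and f: "Ck_on n S f" and g: "Ck_on n S g"
    and "length hs \<le> n" "x \<in> S"
  shows "iterated_derivative hs (\<lambda>y. f y + s *\<^sub>R g y) x = iterated_derivative hs f x + s *\<^sub>R iterated_derivative hs g x"
  using assms(4,5)
proof (induction hs arbitrary: x)
  case (Cons h hs)
  let ?D = "iterated_derivative hs"
  have sg: "Ck_on n S (\<lambda>y. s *\<^sub>R g y)"
    by (rule Ck_on_bounded_linear[OF bounded_linear_scaleR_right S g])
  have le: "length hs + Suc 0 \<le> n" using Cons.prems by simp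
  have diff: "?D F differentiable at x" if "Ck_on n S F" for F :: "'a \<Rightarrow> 'b"
  proof -
    have "Ck_on (Suc 0) S (?D F)"
      using that le by (intro Ck_on_iterated_derivative) (rule Ck_on_le)
    then show ?thesis using Cons.prems by simp
  qed
  have "frechet_derivative (?D (\<lambda>y. f y + s *\<^sub>R g y)) (at x) = frechet_derivative (\<lambda>y. ?D f y + s *\<^sub>R ?D g y) (at x)"
  proof (rule frechet_derivative_transform_within_open[OF _ S])
    show "?D (\<lambda>y. f y + s *\<^sub>R g y) differentiable at x"
      by (intro diff Ck_on_add[OF S f] sg)
  qed (use Cons in auto)
  also have "\<dots> = (\<lambda>h. frechet_derivative (?D f) (at x) h + s *\<^sub>R frechet_derivative (?D g) (at x) h)"
    by (rule frechet_derivative_at[symmetric])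
      (auto intro!: derivative_eq_intros diff[OF f, unfolded frechet_derivative_works] diff[OF g, unfolded frechet_derivative_works])
  finally show ?case by simp
qed simp

section \<open>Smooth bump functions\<close>

text \<open>
The functions \<open>p(1/t) exp(-1/t)\<close>, extended by \<open>0\<close>. Admitting a polynomial factor makes the class closed
under differentiation, so that smoothness follows by induction.
\<close>

definition flat_exp :: "real poly \<Rightarrow> real \<Rightarrow> real" where
  "flat_exp p t = (if t > 0 then poly p (inverse t) * exp (- inverse t) else 0)"

lemma poly_times_exp_minus_tendsto_0:
  fixes p :: "real poly"
  shows "((\<lambda>s. poly p s * exp (- s)) \<longlongrightarrow> 0) at_top"
proof -
  have "((\<lambda>s. \<Sum>i\<le>degree p. coeff p i * (s ^ i / exp s)) \<longlongrightarrow> (\<Sum>i\<le>degree p. coeff p i * 0)) at_top"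
    by (intro tendsto_sum tendsto_mult tendsto_const tendsto_power_div_exp_0)
  then show ?thesis
    by (simp add: poly_altdef sum_distrib_right exp_minus divide_inverse mult.assoc)
qed

lemma flat_exp_has_derivative:
  "(flat_exp p has_real_derivative flat_exp ([:0, 0, 1:] * (p - pderiv p)) t) (at t)"
proof -
  consider "t > 0" | "t < 0" | "t = 0" by linarith
  then show ?thesis
  proof cases
    case 1
    have "((\<lambda>t. poly p (inverse t) * exp (- inverse t)) has_real_derivative flat_exp ([:0, 0, 1:] * (p - pderiv p)) t) (at t)"
      using 1 by (auto intro!: derivative_eq_intros DERIV_chain2[OF poly_DERIV] simp: flat_exp_def field_simps power2_eq_square)
    then show ?thesis
      by (rule has_field_derivative_transform_within_open[where S = "{0<..}"]) (use 1 in \<open>auto simp: flat_exp_def\<close>)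
  next
    case 2
    have "((\<lambda>t. 0) has_real_derivative 0) (at t)" by simp
    then have "(flat_exp p has_real_derivative 0) (at t)"
      by (rule has_field_derivative_transform_within_open[where S = "{..<0}"]) (use 2 in \<open>auto simp: flat_exp_def\<close>)
    then show ?thesis using 2 by (simp add: flat_exp_def)
  next
    case 3
    have "((\<lambda>h. flat_exp p h / h) \<longlongrightarrow> 0) (at 0)"
      unfolding filterlim_at_split
    proof
      show "((\<lambda>h. flat_exp p h / h) \<longlongrightarrow> 0) (at_left 0)"
        by (rule tendsto_eventually) (auto simp: flat_exp_def eventually_at_filter)
      have "((\<lambda>s. poly ([:0, 1:] * p) s * exp (- s)) \<longlongrightarrow> 0) at_top" by (rule poly_times_exp_minus_tendsto_0)
      then have "((\<lambda>s. flat_exp p (inverse s) / inverse s) \<longlongrightarrow> 0) at_top"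
        by (rule Lim_transform_eventually)
          (auto simp: flat_exp_def field_simps intro!: eventually_mono[OF eventually_gt_at_top[of 0]])
      then show "((\<lambda>h. flat_exp p h / h) \<longlongrightarrow> 0) (at_right 0)"
        by (simp add: filterlim_at_right_to_top)
    qed
    then show ?thesis using 3 by (simp add: DERIV_def flat_exp_def)
  qed
qed

lemma Ck_on_flat_exp: "Ck_on n UNIV (flat_exp p)"
proof (induction n arbitrary: p)
  case 0
  show ?case using flat_exp_has_derivative[of p]
    by (auto intro!: continuous_at_imp_continuous_on DERIV_isCont)
next
  case (Suc n)
  let ?q = "[:0, 0, 1:] * (p - pderiv p)"
  show ?case
  proof (rule Ck_on_SucI)
    show "(flat_exp p has_derivative (\<lambda>h. flat_exp ?q x * h)) (at x)" for x
      using flat_exp_has_derivative[of p x] by (simp add: has_field_derivative_def)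
    have "(\<lambda>x. flat_exp ?q x * h) = flat_exp (smult h ?q)" for h
      by (auto simp: flat_exp_def fun_eq_iff)
    then show "Ck_on n UNIV (\<lambda>x. flat_exp ?q x * h)" for h
      using Suc.IH by simp
  qed simp
qed

text \<open>
A radial bump supported in the ball of radius \<open>r\<close>. It has no plateau, so that inside the ball its only
critical point is the centre.
\<close>

definition bump :: "'a::euclidean_space \<Rightarrow> real \<Rightarrow> 'a \<Rightarrow> real" where
  "bump z r y = flat_exp 1 (r\<^sup>2 - (y - z) \<bullet> (y - z))"

lemma Ck_on_bump: "Ck_on n UNIV (bump z r)"
proof -
  have sub: "Ck_on n UNIV (\<lambda>y. y + - z)" by (intro Ck_on_add Ck_on_ident Ck_on_const) auto
  have "Ck_on n UNIV (\<lambda>y. r\<^sup>2 + - ((y + - z) \<bullet> (y + - z)))"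
    by (intro Ck_on_add Ck_on_const Ck_on_bounded_linear[OF bounded_linear_minus[OF bounded_linear_ident]]
        Ck_on_bounded_bilinear[OF bounded_bilinear_inner] sub open_UNIV)
  from Ck_on_compose[OF open_UNIV open_UNIV _ this Ck_on_flat_exp[of n 1]]
  show ?thesis by (simp add: bump_def[abs_def])
qed

lemma bump_eq_0: "dist z y \<ge> r \<Longrightarrow> r \<ge> 0 \<Longrightarrow> bump z r y = 0"
proof -
  assume "dist z y \<ge> r" "r \<ge> 0"
  then have "r\<^sup>2 \<le> (norm (y - z))\<^sup>2" by (intro power_mono) (auto simp: dist_norm norm_minus_commute)
  then show ?thesis by (simp add: bump_def flat_exp_def power2_norm_eq_inner)
qed

lemma bump_noncritical:
  fixes z y :: "'a::euclidean_space"
  assumes "dist z y < r" "y \<noteq> z"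
  shows "\<exists>b\<in>Basis. frechet_derivative (bump z r) (at y) b \<noteq> 0"
proof -
  let ?c = "flat_exp ([:0, 0, 1:] * (1 - pderiv 1)) (r\<^sup>2 - (y - z) \<bullet> (y - z))"
  have "(bump z r has_derivative (\<lambda>h. ?c * (- (2 * ((y - z) \<bullet> h))))) (at y)"
    unfolding bump_def[abs_def]
    by (rule DERIV_compose_FDERIV[OF flat_exp_has_derivative, THEN has_derivative_eq_rhs])
      (auto intro!: derivative_eq_intros simp: inner_commute mult.commute)
  then have der: "frechet_derivative (bump z r) (at y) = (\<lambda>h. ?c * (- (2 * ((y - z) \<bullet> h))))"
    by (rule frechet_derivative_at[symmetric])
  have "(norm (y - z))\<^sup>2 < r\<^sup>2"
    using assms by (intro power_strict_mono) (auto simp: dist_norm norm_minus_commute)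
  then have "0 < r\<^sup>2 - (y - z) \<bullet> (y - z)" by (simp add: power2_norm_eq_inner)
  then have "?c \<noteq> 0" by (simp add: flat_exp_def)
  moreover obtain b where "b \<in> Basis" "(y - z) \<bullet> b \<noteq> 0"
    using assms(2) euclidean_all_zero_iff[of "y - z"] by auto
  ultimately show ?thesis unfolding der by (intro bexI[of _ b]) auto
qed

section \<open>The shear criterion on a Riemannian manifold\<close>

text \<open>
On the segment from the identity to \<open>B\<close> all matrices are positive definite, hence invertible, so the determinant
cannot change sign.
\<close>

lemma det_pos_if_positive_definite:
  fixes B :: "real ^ 'n::finite ^ 'n"
  assumes B: "\<And>u. u \<noteq> 0 \<Longrightarrow> u \<bullet> (B *v u) > 0"
  shows "det B > 0"
proof (rule ccontr)
  assume neg: "\<not> det B > 0"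
  let ?H = "\<lambda>t. t *\<^sub>R mat 1 + (1 - t) *\<^sub>R B :: real ^ 'n ^ 'n"
  have "continuous_on {0..1} (\<lambda>t. det (?H t))"
    unfolding det_def by (intro continuous_intros)
  then obtain t where t: "0 \<le> t" "t \<le> 1" "det (?H t) = 0"
    using IVT'[of "\<lambda>t. det (?H t)" 0 0 1] neg by auto
  then have "\<not> invertible (?H t)" by (simp add: invertible_det_nz)
  then obtain u where u: "u \<noteq> 0" "?H t *v u = 0"
    unfolding invertible_left_inverse matrix_left_invertible_ker by blast
  have "?H t *v u = t *\<^sub>R u + (1 - t) *\<^sub>R (B *v u)"
    by (simp add: matrix_vector_mult_add_rdistrib scaleR_matrix_vector_assoc[symmetric])
  then have "0 = t * (u \<bullet> u) + (1 - t) * (u \<bullet> (B *v u))"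
    using u(2) by (metis inner_add_right inner_scaleR_right inner_zero_right)
  moreover have "t * (u \<bullet> u) + (1 - t) * (u \<bullet> (B *v u)) > 0"
  proof (cases "t = 1")
    case True
    then show ?thesis using u by simp
  next
    case False
    then have "(1 - t) * (u \<bullet> (B *v u)) > 0" using t B[OF u(1)] by simp
    moreover have "t * (u \<bullet> u) \<ge> 0" using t by simp
    ultimately show ?thesis by linarith
  qed
  ultimately show False by simp
qed

locale finite_volume_manifold =
  fixes A :: "('m::{t2_space,second_countable_topology}, 'n::finite) chart set"
    and G :: "('m, 'n) chart \<Rightarrow> 'm \<Rightarrow> real ^ 'n ^ 'n"
    and vol :: "'m measure"
  assumes manifold: "riemannian_manifold A G"
    and volume: "riemannian_volume A G vol"
    and finite_volume: "emeasure vol UNIV < \<infinity>"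
begin

abbreviation range_of :: "('m, 'n) chart \<Rightarrow> (real ^ 'n) set" where
  "range_of c \<equiv> coord c ` dom_of c"

lemma charts_cover: "\<exists>c\<in>A. x \<in> dom_of c"
  using manifold by (auto simp: riemannian_manifold_def smooth_atlas_def)

lemma
  assumes "c \<in> A"
  shows open_dom: "open (dom_of c)" and open_range: "open (range_of c)"
    and continuous_coord: "continuous_on (dom_of c) (coord c)"
    and continuous_param: "continuous_on (range_of c) (param c)"
    and param_coord: "x \<in> dom_of c \<Longrightarrow> param c (coord c x) = x"
  using assms manifold
  by (auto simp: riemannian_manifold_def smooth_atlas_def homeomorphism_def)

lemma smooth_transition:
  "c \<in> A \<Longrightarrow> c' \<in> A \<Longrightarrow> Ck_on n (coord c ` (dom_of c \<inter> dom_of c')) (\<lambda>y. coord c' (param c y))"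
  using manifold by (simp add: riemannian_manifold_def smooth_atlas_def class_C_on_def comp_def)

lemma metric_pos: "c \<in> A \<Longrightarrow> x \<in> dom_of c \<Longrightarrow> u \<noteq> 0 \<Longrightarrow> u \<bullet> (G c x *v u) > 0"
  using manifold by (simp add: riemannian_manifold_def riemannian_metric_def)

lemma sets_vol [simp]: "sets vol = sets borel"
  using volume by (simp add: riemannian_volume_def)

lemma space_vol [simp]: "space vol = UNIV"
  using sets_eq_imp_space_eq[OF sets_vol] by simp

lemma finite_measure_vol: "finite_measure vol"
  using finite_volume by (intro finite_measureI) simp

lemma open_chart_preimage:
  assumes "c \<in> A" "open W" shows "open {x \<in> dom_of c. coord c x \<in> W}"
proof -
  have "{x \<in> dom_of c. coord c x \<in> W} = dom_of c \<inter> coord c -` W" by auto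
  then show ?thesis using continuous_open_preimage[OF continuous_coord open_dom] assms by simp
qed

lemma open_param_preimage:
  assumes "c \<in> A" "open W" shows "open {y \<in> range_of c. param c y \<in> W}"
proof -
  have "{y \<in> range_of c. param c y \<in> W} = range_of c \<inter> param c -` W" by auto
  then show ?thesis using continuous_open_preimage[OF continuous_param open_range] assms by simp
qed

lemma continuous_on_if_charts:
  fixes f :: "'m \<Rightarrow> 'b::topological_space"
  assumes "\<And>c. c \<in> A \<Longrightarrow> continuous_on (range_of c) (\<lambda>y. f (param c y))"
  shows "continuous_on UNIV f"
proof (rule continuous_at_imp_continuous_on, rule ballI)
  fix x :: 'm
  obtain c where c: "c \<in> A" "x \<in> dom_of c" using charts_cover by blast
  have "continuous_on (dom_of c) (\<lambda>x. f (param c (coord c x)))"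
    by (rule continuous_on_compose2[OF assms[OF c(1)] continuous_coord[OF c(1)]]) simp
  then have "continuous_on (dom_of c) f"
    by (simp add: param_coord[OF c(1)] cong: continuous_on_cong)
  then show "isCont f x" using c open_dom by (simp add: continuous_on_eq_continuous_at)
qed

lemma vol_null_if_chart_negligible:
  assumes c: "c \<in> A" and E: "E \<in> sets borel" "E \<subseteq> dom_of c" and neg: "negligible (coord c ` E)"
  shows "emeasure vol E = 0"
proof -
  obtain N where N: "N \<in> null_sets lborel" "coord c ` E \<subseteq> N"
    using neg by (auto simp: negligible_iff_null_sets null_sets_completion_iff2)
  have "emeasure vol E = (\<integral>\<^sup>+ z \<in> coord c ` E. ennreal (sqrt (det (G c (param c z)))) \<partial>lborel)"
    using volume c E by (auto simp: riemannian_volume_def)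
  also have "\<dots> = (\<integral>\<^sup>+ z. 0 \<partial>(lborel :: (real ^ 'n) measure))"
    by (rule nn_integral_cong_AE) (use AE_not_in[OF N(1)] N(2) in \<open>auto elim!: eventually_mono split: split_indicator\<close>)
  finally show ?thesis by simp
qed

text \<open>
Normalization to a probability measure requires positive total volume: the density is positive on the
nonempty open image of a chart.
\<close>

lemma vol_pos: "emeasure vol UNIV > 0"
proof -
  obtain c where c: "c \<in> A" "undefined \<in> dom_of c" using charts_cover by blast
  let ?g = "\<lambda>z. sqrt (det (G c (param c z)))"
  have "Ck_on 0 (range_of c) (G c \<circ> param c)"
    using manifold c(1) by (auto simp: riemannian_manifold_def riemannian_metric_def class_C_on_def simp del: Ck_on.simps)
  then have "continuous_on (range_of c) (\<lambda>z. G c (param c z))" by (simp add: comp_def)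
  then have cont: "continuous_on (range_of c) ?g"
    unfolding det_def by (intro continuous_intros) auto
  have pos: "?g z > 0" if "z \<in> range_of c" for z
    using that c(1) by (auto simp: param_coord intro!: det_pos_if_positive_definite metric_pos)
  have meas: "(\<lambda>z. ennreal (?g z) * indicator (range_of c) z) \<in> borel_measurable lborel"
  proof -
    have "(\<lambda>z. indicator (range_of c) z *\<^sub>R ?g z) \<in> borel_measurable borel"
      using open_range[OF c(1)] cont by (intro borel_measurable_continuous_on_indicator) auto
    then have "(\<lambda>z. ennreal (indicator (range_of c) z *\<^sub>R ?g z)) \<in> borel_measurable borel" by measurable
    moreover have "ennreal (indicator (range_of c) z *\<^sub>R ?g z) = ennreal (?g z) * indicator (range_of c) z" for z
      by (simp split: split_indicator)
    ultimately show ?thesis by simp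
  qed
  have eq: "emeasure vol (dom_of c) = (\<integral>\<^sup>+ z \<in> range_of c. ennreal (?g z) \<partial>lborel)"
    using volume c(1) open_dom[OF c(1)] by (auto simp: riemannian_volume_def)
  have "emeasure vol (dom_of c) \<noteq> 0"
  proof
    assume "emeasure vol (dom_of c) = 0"
    then have "AE z in lborel. ennreal (?g z) * indicator (range_of c) z = 0"
      unfolding eq using meas by (subst (asm) nn_integral_0_iff_AE) auto
    then have "AE z in lborel. z \<notin> range_of c"
      by eventually_elim (use pos in \<open>force split: split_indicator_asm\<close>)
    then have "range_of c \<in> null_sets lborel"
      using open_range[OF c(1)] by (subst (asm) AE_iff_null_sets[symmetric]) auto
    then have "negligible (range_of c)"
      by (simp add: negligible_iff_null_sets null_sets_completionI)
    then show False using open_not_negligible[OF open_range[OF c(1)]] c(2) by auto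
  qed
  moreover have "emeasure vol (dom_of c) \<le> emeasure vol UNIV"
    using open_dom[OF c(1)] by (intro emeasure_mono) auto
  ultimately show ?thesis by (metis le_zero_eq not_gr_zero)
qed

lemma sets_normalized [simp]: "sets (normalized vol) = sets borel"
  by (simp add: normalized_def)

lemma space_normalized [simp]: "space (normalized vol) = UNIV"
  using sets_eq_imp_space_eq[OF sets_normalized] by simp

lemma emeasure_normalized: "emeasure (normalized vol) E = emeasure vol E / emeasure vol UNIV"
  by (simp add: normalized_def divide_ennreal_def mult.commute)

lemma prob_space_normalized: "prob_space (normalized vol)"
  by (rule prob_spaceI) (use vol_pos finite_volume in \<open>simp add: emeasure_normalized ennreal_divide_self\<close>)

lemma null_sets_normalized: "null_sets (normalized vol) = null_sets vol"
  using vol_pos finite_volume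
  by (auto simp: null_sets_def emeasure_normalized ennreal_divide_eq_0_iff)

definition partial :: "('m, 'n) chart \<Rightarrow> ('m \<Rightarrow> 'b::real_normed_vector) \<Rightarrow> real ^ 'n \<Rightarrow> 'm \<Rightarrow> 'b" where
  "partial c f b x = frechet_derivative (f \<circ> param c) (at (coord c x)) b"

definition critical :: "('m, 'n) chart \<Rightarrow> ('m \<Rightarrow> real) \<Rightarrow> 'm set" where
  "critical c f = {x \<in> dom_of c. \<forall>b\<in>Basis. partial c f b x = 0}"

definition C1 :: "('m \<Rightarrow> 'b::real_normed_vector) \<Rightarrow> bool" where
  "C1 f \<longleftrightarrow> (\<forall>c\<in>A. Ck_on (Suc 0) (range_of c) (f \<circ> param c))"

lemma continuous_partial:
  assumes "C1 f" "c \<in> A" shows "continuous_on (dom_of c) (partial c f b)"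
proof -
  have "continuous_on (range_of c) (\<lambda>y. frechet_derivative (f \<circ> param c) (at y) b)"
    using assms by (simp add: C1_def)
  from continuous_on_compose2[OF this continuous_coord[OF assms(2)]] show ?thesis
    unfolding partial_def by simp
qed

text \<open>
The gradient is the image of the vector of partial derivatives under the inverse Gram matrix, which is injective.
\<close>

lemma gradient_eq_0_iff:
  assumes "c \<in> A" "x \<in> dom_of c"
  shows "gradient G f c x = 0 \<longleftrightarrow> x \<in> critical c f"
proof -
  let ?d = "\<chi> j. frechet_derivative (f \<circ> param c) (at (coord c x)) (axis j 1) :: real ^ 'n"
  have "\<forall>u. G c x *v u = 0 \<longrightarrow> u = 0"
    using metric_pos[OF assms] by (metis inner_zero_right less_irrefl)
  then have inv: "invertible (G c x)"
    by (simp add: invertible_left_inverse matrix_left_invertible_ker)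
  have right: "G c x ** matrix_inv (G c x) = mat 1"
    using someI_ex[OF inv[unfolded invertible_def]] by (simp add: matrix_inv_def)
  have "gradient G f c x = 0 \<longleftrightarrow> ?d = 0"
  proof
    assume "gradient G f c x = 0"
    then have "G c x *v (matrix_inv (G c x) *v ?d) = 0" by (simp add: gradient_def)
    then show "?d = 0" by (simp add: matrix_vector_mul_assoc right)
  qed (simp add: gradient_def)
  also have "\<dots> \<longleftrightarrow> x \<in> critical c f"
  proof -
    have "(\<forall>b\<in>Basis. partial c f b x = 0) \<longleftrightarrow> (\<forall>j. partial c f (axis j 1) x = 0)"
      unfolding Basis_vec_def Basis_real_def by blast
    then show ?thesis
      using assms by (simp add: critical_def partial_def vec_eq_iff)
  qed
  finally show ?thesis .
qed

lemma gradient_vanishes_iff: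
  "gradient_vanishes A G f x \<longleftrightarrow> (\<forall>c\<in>A. x \<in> dom_of c \<longrightarrow> x \<in> critical c f)"
  unfolding gradient_vanishes_def using gradient_eq_0_iff by blast

lemma open_noncritical:
  assumes "C1 f" "c \<in> A" shows "open (dom_of c - critical c f)"
proof -
  have "open (dom_of c \<inter> partial c f b -` (- {0}))" for b
    by (rule continuous_open_preimage[OF continuous_partial[OF assms] open_dom[OF assms(2)]]) auto
  then have "open (\<Union>b\<in>Basis. dom_of c \<inter> partial c f b -` (- {0}))" by blast
  moreover have "(\<Union>b\<in>Basis. dom_of c \<inter> partial c f b -` (- {0})) = dom_of c - critical c f"
    by (auto simp: critical_def)
  ultimately show ?thesis by simp
qed

lemma noncritical_eq_Union:
  "{x. \<not> gradient_vanishes A G f x} = (\<Union>c\<in>A. dom_of c - critical c f)"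
  by (auto simp: gradient_vanishes_iff)

lemma closed_gradient_vanishes:
  assumes "C1 f" shows "closed {x. gradient_vanishes A G f x}"
proof -
  have "open {x. \<not> gradient_vanishes A G f x}"
    unfolding noncritical_eq_Union using open_noncritical[OF assms] by blast
  then show ?thesis by (simp add: closed_def Collect_neg_eq)
qed

lemma C1_differentiable:
  assumes "C1 f" "c \<in> A" "y \<in> range_of c"
  shows "(f \<circ> param c has_derivative frechet_derivative (f \<circ> param c) (at y)) (at y)"
  using assms by (auto simp: C1_def frechet_derivative_works[symmetric])

lemma C1_continuous: "C1 f \<Longrightarrow> continuous_on UNIV f"
  by (rule continuous_on_if_charts) (auto simp: C1_def comp_def simp del: Ck_on.simps dest!: Ck_on_imp_continuous_on)

text \<open>
The atlas may be uncountable; by the Lindeloef property countably many of the open sets of noncritical points of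
single charts cover all noncritical points.
\<close>

lemma noncritical_level_null:
  assumes f: "C1 f" and Z: "Z \<in> null_sets lborel"
  shows "f -` Z \<inter> {x. \<not> gradient_vanishes A G f x} \<in> null_sets vol"
proof -
  let ?W = "\<lambda>c. dom_of c - critical c f"
  have fZ: "f -` Z \<in> sets borel"
    using measurable_sets[OF borel_measurable_continuous_onI[OF C1_continuous[OF f]], of Z] Z by auto
  obtain \<W> where \<W>: "\<W> \<subseteq> ?W ` A" "countable \<W>" "\<Union>\<W> = \<Union>(?W ` A)"
    using Lindelof[of "?W ` A"] open_noncritical[OF f] by blast
  have "f -` Z \<inter> W \<in> null_sets vol" if "W \<in> \<W>" for W
  proof -
    obtain c where c: "c \<in> A" "W = ?W c" using \<W>(1) \<open>W \<in> \<W>\<close> by blast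
    have E: "f -` Z \<inter> W \<in> sets borel"
      using fZ open_noncritical[OF f c(1)] c(2) by auto
    have "negligible {y \<in> {y \<in> range_of c. \<exists>b\<in>Basis. frechet_derivative (f \<circ> param c) (at y) b \<noteq> 0}. (f \<circ> param c) y \<in> Z}"
      by (rule negligible_noncritical_level[OF C1_differentiable[OF f c(1)] _ Z]) auto
    then have "negligible (coord c ` (f -` Z \<inter> W))"
      by (rule negligible_subset) (auto simp: c(2) critical_def partial_def param_coord[OF c(1)])
    then have "emeasure vol (f -` Z \<inter> W) = 0"
      using E c by (intro vol_null_if_chart_negligible[of c]) auto
    then show ?thesis using E by (auto simp: null_sets_def)
  qed
  then have "(\<Union>W\<in>\<W>. f -` Z \<inter> W) \<in> null_sets vol"
    using \<W>(2) by (intro null_sets_UN') auto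
  moreover have "(\<Union>W\<in>\<W>. f -` Z \<inter> W) = f -` Z \<inter> {x. \<not> gradient_vanishes A G f x}"
    using \<W>(3) unfolding noncritical_eq_Union by auto
  ultimately show ?thesis by simp
qed

lemma C1_inner:
  fixes v :: "'m \<Rightarrow> real ^ 'd::finite"
  assumes "C1 v"
  shows "C1 (\<lambda>y. \<xi> \<bullet> v y)"
    and "c \<in> A \<Longrightarrow> x \<in> dom_of c \<Longrightarrow> partial c (\<lambda>y. \<xi> \<bullet> v y) b x = \<xi> \<bullet> partial c v b x"
proof -
  have eq: "(\<lambda>y. \<xi> \<bullet> v y) \<circ> param c = (\<lambda>y. \<xi> \<bullet> (v \<circ> param c) y)" for c by auto
  show "C1 (\<lambda>y. \<xi> \<bullet> v y)"
    unfolding C1_def eq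
  proof
    fix c assume c: "c \<in> A"
    then have "Ck_on (Suc 0) (range_of c) (v \<circ> param c)" using assms by (simp only: C1_def)
    then show "Ck_on (Suc 0) (range_of c) (\<lambda>y. \<xi> \<bullet> (v \<circ> param c) y)"
      by (rule Ck_on_bounded_linear[OF bounded_linear_inner_right open_range[OF c]])
  qed
  assume c: "c \<in> A" "x \<in> dom_of c"
  then have "((\<lambda>y. \<xi> \<bullet> (v \<circ> param c) y) has_derivative (\<lambda>h. \<xi> \<bullet> frechet_derivative (v \<circ> param c) (at (coord c x)) h)) (at (coord c x))"
    by (intro bounded_linear.has_derivative[OF bounded_linear_inner_right] C1_differentiable[OF assms] imageI)
  then show "partial c (\<lambda>y. \<xi> \<bullet> v y) b x = \<xi> \<bullet> partial c v b x"
    unfolding partial_def eq by (simp add: frechet_derivative_at[symmetric])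
qed

lemma Ck_maps_imp_C1: "v \<in> Ck_maps A k \<Longrightarrow> k \<ge> 1 \<Longrightarrow> C1 v"
  by (auto simp: Ck_maps_def C1_def class_C_on_def one_enat_def simp del: Ck_on.simps)

lemma shear_criterion_imp_keplerian_shear:
  fixes v :: "'m \<Rightarrow> real ^ 'd::finite"
  assumes v: "v \<in> Ck_maps A k" "k \<ge> 1" and crit: "shear_criterion A G vol v"
  shows "keplerian_shear (normalized vol \<Otimes>\<^sub>M torus_measure) (shear_flow v)"
proof (rule keplerian_shear_shear_flow[OF prob_space_normalized])
  have C1: "C1 v" using v by (rule Ck_maps_imp_C1)
  show "v \<in> borel_measurable (normalized vol)"
    using borel_measurable_continuous_onI[OF C1_continuous[OF C1]]
    by (simp add: measurable_cong_sets[OF sets_normalized refl])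
  fix \<xi> :: "real ^ 'd" and Z :: "real set" assume \<xi>: "\<xi> \<in> integer_vectors" "\<xi> \<noteq> 0" and Z: "Z \<in> null_sets lborel"
  let ?f = "\<lambda>y. \<xi> \<bullet> v y"
  have "?f -` Z \<inter> {x. \<not> gradient_vanishes A G ?f x} \<in> null_sets vol"
    by (rule noncritical_level_null[OF C1_inner(1)[OF C1] Z])
  moreover have "{x. gradient_vanishes A G ?f x} \<in> null_sets vol"
    using crit \<xi> by (auto simp: shear_criterion_def null_sets_normalized)
  ultimately have "?f -` Z \<inter> {x. \<not> gradient_vanishes A G ?f x} \<union> {x. gradient_vanishes A G ?f x} \<in> null_sets vol"
    by (rule null_sets.Un)
  moreover have "?f -` Z \<in> sets vol"
    using measurable_sets[OF borel_measurable_continuous_onI[OF C1_continuous[OF C1_inner(1)[OF C1]]], of Z] Z by auto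
  ultimately have "?f -` Z \<in> null_sets vol"
    by (rule null_sets_subset) auto
  then show "?f -` Z \<inter> space (normalized vol) \<in> null_sets (normalized vol)"
    by (simp add: null_sets_normalized)
qed

end

section \<open>Genericity of the shear criterion\<close>

lemma eventually_in_open_if_subbasic:
  assumes l: "l \<in> topspace (topology_generated_by \<S>)"
    and sub: "\<And>W. W \<in> \<S> \<Longrightarrow> l \<in> W \<Longrightarrow> \<forall>\<^sub>F i in F. f i \<in> W"
    and T: "openin (topology_generated_by \<S>) T" "l \<in> T"
  shows "\<forall>\<^sub>F i in F. f i \<in> T"
proof -
  have "generate_topology_on \<S> T" using T(1) by (simp add: openin_topology_generated_by_iff)
  then show ?thesis using T(2)
  proof induction
    case (Int a b)
    then show ?case by (auto intro: eventually_conj)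
  next
    case (UN K)
    then obtain k where "k \<in> K" "l \<in> k" by blast
    then have "\<forall>\<^sub>F i in F. f i \<in> k" using UN.IH by blast
    then show ?case by eventually_elim (use \<open>k \<in> K\<close> in blast)
  qed (use sub in auto)
qed

context finite_volume_manifold
begin

definition chart_ball :: "('m, 'n) chart \<Rightarrow> real ^ 'n \<Rightarrow> real \<Rightarrow> 'm set" where
  "chart_ball c z r = {x \<in> dom_of c. coord c x \<in> cball z r}"

lemma compact_chart_ball:
  assumes "c \<in> A" "cball z r \<subseteq> range_of c" shows "compact (chart_ball c z r)"
proof -
  have "compact (param c ` cball z r)"
    using continuous_on_subset[OF continuous_param[OF assms(1)] assms(2)] by (rule compact_continuous_image) simp
  moreover have "param c ` cball z r = chart_ball c z r"
  proof
    show "param c ` cball z r \<subseteq> chart_ball c z r"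
    proof
      fix x assume "x \<in> param c ` cball z r"
      then obtain y where y: "y \<in> cball z r" "x = param c y" by blast
      then obtain x' where "x' \<in> dom_of c" "y = coord c x'" using assms(2) by blast
      with y show "x \<in> chart_ball c z r" by (simp add: chart_ball_def param_coord[OF assms(1)])
    qed
    show "chart_ball c z r \<subseteq> param c ` cball z r"
    proof
      fix x assume "x \<in> chart_ball c z r"
      then have "x = param c (coord c x)" "coord c x \<in> cball z r"
        by (simp_all add: chart_ball_def param_coord[OF assms(1)])
      then show "x \<in> param c ` cball z r" by (rule image_eqI)
    qed
  qed
  ultimately show ?thesis by simp
qed

text \<open>
The chart contains twice the ball, so that a bump of radius \<open>2 * r\<close> fits into the chart while the ball of
radius \<open>r\<close> stays in the region where the bump is noncritical.
\<close>

definition good_ball :: "('m, 'n) chart \<Rightarrow> real ^ 'n \<Rightarrow> real \<Rightarrow> bool" where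
  "good_ball c z r \<longleftrightarrow> c \<in> A \<and> r > 0 \<and> cball z (2 * r) \<subseteq> range_of c"

lemma good_ballD:
  assumes "good_ball c z r"
  shows "c \<in> A" "r > 0" "compact (chart_ball c z r)" "compact (chart_ball c z (2 * r))" "cball z r \<subseteq> range_of c"
proof -
  show c: "c \<in> A" "r > 0" using assms by (auto simp: good_ball_def)
  have "cball z r \<subseteq> cball z (2 * r)" using c by (intro subset_cball) simp
  then show "cball z r \<subseteq> range_of c" using assms by (auto simp: good_ball_def)
  then show "compact (chart_ball c z r)" "compact (chart_ball c z (2 * r))"
    using assms c by (auto intro!: compact_chart_ball simp: good_ball_def)
qed

lemma countable_good_cover:
  obtains \<T> where "countable \<T>" "\<forall>(c, z, r)\<in>\<T>. good_ball c z r"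
    "(\<Union>(c, z, r)\<in>\<T>. chart_ball c z r) = UNIV"
proof -
  let ?B = "\<lambda>(c, z, r). {x \<in> dom_of c. coord c x \<in> ball z r}"
  let ?I = "{(c, z, r). good_ball c z r}"
  define \<B> where "\<B> = ?B ` ?I"
  have "open W" if "W \<in> \<B>" for W
    using that by (auto intro!: open_chart_preimage simp: \<B>_def good_ball_def simp del: mem_ball)
  then obtain \<W> where \<W>: "\<W> \<subseteq> \<B>" "countable \<W>" "\<Union>\<W> = \<Union>\<B>"
    using Lindelof[of \<B>] by blast
  have "countable \<W> \<and> \<W> \<subseteq> ?B ` ?I" using \<W>(1,2) by (simp only: \<B>_def simp_thms)
  then obtain \<T> where \<T>: "countable \<T>" "\<T> \<subseteq> ?I" "\<W> = ?B ` \<T>"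
    unfolding countable_subset_image by (elim exE conjE) (rule that)
  show ?thesis
  proof (rule that[OF \<T>(1)])
    show "\<forall>(c, z, r)\<in>\<T>. good_ball c z r" using \<T>(2) by auto
    have "x \<in> (\<Union>(c, z, r)\<in>\<T>. chart_ball c z r)" for x
    proof -
      obtain c where c: "c \<in> A" "x \<in> dom_of c" using charts_cover by blast
      then obtain e where e: "e > 0" "cball (coord c x) e \<subseteq> range_of c"
        using open_range[OF c(1)] by (meson image_eqI open_contains_cball)
      then have "(c, coord c x, e / 2) \<in> ?I" "x \<in> ?B (c, coord c x, e / 2)"
        using c by (auto simp: good_ball_def)
      then have "x \<in> \<Union>\<W>" unfolding \<W>(3) \<B>_def by blast
      then obtain i where "i \<in> \<T>" "x \<in> ?B i" unfolding \<T>(3) by blast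
      then show ?thesis by (intro UN_I[of i]) (auto simp: chart_ball_def split: prod.splits)
    qed
    then show "(\<Union>(c, z, r)\<in>\<T>. chart_ball c z r) = UNIV" by blast
  qed
qed

definition bump_on :: "('m, 'n) chart \<Rightarrow> real ^ 'n \<Rightarrow> real \<Rightarrow> 'm \<Rightarrow> real" where
  "bump_on c z r x = (if x \<in> dom_of c then bump z r (coord c x) else 0)"

text \<open>
The bump extended by \<open>0\<close> is smooth in every other chart: it is a composition with a transition map on the
overlap of the charts, and it vanishes on the complement of its compact, hence closed, support.
\<close>

lemma Ck_on_bump_on:
  assumes good: "good_ball c z r" and c': "c' \<in> A"
  shows "Ck_on n (range_of c') (\<lambda>y. bump_on c z (2 * r) (param c' y))"
proof (rule Ck_on_locally)
  note c = good_ballD[OF good]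
  fix y assume y: "y \<in> range_of c'"
  show "\<exists>T. open T \<and> y \<in> T \<and> Ck_on n T (\<lambda>y. bump_on c z (2 * r) (param c' y))"
  proof (cases "param c' y \<in> dom_of c")
    case True
    let ?T = "{y \<in> range_of c'. param c' y \<in> dom_of c}"
    have T: "open ?T" by (rule open_param_preimage[OF c' open_dom[OF c(1)]])
    have "?T = coord c' ` (dom_of c' \<inter> dom_of c)" using param_coord[OF c'] by auto
    then have trans: "Ck_on n ?T (\<lambda>y. coord c (param c' y))"
      using smooth_transition[OF c' c(1)] by simp
    have "Ck_on n ?T (\<lambda>y. bump z (2 * r) (coord c (param c' y)))"
      by (rule Ck_on_compose[OF T open_UNIV _ trans Ck_on_bump]) simp
    then have "Ck_on n ?T (\<lambda>y. bump_on c z (2 * r) (param c' y))"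
      by (rule Ck_on_cong[OF T, rotated]) (simp add: bump_on_def)
    then show ?thesis using T y True by blast
  next
    case False
    let ?T = "{y \<in> range_of c'. param c' y \<in> - chart_ball c z (2 * r)}"
    have T: "open ?T"
      by (intro open_param_preimage[OF c'] open_Compl compact_imp_closed c)
    have "Ck_on n ?T (\<lambda>y. 0 :: real)" by (rule Ck_on_const)
    then have "Ck_on n ?T (\<lambda>y. bump_on c z (2 * r) (param c' y))"
      by (rule Ck_on_cong[OF T, rotated]) (use c(2) in \<open>auto simp: bump_on_def chart_ball_def bump_eq_0\<close>)
    moreover have "y \<in> ?T" using y False by (simp add: chart_ball_def)
    ultimately show ?thesis using T by blast
  qed
qed

lemma topspace_Ck_topology: "topspace (Ck_topology A k :: ('m \<Rightarrow> real ^ 'd::finite) topology) = Ck_maps A k"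
proof -
  obtain c where c: "c \<in> A" using charts_cover by blast
  have "v \<in> topspace (Ck_topology A k)" if v: "v \<in> Ck_maps A k" for v :: "'m \<Rightarrow> real ^ 'd"
    unfolding Ck_topology_def topology_generated_by_topspace
  proof (rule UnionI)
    show "{w \<in> Ck_maps A k. \<forall>x\<in>{}. norm (iterated_derivative [] (w \<circ> param c) (coord c x)
        - iterated_derivative [] (v \<circ> param c) (coord c x)) < 1} \<in>
      {{w \<in> Ck_maps A k. \<forall>x\<in>K. norm (iterated_derivative hs (w \<circ> param c) (coord c x)
               - iterated_derivative hs (v \<circ> param c) (coord c x)) < e} | v c K hs e.
        v \<in> Ck_maps A k \<and> c \<in> A \<and> compact K \<and> K \<subseteq> dom_of c \<and> hs \<in> lists Basis \<and> enat (length hs) \<le> k \<and> e > 0}"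
      by (rule CollectI, intro exI[of _ v] exI[of _ c] exI[of _ "{}"] exI[of _ "[]"] exI[of _ 1] conjI refl)
        (use v c in \<open>simp_all add: zero_enat_def[symmetric]\<close>)
  qed (use v in simp)
  moreover have "topspace (Ck_topology A k :: ('m \<Rightarrow> real ^ 'd) topology) \<subseteq> Ck_maps A k"
    unfolding Ck_topology_def topology_generated_by_topspace by auto
  ultimately show ?thesis by blast
qed

text \<open>
The open dense sets of the Baire argument.
\<close>

definition few_critical :: "enat \<Rightarrow> real ^ 'd \<Rightarrow> ('m, 'n) chart \<Rightarrow> real ^ 'n \<Rightarrow> real \<Rightarrow> nat \<Rightarrow> ('m \<Rightarrow> real ^ 'd::finite) set" where
  "few_critical k \<xi> c z r m =
     {v \<in> Ck_maps A k. measure vol (chart_ball c z r \<inter> critical c (\<lambda>y. \<xi> \<bullet> v y)) < 1 / Suc m}"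

lemma closed_almost_critical:
  fixes f :: "'m \<Rightarrow> real"
  assumes f: "C1 f" and good: "good_ball c z r"
  shows "closed {x \<in> chart_ball c z r. \<forall>b\<in>Basis. \<bar>partial c f b x\<bar> \<le> e}"
proof -
  note c = good_ballD[OF good]
  have "closed (chart_ball c z r \<inter> partial c f b -` {- e..e})" for b
  proof (rule continuous_closed_preimage)
    show "continuous_on (chart_ball c z r) (partial c f b)"
      by (rule continuous_on_subset[OF continuous_partial[OF f c(1)]]) (auto simp: chart_ball_def)
    show "closed (chart_ball c z r)" using c(3) by (rule compact_imp_closed)
    show "closed {- e..e}" by (rule closed_real_atLeastAtMost)
  qed
  then have "closed (\<Inter>b\<in>Basis. chart_ball c z r \<inter> partial c f b -` {- e..e})" by blast
  moreover have "(\<Inter>b\<in>Basis. chart_ball c z r \<inter> partial c f b -` {- e..e}) =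
      {x \<in> chart_ball c z r. \<forall>b\<in>Basis. \<bar>partial c f b x\<bar> \<le> e}"
    using nonempty_Basis by (auto simp: abs_le_iff) 
  ultimately show ?thesis by simp
qed

lemma critical_eq_almost_critical:
  "chart_ball c z r \<inter> critical c f = {x \<in> chart_ball c z r. \<forall>b\<in>Basis. \<bar>partial c f b x\<bar> \<le> 0}"
  by (auto simp: critical_def chart_ball_def)

text \<open>
The sets \<open>D p\<close> of points of the ball with partial derivatives at most \<open>1/(p + 1)\<close> decrease to the critical set, so
one of them still has volume less than \<open>1/(m + 1)\<close>. It contains the critical points of \<open>\<langle>\<xi>, w\<rangle>\<close> for
every \<open>w\<close> whose first derivatives are close to those of \<open>v\<close> on the ball.
\<close>

lemma openin_few_critical:
  fixes \<xi> :: "real ^ 'd::finite"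
  assumes k: "k \<ge> 1" and good: "good_ball c z r"
  shows "openin (Ck_topology A k) (few_critical k \<xi> c z r m)"
proof (subst openin_subopen, intro ballI)
  interpret vol: finite_measure vol by (rule finite_measure_vol)
  note c = good_ballD[OF good]
  let ?K = "chart_ball c z r"
  fix v assume v: "v \<in> few_critical k \<xi> c z r m"
  then have vC: "v \<in> Ck_maps A k" by (simp add: few_critical_def)
  then have v1: "C1 v" using k by (rule Ck_maps_imp_C1)
  let ?f = "\<lambda>y. \<xi> \<bullet> v y"
  define D where "D p = {x \<in> ?K. \<forall>b\<in>Basis. \<bar>partial c ?f b x\<bar> \<le> 1 / real (Suc p)}" for p
  have Dm: "D p \<in> sets vol" for p
    unfolding D_def sets_vol by (intro borel_closed closed_almost_critical C1_inner v1 good)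
  have "(\<lambda>p. measure vol (D p)) \<longlonglongrightarrow> measure vol (\<Inter>p. D p)"
  proof (rule vol.finite_Lim_measure_decseq)
    show "decseq D"
    proof (rule decseq_SucI)
      fix p
      have "1 / real (Suc (Suc p)) \<le> 1 / real (Suc p)" by (simp add: field_simps)
      then show "D (Suc p) \<subseteq> D p" unfolding D_def by (force intro: order_trans)
    qed
  qed (use Dm in auto)
  moreover have "(\<Inter>p. D p) = ?K \<inter> critical c ?f"
  proof (intro equalityI subsetI)
    fix x assume x: "x \<in> (\<Inter>p. D p)"
    have "partial c ?f b x = 0" if b: "b \<in> Basis" for b
    proof (rule ccontr)
      assume "partial c ?f b x \<noteq> 0"
      then obtain p where "1 / real (Suc p) < \<bar>partial c ?f b x\<bar>"
        using nat_approx_posE[of "\<bar>partial c ?f b x\<bar>"] by auto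
      moreover have "\<bar>partial c ?f b x\<bar> \<le> 1 / real (Suc p)" using x b by (auto simp: D_def)
      ultimately show False by simp
    qed
    then show "x \<in> ?K \<inter> critical c ?f" using x by (auto simp: D_def critical_def chart_ball_def)
  qed (auto simp: D_def critical_def)
  ultimately have "(\<lambda>p. measure vol (D p)) \<longlonglongrightarrow> measure vol (?K \<inter> critical c ?f)" by simp
  moreover have "measure vol (?K \<inter> critical c ?f) < 1 / Suc m" using v by (simp add: few_critical_def)
  ultimately have "\<forall>\<^sub>F p in sequentially. measure vol (D p) < 1 / Suc m" by (rule order_tendstoD)
  then obtain p where p: "measure vol (D p) < 1 / Suc m" by (auto dest: eventually_happens)
  \<comment> \<open>derivatives of \<open>v\<close> and \<open>w\<close> within \<open>e\<close> give derivatives of \<open>\<langle>\<xi>, v\<rangle>\<close> and \<open>\<langle>\<xi>, w\<rangle>\<close> within \<open>1/(p + 1)\<close>\<close>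
  define e where "e = 1 / (real (Suc p) * (norm \<xi> + 1))"
  have e: "e > 0" unfolding e_def by (intro divide_pos_pos mult_pos_pos add_nonneg_pos) auto
  let ?N = "\<lambda>b. {w \<in> Ck_maps A k. \<forall>x\<in>?K. norm (iterated_derivative [b] (w \<circ> param c) (coord c x)
      - iterated_derivative [b] (v \<circ> param c) (coord c x)) < e}"
  have N: "openin (Ck_topology A k) (?N b)" if "b \<in> Basis" for b
    unfolding Ck_topology_def
  proof (rule topology_generated_by_Basis, rule CollectI)
    have "?K \<subseteq> dom_of c" by (auto simp: chart_ball_def)
    then show "\<exists>v' c' K hs e'. ?N b = {w \<in> Ck_maps A k. \<forall>x\<in>K. norm (iterated_derivative hs (w \<circ> param c') (coord c' x)
        - iterated_derivative hs (v' \<circ> param c') (coord c' x)) < e'} \<and>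
        v' \<in> Ck_maps A k \<and> c' \<in> A \<and> compact K \<and> K \<subseteq> dom_of c' \<and> hs \<in> lists Basis \<and> enat (length hs) \<le> k \<and> 0 < e'"
      using vC c e that k
      by (intro exI[of _ v] exI[of _ c] exI[of _ ?K] exI[of _ "[b]"] exI[of _ e]) (auto simp: one_enat_def)
  qed
  show "\<exists>T. openin (Ck_topology A k) T \<and> v \<in> T \<and> T \<subseteq> few_critical k \<xi> c z r m"
  proof (intro exI conjI)
    show "openin (Ck_topology A k) (\<Inter>b\<in>Basis. ?N b)"
      using N nonempty_Basis by (intro openin_Inter) auto
    show "v \<in> (\<Inter>b\<in>Basis. ?N b)" using vC e by simp
    show "(\<Inter>b\<in>Basis. ?N b) \<subseteq> few_critical k \<xi> c z r m"
    proof
      fix w assume w: "w \<in> (\<Inter>b\<in>Basis. ?N b)"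
      obtain b\<^sub>0 :: "real ^ 'n" where "b\<^sub>0 \<in> Basis" using nonempty_Basis by blast
      with w have wC: "w \<in> Ck_maps A k" by blast
      then have w1: "C1 w" using k by (rule Ck_maps_imp_C1)
      have "?K \<inter> critical c (\<lambda>y. \<xi> \<bullet> w y) \<subseteq> D p"
      proof
        fix x assume x: "x \<in> ?K \<inter> critical c (\<lambda>y. \<xi> \<bullet> w y)"
        then have xd: "x \<in> dom_of c" by (simp add: critical_def)
        have "\<bar>partial c ?f b x\<bar> \<le> 1 / real (Suc p)" if b: "b \<in> Basis" for b
        proof -
          have "norm (partial c w b x - partial c v b x) < e"
            using w b x by (auto simp: partial_def)
          then have "norm \<xi> * norm (partial c v b x - partial c w b x) \<le> (norm \<xi> + 1) * e"
            using e by (intro mult_mono) (auto simp: norm_minus_commute)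
          moreover have "\<xi> \<bullet> partial c w b x = 0"
            using x b C1_inner(2)[OF w1 c(1) xd] by (simp add: critical_def)
          then have "partial c ?f b x = \<xi> \<bullet> (partial c v b x - partial c w b x)"
            using C1_inner(2)[OF v1 c(1) xd] by (simp add: inner_diff_right)
          moreover have "(norm \<xi> + 1) * e = 1 / real (Suc p)"
            unfolding e_def using norm_ge_zero[of \<xi>] by (simp add: field_simps add_nonneg_eq_0_iff)
          ultimately show ?thesis
            using Cauchy_Schwarz_ineq2[of \<xi> "partial c v b x - partial c w b x"] by linarith
        qed
        then show "x \<in> D p" using x by (simp add: D_def)
      qed
      then have "measure vol (?K \<inter> critical c (\<lambda>y. \<xi> \<bullet> w y)) \<le> measure vol (D p)"
        using Dm by (rule vol.finite_measure_mono)
      then show "w \<in> few_critical k \<xi> c z r m" using p wC by (simp add: few_critical_def)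
    qed
  qed
qed

lemma perturbation_in_Ck_maps:
  fixes v :: "'m \<Rightarrow> real ^ 'd::finite"
  assumes v: "v \<in> Ck_maps A k" and good: "good_ball c z r"
  shows "(\<lambda>x. v x + s *\<^sub>R (bump_on c z (2 * r) x *\<^sub>R \<xi>)) \<in> Ck_maps A k"
proof -
  have "Ck_on n (range_of c') ((\<lambda>x. v x + s *\<^sub>R (bump_on c z (2 * r) x *\<^sub>R \<xi>)) \<circ> param c')"
    if c': "c' \<in> A" and n: "enat n \<le> k" for c' n
  proof -
    have "Ck_on n (range_of c') (v \<circ> param c')" using v c' n by (simp add: Ck_maps_def class_C_on_def)
    moreover have "Ck_on n (range_of c') (\<lambda>y. s *\<^sub>R (bump_on c z (2 * r) (param c' y) *\<^sub>R \<xi>))"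
      by (intro Ck_on_bounded_linear[OF bounded_linear_scaleR_right open_range[OF c']]
          Ck_on_bounded_linear[OF bounded_linear_scaleR_left open_range[OF c']] Ck_on_bump_on[OF good c'])
    ultimately show ?thesis
      using Ck_on_add[OF open_range[OF c'], of n "v \<circ> param c'"] by (simp add: comp_def)
  qed
  then show ?thesis by (simp add: Ck_maps_def class_C_on_def)
qed

text \<open>
A neighbourhood controls one derivative on one compact set. There the derivative of the perturbation is bounded, and
the distance of \<open>v\<close> to the centre of the neighbourhood attains its maximum, which leaves room.
\<close>

lemma perturbation_tendsto:
  fixes v :: "'m \<Rightarrow> real ^ 'd::finite"
  assumes v: "v \<in> Ck_maps A k" and good: "good_ball c z r"
    and T: "openin (Ck_topology A k) T" "v \<in> T" and s: "s \<longlonglongrightarrow> 0"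
  shows "\<forall>\<^sub>F p in sequentially. (\<lambda>x. v x + s p *\<^sub>R (bump_on c z (2 * r) x *\<^sub>R \<xi>)) \<in> T"
proof (rule eventually_in_open_if_subbasic[OF _ _ T[unfolded Ck_topology_def]])
  let ?w = "\<lambda>p x. v x + s p *\<^sub>R (bump_on c z (2 * r) x *\<^sub>R \<xi>)"
  let ?S = "{{w \<in> (Ck_maps A k :: ('m \<Rightarrow> real ^ 'd) set). \<forall>x\<in>K. norm (iterated_derivative hs (w \<circ> param c) (coord c x)
               - iterated_derivative hs (v \<circ> param c) (coord c x)) < e} | v c K hs e.
        v \<in> Ck_maps A k \<and> c \<in> A \<and> compact K \<and> K \<subseteq> dom_of c \<and> hs \<in> lists Basis \<and> enat (length hs) \<le> k \<and> e > 0}"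
  show "v \<in> topspace (topology_generated_by ?S)"
  proof -
    have "v \<in> topspace (Ck_topology A k)" using v by (simp add: topspace_Ck_topology)
    then show ?thesis unfolding Ck_topology_def .
  qed
  fix W assume "W \<in> ?S"
    and vW: "v \<in> W"
  then obtain v0 c' K hs e where W: "W = {w \<in> Ck_maps A k. \<forall>x\<in>K. norm (iterated_derivative hs (w \<circ> param c') (coord c' x)
               - iterated_derivative hs (v0 \<circ> param c') (coord c' x)) < e}"
    and v0: "v0 \<in> Ck_maps A k" and c': "c' \<in> A" and K: "compact K" "K \<subseteq> dom_of c'" and hs: "enat (length hs) \<le> k" and e: "e > 0"
    by blast
  let ?D = "iterated_derivative hs"
  let ?g = "\<lambda>y. bump_on c z (2 * r) (param c' y) *\<^sub>R \<xi>"
  have gC: "Ck_on (length hs) (range_of c') ?g"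
    by (intro Ck_on_bounded_linear[OF bounded_linear_scaleR_left open_range[OF c']] Ck_on_bump_on[OF good c'])
  have C: "Ck_on (length hs) (range_of c') (u \<circ> param c')" if "u \<in> Ck_maps A k" for u :: "'m \<Rightarrow> real ^ 'd"
    using that c' hs by (simp add: Ck_maps_def class_C_on_def)
  have contD: "continuous_on K (\<lambda>x. ?D f (coord c' x))" if "Ck_on (length hs) (range_of c') f" for f :: "real ^ 'n \<Rightarrow> real ^ 'd"
  proof -
    have "continuous_on (range_of c') (?D f)"
      using Ck_on_iterated_derivative[of hs 0] that by simp
    moreover have "continuous_on K (coord c')" by (rule continuous_on_subset[OF continuous_coord[OF c'] K(2)])
    ultimately show ?thesis by (rule continuous_on_compose2) (use K(2) in auto)
  qed
  have Dw: "?D (?w p \<circ> param c') (coord c' x) = ?D (v \<circ> param c') (coord c' x) + s p *\<^sub>R ?D ?g (coord c' x)" if "x \<in> K" for p x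
    using iterated_derivative_add_scaled[OF open_range[OF c'] C[OF v] gC order_refl, of "coord c' x" "s p"] that K(2)
    by (auto simp: comp_def)
  show "\<forall>\<^sub>F p in sequentially. ?w p \<in> W"
  proof (cases "K = {}")
    case True
    then show ?thesis using perturbation_in_Ck_maps[OF v good] by (simp add: W)
  next
    case False
    have "\<exists>x\<in>K. \<forall>y\<in>K. norm (?D (v \<circ> param c') (coord c' y) - ?D (v0 \<circ> param c') (coord c' y))
        \<le> norm (?D (v \<circ> param c') (coord c' x) - ?D (v0 \<circ> param c') (coord c' x))"
      by (rule continuous_attains_sup[OF K(1) False]) (intro continuous_intros contD C v v0)
    then obtain e' where e': "e' < e" "\<And>y. y \<in> K \<Longrightarrow> norm (?D (v \<circ> param c') (coord c' y) - ?D (v0 \<circ> param c') (coord c' y)) \<le> e'"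
      using vW unfolding W by blast
    have "\<exists>x\<in>K. \<forall>y\<in>K. norm (?D ?g (coord c' y)) \<le> norm (?D ?g (coord c' x))"
      by (rule continuous_attains_sup[OF K(1) False]) (intro continuous_intros contD gC)
    then obtain b where b: "\<And>y. y \<in> K \<Longrightarrow> norm (?D ?g (coord c' y)) \<le> b" by blast
    have "(\<lambda>p. \<bar>s p\<bar> * b) \<longlonglongrightarrow> 0"
      using s by (intro tendsto_mult_left_zero tendsto_rabs_zero)
    then have "\<forall>\<^sub>F p in sequentially. \<bar>s p\<bar> * b < e - e'"
      using e'(1) by (intro order_tendstoD) auto
    then show ?thesis
    proof eventually_elim
      case (elim p)
      have "norm (?D (?w p \<circ> param c') (coord c' x) - ?D (v0 \<circ> param c') (coord c' x)) < e" if x: "x \<in> K" for x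
      proof -
        have "norm (?D (?w p \<circ> param c') (coord c' x) - ?D (v0 \<circ> param c') (coord c' x)) =
            norm ((?D (v \<circ> param c') (coord c' x) - ?D (v0 \<circ> param c') (coord c' x)) + s p *\<^sub>R ?D ?g (coord c' x))"
          unfolding Dw[OF x] by (simp add: algebra_simps)
        also have "\<dots> \<le> e' + \<bar>s p\<bar> * b"
          using e'(2)[OF x] b[OF x] by (intro norm_triangle_mono) (auto intro: mult_left_mono)
        also have "\<dots> < e" using elim by simp
        finally show ?thesis .
      qed
      then show ?case using perturbation_in_Ck_maps[OF v good] by (simp add: W)
    qed
  qed
qed

text \<open>
A common critical point for \<open>s p \<noteq> s q\<close> would be a critical point of the bump, hence the centre of the ball. Apart
from this null point the critical sets are disjoint, and a disjoint sequence in a finite measure space has measures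
tending to \<open>0\<close>.
\<close>

lemma critical_perturbation_tendsto:
  fixes v :: "'m \<Rightarrow> real ^ 'd::finite"
  assumes v: "v \<in> Ck_maps A k" and k: "k \<ge> 1" and good: "good_ball c z r" and \<xi>: "\<xi> \<noteq> 0"
    and s: "inj s"
  shows "(\<lambda>p :: nat. measure vol (chart_ball c z r \<inter>
      critical c (\<lambda>y. \<xi> \<bullet> (v y + s p *\<^sub>R (bump_on c z (2 * r) y *\<^sub>R \<xi>))))) \<longlonglongrightarrow> 0"
proof -
  interpret vol: finite_measure vol by (rule finite_measure_vol)
  note c = good_ballD[OF good]
  let ?K = "chart_ball c z r"
  let ?w = "\<lambda>p y. v y + s p *\<^sub>R (bump_on c z (2 * r) y *\<^sub>R \<xi>)"
  let ?Z = "\<lambda>p. ?K \<inter> critical c (\<lambda>y. \<xi> \<bullet> ?w p y)"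
  let ?x0 = "param c z"
  have w1: "C1 (?w p)" for p
    using perturbation_in_Ck_maps[OF v good] k by (rule Ck_maps_imp_C1)
  have v1: "C1 v" using v k by (rule Ck_maps_imp_C1)
  have Zm: "?Z p \<in> sets vol" for p
    unfolding critical_eq_almost_critical sets_vol by (intro borel_closed closed_almost_critical C1_inner w1 good)
  have x0: "?x0 \<in> dom_of c" "coord c ?x0 = z"
  proof -
    have "z \<in> range_of c" using c(2,5) by (auto simp: subset_iff)
    then obtain x where "x \<in> dom_of c" "z = coord c x" by blast
    then show "?x0 \<in> dom_of c" "coord c ?x0 = z" by (simp_all add: param_coord[OF c(1)])
  qed
  have null: "emeasure vol {?x0} = 0"
    using x0 by (intro vol_null_if_chart_negligible[OF c(1)]) auto
  have partial_w: "partial c (\<lambda>y. \<xi> \<bullet> ?w p y) b x =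
      partial c (\<lambda>y. \<xi> \<bullet> v y) b x + s p * (\<xi> \<bullet> \<xi>) * frechet_derivative (bump z (2 * r)) (at (coord c x)) b"
    if x: "x \<in> dom_of c" for p b x
  proof -
    let ?y = "coord c x"
    have y: "?y \<in> range_of c" using x by simp
    have dv: "((\<lambda>y. \<xi> \<bullet> v y) \<circ> param c has_derivative frechet_derivative ((\<lambda>y. \<xi> \<bullet> v y) \<circ> param c) (at ?y)) (at ?y)"
      by (rule C1_differentiable[OF C1_inner(1)[OF v1] c(1) y])
    have db: "(bump z (2 * r) has_derivative frechet_derivative (bump z (2 * r)) (at ?y)) (at ?y)"
      using Ck_on_SucD(1)[OF Ck_on_bump[of "Suc 0" z "2 * r"], of ?y] by simp
    have "((\<lambda>y. ((\<lambda>y. \<xi> \<bullet> v y) \<circ> param c) y + s p * (\<xi> \<bullet> \<xi>) * bump z (2 * r) y) has_derivative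
        (\<lambda>h. frechet_derivative ((\<lambda>y. \<xi> \<bullet> v y) \<circ> param c) (at ?y) h + s p * (\<xi> \<bullet> \<xi>) * frechet_derivative (bump z (2 * r)) (at ?y) h)) (at ?y)"
      by (intro has_derivative_add dv has_derivative_mult_right db)
    then have "((\<lambda>y. \<xi> \<bullet> ?w p y) \<circ> param c has_derivative
        (\<lambda>h. frechet_derivative ((\<lambda>y. \<xi> \<bullet> v y) \<circ> param c) (at ?y) h + s p * (\<xi> \<bullet> \<xi>) * frechet_derivative (bump z (2 * r)) (at ?y) h)) (at ?y)"
    proof (rule has_derivative_transform_within_open[OF _ open_range[OF c(1)] y])
      fix y assume "y \<in> range_of c"
      then obtain x where "x \<in> dom_of c" "y = coord c x" by blast
      then show "((\<lambda>y. \<xi> \<bullet> v y) \<circ> param c) y + s p * (\<xi> \<bullet> \<xi>) * bump z (2 * r) y = ((\<lambda>y. \<xi> \<bullet> ?w p y) \<circ> param c) y"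
        by (simp add: param_coord[OF c(1)] bump_on_def inner_add_right)
    qed
    from frechet_derivative_at[OF this] show ?thesis unfolding partial_def by metis
  qed
  have "disjoint_family (\<lambda>p. ?Z p - {?x0})"
    unfolding disjoint_family_on_def
  proof (intro ballI impI, rule ccontr)
    fix p q :: nat assume pq: "p \<noteq> q" and "(?Z p - {?x0}) \<inter> (?Z q - {?x0}) \<noteq> {}"
    then obtain x where x: "x \<in> ?Z p" "x \<in> ?Z q" "x \<noteq> ?x0" by auto
    then have xd: "x \<in> dom_of c" "dist z (coord c x) \<le> r" by (auto simp: chart_ball_def)
    have "coord c x \<noteq> z" using x(3) param_coord[OF c(1) xd(1)] by auto
    moreover have "dist z (coord c x) < 2 * r" using xd(2) c(2) by linarith
    ultimately obtain b where b: "b \<in> Basis" "frechet_derivative (bump z (2 * r)) (at (coord c x)) b \<noteq> 0"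
      using bump_noncritical by blast
    have "partial c (\<lambda>y. \<xi> \<bullet> ?w p y) b x = 0" "partial c (\<lambda>y. \<xi> \<bullet> ?w q y) b x = 0"
      using x b by (auto simp: critical_def)
    then have "s p * (\<xi> \<bullet> \<xi>) * frechet_derivative (bump z (2 * r)) (at (coord c x)) b =
        s q * (\<xi> \<bullet> \<xi>) * frechet_derivative (bump z (2 * r)) (at (coord c x)) b"
      unfolding partial_w[OF xd(1)] by linarith
    then have "s p = s q" using b(2) \<xi> by simp
    then show False using s pq by (auto dest: injD)
  qed
  then have "(\<lambda>p. measure vol (?Z p - {?x0})) sums measure vol (\<Union>p. ?Z p - {?x0})"
    using Zm by (intro vol.finite_measure_UNION) auto
  then have "(\<lambda>p. measure vol (?Z p - {?x0})) \<longlonglongrightarrow> 0"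
    by (intro summable_LIMSEQ_zero sums_summable)
  moreover have "measure vol (?Z p - {?x0}) = measure vol (?Z p)" for p
    by (rule measure_Diff_null_set) (use null Zm in \<open>auto simp: null_sets_def\<close>)
  ultimately show ?thesis by simp
qed

lemma dense_few_critical:
  fixes \<xi> :: "real ^ 'd::finite"
  assumes k: "k \<ge> 1" and good: "good_ball c z r" and \<xi>: "\<xi> \<noteq> 0"
  shows "Ck_topology A k closure_of few_critical k \<xi> c z r m = topspace (Ck_topology A k)"
proof (rule antisym[OF closure_of_subset_topspace], rule subsetI)
  fix v :: "'m \<Rightarrow> real ^ 'd" assume v': "v \<in> topspace (Ck_topology A k)"
  then have v: "v \<in> Ck_maps A k" by (simp add: topspace_Ck_topology)
  define s :: "nat \<Rightarrow> real" where "s p = inverse (Suc p)" for p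
  have s: "s \<longlonglongrightarrow> 0" "inj s"
    unfolding s_def by (rule LIMSEQ_inverse_real_of_nat) (auto simp: inj_def)
  let ?w = "\<lambda>p x. v x + s p *\<^sub>R (bump_on c z (2 * r) x *\<^sub>R \<xi>)"
  have "\<forall>\<^sub>F p in sequentially. measure vol (chart_ball c z r \<inter> critical c (\<lambda>y. \<xi> \<bullet> ?w p y)) < 1 / Suc m"
    by (rule order_tendstoD(2)[OF critical_perturbation_tendsto[OF v k good \<xi> s(2)]]) simp
  then have U: "\<forall>\<^sub>F p in sequentially. ?w p \<in> few_critical k \<xi> c z r m"
    by eventually_elim (simp only: few_critical_def mem_Collect_eq perturbation_in_Ck_maps[OF v good] simp_thms)
  show "v \<in> Ck_topology A k closure_of few_critical k \<xi> c z r m"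
    unfolding in_closure_of
  proof (intro conjI allI impI)
    fix T assume T: "v \<in> T \<and> openin (Ck_topology A k) T"
    then have "\<forall>\<^sub>F p in sequentially. ?w p \<in> T"
      using perturbation_tendsto[OF v good _ _ s(1)] by blast
    with U have "\<forall>\<^sub>F p in sequentially. ?w p \<in> few_critical k \<xi> c z r m \<and> ?w p \<in> T"
      by (rule eventually_conj)
    then show "\<exists>y. y \<in> few_critical k \<xi> c z r m \<and> y \<in> T"
      by (auto dest!: eventually_happens)
  qed (rule v')
qed

lemma shear_criterion_if_few_critical:
  fixes v :: "'m \<Rightarrow> real ^ 'd::finite"
  assumes v: "v \<in> Ck_maps A k" "k \<ge> 1"
    and \<T>: "countable \<T>" "\<forall>(c, z, r)\<in>\<T>. good_ball c z r" "(\<Union>(c, z, r)\<in>\<T>. chart_ball c z r) = UNIV"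
    and few: "\<And>\<xi> c z r m. \<xi> \<in> integer_vectors - {0} \<Longrightarrow> (c, z, r) \<in> \<T> \<Longrightarrow> v \<in> few_critical k \<xi> c z r m"
  shows "shear_criterion A G vol v"
  unfolding shear_criterion_def null_sets_normalized
proof
  interpret vol: finite_measure vol by (rule finite_measure_vol)
  fix \<xi> :: "real ^ 'd" assume \<xi>: "\<xi> \<in> integer_vectors - {0}"
  let ?f = "\<lambda>y. \<xi> \<bullet> v y"
  have f1: "C1 ?f" by (intro C1_inner Ck_maps_imp_C1[OF v])
  have "chart_ball c z r \<inter> critical c ?f \<in> null_sets vol" if i: "(c, z, r) \<in> \<T>" for c z r
  proof -
    have "measure vol (chart_ball c z r \<inter> critical c ?f) < 1 / Suc m" for m
      using few[OF \<xi> i, of m] by (simp add: few_critical_def)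
    then have "measure vol (chart_ball c z r \<inter> critical c ?f) \<le> 0"
      by (meson nat_approx_posE not_less order.asym)
    then have "measure vol (chart_ball c z r \<inter> critical c ?f) = 0"
      by (simp add: measure_le_0_iff)
    moreover have "chart_ball c z r \<inter> critical c ?f \<in> sets vol"
      unfolding critical_eq_almost_critical sets_vol by (intro borel_closed closed_almost_critical f1) (use \<T>(2) i in auto)
    ultimately show ?thesis by (simp add: null_sets_def vol.emeasure_eq_measure)
  qed
  then have "(\<Union>(c, z, r)\<in>\<T>. chart_ball c z r \<inter> critical c ?f) \<in> null_sets vol"
    using \<T>(1) by (intro null_sets_UN') auto
  moreover have "{x. gradient_vanishes A G ?f x} \<in> sets vol"
    using closed_gradient_vanishes[OF f1] by simp
  moreover have "{x. gradient_vanishes A G ?f x} \<subseteq> (\<Union>(c, z, r)\<in>\<T>. chart_ball c z r \<inter> critical c ?f)"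
  proof
    fix x assume "x \<in> {x. gradient_vanishes A G ?f x}"
    moreover obtain c z r where "(c, z, r) \<in> \<T>" "x \<in> chart_ball c z r" using \<T>(3) by blast
    moreover from this have "c \<in> A" "x \<in> dom_of c" using \<T>(2) by (auto simp: good_ball_def chart_ball_def)
    ultimately show "x \<in> (\<Union>(c, z, r)\<in>\<T>. chart_ball c z r \<inter> critical c ?f)"
      by (auto simp: gradient_vanishes_iff)
  qed
  ultimately show "{x. gradient_vanishes A G ?f x} \<in> null_sets vol"
    by (rule null_sets_subset)
qed

lemma shear_criterion_generic:
  assumes k: "k \<ge> 1"
  shows "baire_generic (Ck_topology A k :: ('m \<Rightarrow> real ^ 'd::finite) topology)
    {v \<in> Ck_maps A k. shear_criterion A G vol v}"
proof -
  obtain \<T> where \<T>: "countable \<T>" "\<forall>(c, z, r)\<in>\<T>. good_ball c z r"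
    "(\<Union>(c, z, r)\<in>\<T>. chart_ball c z r) = UNIV"
    by (rule countable_good_cover)
  let ?\<U> = "(\<lambda>(\<xi> :: real ^ 'd, (c, z, r), m). few_critical k \<xi> c z r m) ` ((integer_vectors - {0}) \<times> \<T> \<times> UNIV)"
  show ?thesis
    unfolding baire_generic_def topspace_Ck_topology
  proof (intro conjI exI[of _ ?\<U>] ballI)
    show "countable ?\<U>"
      using \<T>(1) countable_integer_vectors by (intro countable_image countable_SIGMA countable_Diff) auto
    show "openin (Ck_topology A k) U" if "U \<in> ?\<U>" for U
      using that \<T>(2) by (auto intro!: openin_few_critical[OF k])
    show "Ck_topology A k closure_of U = Ck_maps A k" if "U \<in> ?\<U>" for U
      using that \<T>(2) dense_few_critical[OF k] by (fastforce simp: topspace_Ck_topology)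
    show "Ck_maps A k \<inter> \<Inter>?\<U> \<subseteq> {v \<in> Ck_maps A k. shear_criterion A G vol v}"
    proof safe
      fix v assume v: "v \<in> Ck_maps A k" "v \<in> \<Inter>?\<U>"
      show "shear_criterion A G vol v"
      proof (rule shear_criterion_if_few_critical[OF v(1) k \<T>])
        fix \<xi> :: "real ^ 'd" and c z r m
        assume "\<xi> \<in> integer_vectors - {0}" "(c, z, r) \<in> \<T>"
        then have "few_critical k \<xi> c z r m \<in> ?\<U>" by (intro image_eqI[where x = "(\<xi>, (c, z, r), m)"]) auto
        then show "v \<in> few_critical k \<xi> c z r m" using v(2) by blast
      qed
    qed
  qed auto
qed

end

theorem proposition0p2:
  fixes A :: "('m::{t2_space,second_countable_topology}, 'n::finite) chart set"
    and G :: "('m, 'n) chart \<Rightarrow> 'm \<Rightarrow> real ^ 'n ^ 'n"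
    and vol :: "'m measure"
    and k :: enat
  assumes "riemannian_manifold A G"
    and "riemannian_volume A G vol"
    and "emeasure vol UNIV < \<infinity>"
    and "k \<ge> 1"
  shows "(\<forall>v :: 'm \<Rightarrow> real ^ 'd::finite.
            v \<in> Ck_maps A k \<and> shear_criterion A G vol v \<longrightarrow>
            keplerian_shear (normalized vol \<Otimes>\<^sub>M torus_measure) (shear_flow v)) \<and>
         baire_generic (Ck_topology A k :: ('m \<Rightarrow> real ^ 'd) topology)
           {v \<in> Ck_maps A k. shear_criterion A G vol v}"
proof -
  interpret finite_volume_manifold A G vol
    using assms(1-3) by unfold_locales
  show ?thesis
    using shear_criterion_imp_keplerian_shear shear_criterion_generic assms(4) by blast
qed

end
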